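(* Let $G=\mathrm{OSp}(V)$ and $d=m-2n$. There is a unique additive covariant functor $F:\mathcal{B}(d)\to\mathcal{T}_G(V)$ such that (i) $F$ sends the object $r$ to $V^{\otimes_\Lambda r}$, and sends the elementary diagrams to $F(I)=\mathrm{id}_V$, $F(X)=\tau$, $F(U)=\check C$, $F(A)=\hat C$; (ii) $F$ respects tensor products: $F(r\otimes r')=V^{\otimes_\Lambda r}\otimes_\Lambda V^{\otimes_\Lambda r'}$ and $F(D\otimes D')=F(D)\otimes_\Lambda F(D')$ for all morphisms $D,D'$.
   Context: $\Lambda=\varinjlim\wedge(\mathbb{C}^N)$ is the infinite Grassmann algebra ($\mathbb{Z}_2$-graded, supercommutative; modules are $\mathbb{Z}_2$-graded with $\lambda v=(-1)^{[\lambda][v]}v\lambda$). $V_{\mathbb{C}}$ has superdimension $(m|2n)$, nondegenerate even supersymmetric form, and homogeneous basis $e_1,\dots,e_{m+2n}$ ($e_1,\dots,e_m$ even) with $(e_a,e_b)=\eta_{ab}$, $\eta=\mathrm{diag}(I_m,J)$, $J$ block diagonal with $n$ blocks $\begin{pmatrix}0&-1\\1&0\end{pmatrix}$; $\eta^{ab}$ denote the entries of $\eta^{-1}$. $V=V_{\mathbb{C}}\otimes\Lambda$ with the $\Lambda$-bilinear extension of the form; $\mathrm{OSp}(V)$ is the group of invertible even $\Lambda$-linear endomorphisms preserving the form. Maps: $\tau:V\otimes V\to V\otimes V$, $v\otimes w\mapsto(-1)^{[v][w]}w\otimes v$; $\check C:\Lambda\to V\otimes V$, $1\mapsto c_0=\sum_{a,b}e_a\otimes\eta^{ab}e_b$;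 $\hat C:V\otimes V\to\Lambda$, $v\otimes w\mapsto(v,w)$. Brauer category $\mathcal{B}(\delta)$ ($\delta\in\Lambda_{\bar0}$): objects $0,1,2,\dots$; $\mathrm{Hom}(k,\ell)=B_k^\ell(\delta)$, the free $\Lambda$-module with even basis the $(k,\ell)$ Brauer diagrams (partitions of $k$ bottom and $\ell$ top points into pairs); composition is concatenation of diagrams, each closed loop removed being replaced by a factor $\delta$, extended $\Lambda$-bilinearly; tensor product on objects is $k\otimes\ell=k+\ell$ and on diagrams is juxtaposition. The elementary diagrams are $I$ (the $(1,1)$ identity), $X$ (the $(2,2)$ crossing), $A$ (the $(2,0)$ cap) and $U$ (the $(0,2)$ cup); they generate all diagrams under composition and tensor product. $\mathcal{T}_G(V)$ is the full subcategory of $G$-modules with objects $V^{\otimes_\Lambda r}$, $r\ge0$, whose morphisms are $G$-equivariant $\Lambda$-linear maps, with tensor product over $\Lambda$.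
   Formalization: "Additive functor" is read as Λ-linear functor (additive and F(aD)=aF(D) for a in Λ); with additivity alone uniqueness fails, since complex-conjugating the coefficients in Λ before applying F gives another additive tensor functor with the same values on I, X, U, A. *)

theory Defs
  imports Complex_Main "HOL-Library.Function_Algebras"
begin

text \<open>An element of Lambda is a finitely supported complex function on finite sets
  S of generator indices; S stands for the ascending monomial of the generators in S.\<close>

type_synonym gr = "nat set \<Rightarrow> complex"

definition gelem :: "gr \<Rightarrow> bool" where
  "gelem a \<longleftrightarrow> finite {S. a S \<noteq> 0} \<and> (\<forall>S. a S \<noteq> 0 \<longrightarrow> finite S)"

definition gscal :: "complex \<Rightarrow> gr" where
  "gscal c = (\<lambda>S. if S = {} then c else 0)"

definition gone :: gr where
  "gone = gscal 1"

definition gsign :: "nat set \<Rightarrow> nat set \<Rightarrow> complex" where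
  "gsign T U = (-1) ^ card {(i, j). i \<in> T \<and> j \<in> U \<and> j < i}"

definition gmult :: "gr \<Rightarrow> gr \<Rightarrow> gr" where
  "gmult a b = (\<lambda>S. \<Sum>T\<in>Pow S. gsign T (S - T) * a T * b (S - T))"

fun gpowr :: "gr \<Rightarrow> nat \<Rightarrow> gr" where
  "gpowr a 0 = gone"
| "gpowr a (Suc k) = gmult (gpowr a k) a"

definition gpart :: "nat \<Rightarrow> gr \<Rightarrow> gr" where
  "gpart p a = (\<lambda>S. if card S mod 2 = p mod 2 then a S else 0)"

definition gflip :: "gr \<Rightarrow> gr" where
  "gflip a = (\<lambda>S. (-1) ^ card S * a S)"

text \<open>Basis indices 0..m+2n-1; index a is even iff a < m.  The parity of a word
  (basis tensor e_w = e_{w1} tensor ... tensor e_{wr}) is the number of odd letters mod 2.\<close>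

definition wpar :: "nat \<Rightarrow> nat list \<Rightarrow> nat" where
  "wpar m w = length (filter (\<lambda>a. m \<le> a) w) mod 2"

definition gflipw :: "nat \<Rightarrow> nat list \<Rightarrow> gr \<Rightarrow> gr" where
  "gflipw m w a = (if wpar m w = 1 then gflip a else a)"

definition words :: "nat \<Rightarrow> nat \<Rightarrow> nat \<Rightarrow> nat list set" where
  "words m n r = {w. length w = r \<and> (\<forall>a\<in>set w. a < m + 2 * n)}"

text \<open>An element x of V^{tensor r} is written as sum over words w of e_w * x w
  (coefficients on the right).\<close>

type_synonym vt = "nat list \<Rightarrow> gr"
type_synonym vmap = "vt \<Rightarrow> vt"

definition tens :: "nat \<Rightarrow> nat \<Rightarrow> nat \<Rightarrow> vt set" where
  "tens m n r = {x. (\<forall>w. w \<notin> words m n r \<longrightarrow> x w = 0) \<and> (\<forall>w. gelem (x w))}"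

definition rsmul :: "vt \<Rightarrow> gr \<Rightarrow> vt" where
  "rsmul x c = (\<lambda>w. gmult (x w) c)"

text \<open>left action: c * e_w * x_w = e_w * (c twisted by the parity of w) * x_w\<close>
definition lsmul :: "nat \<Rightarrow> gr \<Rightarrow> vt \<Rightarrow> vt" where
  "lsmul m c x = (\<lambda>w. gmult (gflipw m w c) (x w))"

definition vbasis :: "nat list \<Rightarrow> vt" where
  "vbasis w = (\<lambda>w'. if w' = w then gone else 0)"

text \<open>tensor product of x in V^{tensor k} and y: (e_u a)(e_v b) = e_u e_v (a twisted by v) b\<close>
definition vtens :: "nat \<Rightarrow> nat \<Rightarrow> vt \<Rightarrow> vt \<Rightarrow> vt" where
  "vtens m k x y = (\<lambda>w. gmult (gflipw m (drop k w) (x (take k w))) (y (drop k w)))"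

definition is_lin :: "nat \<Rightarrow> nat \<Rightarrow> nat \<Rightarrow> nat \<Rightarrow> vmap \<Rightarrow> bool" where
  "is_lin m n k l f \<longleftrightarrow>
     (\<forall>x\<in>tens m n k. f x \<in> tens m n l) \<and>
     (\<forall>x\<in>tens m n k. \<forall>y\<in>tens m n k. f (x + y) = f x + f y) \<and>
     (\<forall>x\<in>tens m n k. \<forall>c. gelem c \<longrightarrow> f (rsmul x c) = rsmul (f x) c)"

definition lin_ext :: "nat \<Rightarrow> nat \<Rightarrow> nat \<Rightarrow> (nat list \<Rightarrow> vt) \<Rightarrow> vmap" where
  "lin_ext m n k B = (\<lambda>z. \<Sum>w\<in>words m n k. rsmul (B w) (z w))"

definition vev :: "nat \<Rightarrow> vt \<Rightarrow> vt" where
  "vev m x = (\<lambda>w. gpart (wpar m w) (x w))"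

definition vodd :: "nat \<Rightarrow> vt \<Rightarrow> vt" where
  "vodd m x = (\<lambda>w. gpart (wpar m w + 1) (x w))"

definition mev :: "nat \<Rightarrow> vmap \<Rightarrow> vmap" where
  "mev m f = (\<lambda>x. vev m (f (vev m x)) + vodd m (f (vodd m x)))"

definition modd :: "nat \<Rightarrow> vmap \<Rightarrow> vmap" where
  "modd m f = (\<lambda>x. vodd m (f (vev m x)) + vev m (f (vodd m x)))"

text \<open>tensor product of maps f : V^k \<rightarrow> V^l and g : V^k' \<rightarrow> V^l' with the sign rule
  (f tensor g)(x tensor y) = (-1)^{[g][x]} f(x) tensor g(y)\<close>
definition mtens :: "nat \<Rightarrow> nat \<Rightarrow> nat \<Rightarrow> nat \<Rightarrow> nat \<Rightarrow> vmap \<Rightarrow> vmap \<Rightarrow> vmap" where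
  "mtens m n k l k' f g = lin_ext m n (k + k')
     (\<lambda>w. vtens m l (f (vbasis (take k w))) (mev m g (vbasis (drop k w))) +
          (if wpar m (take k w) = 0
           then vtens m l (f (vbasis (take k w))) (modd m g (vbasis (drop k w)))
           else - vtens m l (f (vbasis (take k w))) (modd m g (vbasis (drop k w)))))"

definition eta :: "nat \<Rightarrow> nat \<Rightarrow> nat \<Rightarrow> complex" where
  "eta m a b =
    (if a < m \<and> b < m then (if a = b then 1 else 0)
     else if m \<le> a \<and> m \<le> b then
       (if even (a - m) \<and> b = a + 1 then -1 else if odd (a - m) \<and> a = b + 1 then 1 else 0)
     else 0)"

definition eta_inv :: "nat \<Rightarrow> nat \<Rightarrow> nat \<Rightarrow> complex" where
  "eta_inv m a b =
    (if a < m \<and> b < m then (if a = b then 1 else 0)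
     else if m \<le> a \<and> m \<le> b then
       (if even (a - m) \<and> b = a + 1 then 1 else if odd (a - m) \<and> a = b + 1 then -1 else 0)
     else 0)"

text \<open>Lambda-bilinear extension of the form: (e_a x, e_b y) = eta_ab (x twisted by b) y\<close>
definition vform :: "nat \<Rightarrow> nat \<Rightarrow> vt \<Rightarrow> vt \<Rightarrow> gr" where
  "vform m n x y = (\<Sum>a<m + 2 * n. \<Sum>b<m + 2 * n.
      gmult (gscal (eta m a b)) (gmult (gflipw m [b] (x [a])) (y [b])))"

definition is_osp :: "nat \<Rightarrow> nat \<Rightarrow> vmap \<Rightarrow> bool" where
  "is_osp m n g \<longleftrightarrow> is_lin m n 1 1 g \<and> (\<forall>x\<in>tens m n 1. mev m g x = g x) \<and>
     bij_betw g (tens m n 1) (tens m n 1) \<and>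
     (\<forall>x\<in>tens m n 1. \<forall>y\<in>tens m n 1. vform m n (g x) (g y) = vform m n x y)"

fun gtpow :: "nat \<Rightarrow> nat \<Rightarrow> vmap \<Rightarrow> nat \<Rightarrow> vmap" where
  "gtpow m n g 0 = id"
| "gtpow m n g (Suc r) = mtens m n r r 1 (gtpow m n g r) g"

definition equivariant :: "nat \<Rightarrow> nat \<Rightarrow> nat \<Rightarrow> nat \<Rightarrow> vmap \<Rightarrow> bool" where
  "equivariant m n k l f \<longleftrightarrow> (\<forall>g. is_osp m n g \<longrightarrow>
      (\<forall>x\<in>tens m n k. f (gtpow m n g k x) = gtpow m n g l (f x)))"

definition tau :: "nat \<Rightarrow> nat \<Rightarrow> vmap" where
  "tau m n = lin_ext m n 2 (\<lambda>w. if m \<le> w ! 0 \<and> m \<le> w ! 1 then - vbasis (rev w) else vbasis (rev w))"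

definition c0 :: "nat \<Rightarrow> nat \<Rightarrow> vt" where
  "c0 m n = (\<lambda>w. if w \<in> words m n 2 then gscal (eta_inv m (w ! 0) (w ! 1)) else 0)"

definition Ccheck :: "nat \<Rightarrow> nat \<Rightarrow> vmap" where
  "Ccheck m n = lin_ext m n 0 (\<lambda>_. c0 m n)"

definition Chat :: "nat \<Rightarrow> nat \<Rightarrow> vmap" where
  "Chat m n = lin_ext m n 2 (\<lambda>w. (\<lambda>w'. if w' = [] then gscal (eta m (w ! 0) (w ! 1)) else 0))"

text \<open>A (k,l) Brauer diagram: fixed-point-free involution on the points 0..k+l-1,
  points 0..k-1 are the bottom row and k..k+l-1 the top row (identity elsewhere).\<close>

definition brauer :: "nat \<Rightarrow> nat \<Rightarrow> (nat \<Rightarrow> nat) \<Rightarrow> bool" where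
  "brauer k l p \<longleftrightarrow> (\<forall>i<k + l. p i < k + l \<and> p i \<noteq> i \<and> p (p i) = i) \<and>
                    (\<forall>i. k + l \<le> i \<longrightarrow> p i = i)"

definition diagrams :: "nat \<Rightarrow> nat \<Rightarrow> (nat \<Rightarrow> nat) set" where
  "diagrams k l = {p. brauer k l p}"

text \<open>Concatenation of p1 : k \<rightarrow> l (below) and p2 : l \<rightarrow> q (above); points of the glued
  picture: 0..k-1 bottom, k..k+l-1 middle, k+l..k+l+q-1 top.\<close>
definition dglue :: "nat \<Rightarrow> nat \<Rightarrow> nat \<Rightarrow> (nat \<Rightarrow> nat) \<Rightarrow> (nat \<Rightarrow> nat) \<Rightarrow> (nat \<times> nat) set" where
  "dglue k l q p2 p1 = (({(i, p1 i) | i. i < k + l} \<union> {(k + i, k + p2 i) | i. i < l + q}))\<^sup>*"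

definition douter :: "nat \<Rightarrow> nat \<Rightarrow> nat \<Rightarrow> nat" where
  "douter k l i = (if i < k then i else i + l)"

definition dcomp :: "nat \<Rightarrow> nat \<Rightarrow> nat \<Rightarrow> (nat \<Rightarrow> nat) \<Rightarrow> (nat \<Rightarrow> nat) \<Rightarrow> (nat \<Rightarrow> nat)" where
  "dcomp k l q p2 p1 = (\<lambda>i. if i < k + q then
      (THE j. j < k + q \<and> j \<noteq> i \<and> (douter k l i, douter k l j) \<in> dglue k l q p2 p1) else i)"

definition dloops :: "nat \<Rightarrow> nat \<Rightarrow> nat \<Rightarrow> (nat \<Rightarrow> nat) \<Rightarrow> (nat \<Rightarrow> nat) \<Rightarrow> nat" where
  "dloops k l q p2 p1 = card {C. \<exists>x. k \<le> x \<and> x < k + l \<and>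
      C = dglue k l q p2 p1 `` {x} \<and> C \<subseteq> {k..<k + l}}"

definition demb1 :: "nat \<Rightarrow> nat \<Rightarrow> nat \<Rightarrow> nat" where
  "demb1 k k' i = (if i < k then i else i + k')"

definition demb2 :: "nat \<Rightarrow> nat \<Rightarrow> nat \<Rightarrow> nat \<Rightarrow> nat" where
  "demb2 k k' l i = (if i < k' then k + i else i + k + l)"

definition dtens :: "nat \<Rightarrow> nat \<Rightarrow> nat \<Rightarrow> nat \<Rightarrow> (nat \<Rightarrow> nat) \<Rightarrow> (nat \<Rightarrow> nat) \<Rightarrow> (nat \<Rightarrow> nat)" where
  "dtens k l k' l' p p' = (\<lambda>j.
     if j < k then demb1 k k' (p j)
     else if j < k + k' then demb2 k k' l (p' (j - k))
     else if j < k + k' + l then demb1 k k' (p (j - k'))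
     else if j < k + k' + l + l' then demb2 k k' l (p' (j - k - l))
     else j)"

definition did :: "nat \<Rightarrow> nat \<Rightarrow> nat" where
  "did k = (\<lambda>i. if i < k then i + k else if i < 2 * k then i - k else i)"

definition dI :: "nat \<Rightarrow> nat" where "dI = did 1"

definition dX :: "nat \<Rightarrow> nat" where
  "dX = (\<lambda>i. if i = 0 then 3 else if i = 1 then 2 else if i = 2 then 1 else if i = 3 then 0 else i)"

text \<open>cap (2,0) and cup (0,2): both join the two points 0 and 1\<close>
definition dA :: "nat \<Rightarrow> nat" where
  "dA = (\<lambda>i. if i = 0 then 1 else if i = 1 then 0 else i)"

definition dU :: "nat \<Rightarrow> nat" where
  "dU = (\<lambda>i. if i = 0 then 1 else if i = 1 then 0 else i)"

text \<open>Morphisms of B(delta): Lambda-linear combinations of diagrams\<close>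
type_synonym bm = "(nat \<Rightarrow> nat) \<Rightarrow> gr"

definition bmor :: "nat \<Rightarrow> nat \<Rightarrow> bm set" where
  "bmor k l = {c. (\<forall>D. D \<notin> diagrams k l \<longrightarrow> c D = 0) \<and> (\<forall>D. gelem (c D))}"

definition bdiag :: "(nat \<Rightarrow> nat) \<Rightarrow> bm" where
  "bdiag D = (\<lambda>E. if E = D then gone else 0)"

definition bsmul :: "gr \<Rightarrow> bm \<Rightarrow> bm" where
  "bsmul a c = (\<lambda>D. gmult a (c D))"

definition bcomp :: "gr \<Rightarrow> nat \<Rightarrow> nat \<Rightarrow> nat \<Rightarrow> bm \<Rightarrow> bm \<Rightarrow> bm" where
  "bcomp \<delta> k l q c2 c1 = (\<lambda>E. \<Sum>D1\<in>diagrams k l. \<Sum>D2\<in>diagrams l q.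
      if dcomp k l q D2 D1 = E
      then gmult (gmult (c2 D2) (c1 D1)) (gpowr \<delta> (dloops k l q D2 D1)) else 0)"

definition btens :: "nat \<Rightarrow> nat \<Rightarrow> nat \<Rightarrow> nat \<Rightarrow> bm \<Rightarrow> bm \<Rightarrow> bm" where
  "btens k l k' l' c c' = (\<lambda>E. \<Sum>D\<in>diagrams k l. \<Sum>D'\<in>diagrams k' l'.
      if dtens k l k' l' D D' = E then gmult (c D) (c' D') else 0)"

definition brauer_functor :: "nat \<Rightarrow> nat \<Rightarrow> (nat \<Rightarrow> nat \<Rightarrow> bm \<Rightarrow> vmap) \<Rightarrow> bool" where
  "brauer_functor m n F \<longleftrightarrow>
    (let \<delta> = gscal (of_int (int m - 2 * int n)) in
     (\<forall>k l c. c \<in> bmor k l \<longrightarrow> is_lin m n k l (F k l c) \<and> equivariant m n k l (F k l c)) \<and>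
     (\<forall>k l c c'. c \<in> bmor k l \<longrightarrow> c' \<in> bmor k l \<longrightarrow>
        (\<forall>x\<in>tens m n k. F k l (c + c') x = F k l c x + F k l c' x)) \<and>
     (\<forall>k l a c. gelem a \<longrightarrow> c \<in> bmor k l \<longrightarrow>
        (\<forall>x\<in>tens m n k. F k l (bsmul a c) x = lsmul m a (F k l c x))) \<and>
     (\<forall>k. \<forall>x\<in>tens m n k. F k k (bdiag (did k)) x = x) \<and>
     (\<forall>k l q c1 c2. c1 \<in> bmor k l \<longrightarrow> c2 \<in> bmor l q \<longrightarrow>
        (\<forall>x\<in>tens m n k. F k q (bcomp \<delta> k l q c2 c1) x = F l q c2 (F k l c1 x))) \<and>
     (\<forall>x\<in>tens m n 1. F 1 1 (bdiag dI) x = x) \<and>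
     (\<forall>x\<in>tens m n 2. F 2 2 (bdiag dX) x = tau m n x) \<and>
     (\<forall>x\<in>tens m n 0. F 0 2 (bdiag dU) x = Ccheck m n x) \<and>
     (\<forall>x\<in>tens m n 2. F 2 0 (bdiag dA) x = Chat m n x) \<and>
     (\<forall>k l k' l' c c'. c \<in> bmor k l \<longrightarrow> c' \<in> bmor k' l' \<longrightarrow>
        (\<forall>x\<in>tens m n (k + k'). F (k + k') (l + l') (btens k l k' l' c c') x =
                                mtens m n k l k' (F k l c) (F k' l' c') x)))"

end

theory Submission
  imports Defs "HOL-Library.Multiset"
begin

text \<open>A diagram is sent to an explicit state sum. Attach to every bottom point a basis vector
  \<open>e\<^sub>a\<close> and to every top point a dual basis vector, read the boundary of the diagram once
  around (bottom row forwards, top row backwards), and pair matched points with the form, with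
  the Koszul sign for bringing them together. This Pfaffian-like number behaves supersymmetrically
  under exchange of neighbouring points, so summing over the colours of two neighbouring
  points joins their strands, or closes a loop with value \<open>m - 2n\<close>, the superdimension. Contracting
  the middle row of a glued picture in this way, one pair at a time, yields functoriality.
  Equivariance and uniqueness both follow from the fact that the elementary diagrams generate all
  diagrams without creating closed loops: bending the top points down reduces this to diagrams
  without top points, where adjacent crossings let a cap split off.\<close>

section \<open>The Grassmann algebra\<close>

text \<open>Two difficulties shape the construction. Defining the functor on words in the elementary
  diagrams would require all relations between such words; a state sum gives a value to every
  diagram at once, and the elementary diagrams only have to be evaluated. Moreover the scalar
  \<open>m - 2 * n\<close> can be zero, so a factorization that creates loops would determine only a
  possibly vanishing multiple of the image of a diagram; hence generation has to be loop-free. The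
  top row is read backwards so that, when two diagrams are stacked, the two copies of the middle row
  meet back to back: the innermost pair is adjacent, and after its contraction the next one is. The
  same order puts the boundary of the second factor of a juxtaposition into one block between the
  bottom and the top of the first. A nonvanishing state sum has an even number of odd colours; so
  diagrams act as even maps, and Grassmann coefficients pass them with signs that depend only on the
  parity of a word.\<close>

lemma gsign_Un_left:
  assumes "finite T" "finite U" "finite W" "T \<inter> U = {}"
  shows "gsign (T \<union> U) W = gsign T W * gsign U W"
proof -
  have "{(i, j). i \<in> T \<union> U \<and> j \<in> W \<and> j < i} =
      {(i, j). i \<in> T \<and> j \<in> W \<and> j < i} \<union> {(i, j). i \<in> U \<and> j \<in> W \<and> j < i}" by auto
  moreover have "finite {(i, j). i \<in> T \<and> j \<in> W \<and> j < i}"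
    by (rule finite_subset[of _ "T \<times> W"]) (use assms in auto)
  moreover have "finite {(i, j). i \<in> U \<and> j \<in> W \<and> j < i}"
    by (rule finite_subset[of _ "U \<times> W"]) (use assms in auto)
  moreover have "{(i, j). i \<in> T \<and> j \<in> W \<and> j < i} \<inter> {(i, j). i \<in> U \<and> j \<in> W \<and> j < i} = {}"
    using assms by auto
  ultimately show ?thesis
    unfolding gsign_def by (simp add: card_Un_disjoint power_add)
qed

lemma gsign_Un_right:
  assumes "finite T" "finite U" "finite W" "U \<inter> W = {}"
  shows "gsign T (U \<union> W) = gsign T U * gsign T W"
proof -
  have "{(i, j). i \<in> T \<and> j \<in> U \<union> W \<and> j < i} =
      {(i, j). i \<in> T \<and> j \<in> U \<and> j < i} \<union> {(i, j). i \<in> T \<and> j \<in> W \<and> j < i}" by auto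
  moreover have "finite {(i, j). i \<in> T \<and> j \<in> U \<and> j < i}"
    by (rule finite_subset[of _ "T \<times> U"]) (use assms in auto)
  moreover have "finite {(i, j). i \<in> T \<and> j \<in> W \<and> j < i}"
    by (rule finite_subset[of _ "T \<times> W"]) (use assms in auto)
  moreover have "{(i, j). i \<in> T \<and> j \<in> U \<and> j < i} \<inter> {(i, j). i \<in> T \<and> j \<in> W \<and> j < i} = {}"
    using assms by auto
  ultimately show ?thesis
    unfolding gsign_def by (simp add: card_Un_disjoint power_add)
qed

text \<open>Each pair in \<open>T \<times> U\<close> is an inversion for exactly one of the two
  orders, so the two inversion counts add up to \<open>card T * card U\<close>.\<close>

lemma gsign_swap:
  assumes "finite T" "finite U" "T \<inter> U = {}"
  shows "gsign T U = (-1) ^ (card T * card U) * gsign U T"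
proof -
  let ?A = "{(i, j). i \<in> T \<and> j \<in> U \<and> j < i}" and ?B = "{(i, j). i \<in> U \<and> j \<in> T \<and> j < i}"
  have fA: "finite ?A" by (rule finite_subset[of _ "T \<times> U"]) (use assms in auto)
  have fB: "finite ?B" by (rule finite_subset[of _ "U \<times> T"]) (use assms in auto)
  have "?A \<union> prod.swap ` ?B = T \<times> U"
  proof
    show "T \<times> U \<subseteq> ?A \<union> prod.swap ` ?B"
    proof
      fix x assume "x \<in> T \<times> U"
      then obtain i j where x: "x = (i, j)" "i \<in> T" "j \<in> U" by auto
      with assms(3) have "j < i \<or> i < j" by (metis IntI empty_iff linorder_neqE_nat)
      with x show "x \<in> ?A \<union> prod.swap ` ?B" by (auto simp: image_iff)
    qed
  qed auto
  moreover have "card (?A \<union> prod.swap ` ?B) = card ?A + card (prod.swap ` ?B)"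
    using fA fB by (intro card_Un_disjoint) auto
  moreover have "card (prod.swap ` ?B) = card ?B" by (intro card_image) simp
  ultimately have "card T * card U = card ?A + card ?B"
    by (simp add: card_cartesian_product)
  then show ?thesis
    unfolding gsign_def by (simp add: power_add mult.assoc flip: power_mult_distrib)
qed

text \<open>A sum over an infinite set is \<open>0\<close>, so \<^const>\<open>gmult\<close> vanishes on infinite sets and is
  associative and bilinear without any support hypothesis.\<close>

lemma gmult_infinite: "infinite S \<Longrightarrow> gmult a b S = 0"
  by (simp add: gmult_def)

lemma gmult_assoc: "gmult (gmult a b) c = gmult a (gmult b c)"
proof
  fix S
  show "gmult (gmult a b) c S = gmult a (gmult b c) S"
  proof (cases "finite S")
    case True
    have "gmult (gmult a b) c S = (\<Sum>(R, T)\<in>Sigma (Pow S) Pow.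
        gsign R (S - R) * (gsign T (R - T) * a T * b (R - T)) * c (S - R))"
      using True by (simp add: gmult_def sum_distrib_left sum_distrib_right sum.Sigma finite_subset)
    \<comment> \<open>Chains \<open>T \<subseteq> R \<subseteq> S\<close> correspond to pairs of
      disjoint sets \<open>T\<close> and \<open>U = R - T\<close>. Multiplicativity of
      \<open>gsign\<close> on disjoint unions turns both sign products into the same product of
      three signs.\<close>
    also have "\<dots> = (\<Sum>(T, U)\<in>Sigma (Pow S) (\<lambda>T. Pow (S - T)).
        gsign T (S - T) * a T * (gsign U (S - T - U) * b U * c (S - T - U)))"
    proof (rule sum.reindex_bij_witness[where i = "\<lambda>(T, U). (T \<union> U, T)" and j = "\<lambda>(R, T). (T, R - T)"])
      fix x assume "x \<in> Sigma (Pow S) Pow"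
      then obtain R T where x: "x = (R, T)" "R \<subseteq> S" "T \<subseteq> R" by auto
      have fin: "finite R" "finite T" using x True by (auto intro: finite_subset)
      have 1: "gsign R (S - R) = gsign T (S - R) * gsign (R - T) (S - R)"
        using gsign_Un_left[of T "R - T" "S - R"] fin True x by (simp add: Un_absorb1)
      have 2: "gsign T (S - T) = gsign T (R - T) * gsign T (S - R)"
      proof -
        have "S - T = (R - T) \<union> (S - R)" using x by auto
        then show ?thesis using gsign_Un_right[of T "R - T" "S - R"] fin True x by auto
      qed
      have 3: "S - T - (R - T) = S - R" using x by auto
      show "(case (case x of (R, T) \<Rightarrow> (T, R - T)) of (T, U) \<Rightarrow>
          gsign T (S - T) * a T * (gsign U (S - T - U) * b U * c (S - T - U))) =
        (case x of (R, T) \<Rightarrow> gsign R (S - R) * (gsign T (R - T) * a T * b (R - T)) * c (S - R))"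
        using 1 2 3 x by simp
    qed auto
    also have "\<dots> = gmult a (gmult b c) S"
      using True by (simp add: gmult_def sum_distrib_left sum.Sigma)
    finally show ?thesis .
  qed (simp add: gmult_infinite)
qed

lemma gmult_add_left: "gmult (a + b) c = gmult a c + gmult b c"
  by (rule ext) (simp add: gmult_def algebra_simps sum.distrib)

lemma gmult_add_right: "gmult a (b + c) = gmult a b + gmult a c"
  by (rule ext) (simp add: gmult_def algebra_simps sum.distrib)

lemma gmult_minus_left: "gmult (- a) c = - gmult a c"
  by (rule ext) (simp add: gmult_def sum_negf)

lemma gmult_minus_right: "gmult a (- c) = - gmult a c"
  by (rule ext) (simp add: gmult_def sum_negf)

lemma gmult_0_left [simp]: "gmult 0 a = 0"
  by (rule ext) (simp add: gmult_def)

lemma gmult_0_right [simp]: "gmult a 0 = 0"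
  by (rule ext) (simp add: gmult_def)

lemma gmult_sum_left: "gmult (sum f A) b = (\<Sum>i\<in>A. gmult (f i) b)"
  using sum_comp_morphism[of "\<lambda>a. gmult a b" f A] by (simp add: gmult_add_left comp_def)

lemma gmult_sum_right: "gmult b (sum f A) = (\<Sum>i\<in>A. gmult b (f i))"
  using sum_comp_morphism[of "gmult b" f A] by (simp add: gmult_add_right comp_def)

lemma gelem_infinite: "gelem a \<Longrightarrow> infinite S \<Longrightarrow> a S = 0"
  by (auto simp: gelem_def)

lemma gelem_0 [simp]: "gelem 0"
  by (simp add: gelem_def)

lemma gelem_gscal [simp]: "gelem (gscal c)"
  by (auto simp: gelem_def gscal_def intro: finite_subset[of _ "{{}}"] split: if_splits)

lemma gelem_gone [simp]: "gelem gone"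
  by (simp add: gone_def)

lemma gelem_add [simp]:
  assumes "gelem a" "gelem b"
  shows "gelem (a + b)"
proof -
  have "{S. (a + b) S \<noteq> 0} \<subseteq> {S. a S \<noteq> 0} \<union> {S. b S \<noteq> 0}" by auto
  moreover have "finite ({S. a S \<noteq> 0} \<union> {S. b S \<noteq> 0})"
    using assms by (simp add: gelem_def)
  moreover have "finite S" if "(a + b) S \<noteq> 0" for S
    using that assms gelem_infinite by (metis add_0 plus_fun_apply)
  ultimately show ?thesis
    unfolding gelem_def by (meson finite_subset)
qed

lemma gelem_minus [simp]: "gelem (- a) = gelem a"
  by (simp add: gelem_def)

lemma gelem_sum: "(\<And>i. i \<in> A \<Longrightarrow> gelem (f i)) \<Longrightarrow> gelem (sum f A)"
  by (induction A rule: infinite_finite_induct) simp_all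

lemma gelem_gmult [simp]:
  assumes "gelem a" "gelem b"
  shows "gelem (gmult a b)"
proof -
  have *: "\<exists>T U. S = T \<union> U \<and> a T \<noteq> 0 \<and> b U \<noteq> 0" if S: "gmult a b S \<noteq> 0" for S
  proof -
    obtain T where "T \<in> Pow S" "gsign T (S - T) * a T * b (S - T) \<noteq> 0"
      using S unfolding gmult_def by (meson sum.not_neutral_contains_not_neutral)
    then show ?thesis by (intro exI[of _ T] exI[of _ "S - T"]) auto
  qed
  have "{S. gmult a b S \<noteq> 0} \<subseteq> (\<lambda>(T, U). T \<union> U) ` ({S. a S \<noteq> 0} \<times> {S. b S \<noteq> 0})"
    using * by fast
  then have "finite {S. gmult a b S \<noteq> 0}"
    using assms by (rule_tac finite_subset) (auto simp: gelem_def)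
  then show ?thesis
    using gmult_infinite by (auto simp: gelem_def)
qed

lemma gelem_gflip [simp]: "gelem a \<Longrightarrow> gelem (gflip a)"
  unfolding gelem_def gflip_def by (auto intro: finite_subset[of _ "{S. a S \<noteq> 0}"])

lemma gsign_empty [simp]: "gsign {} S = 1" "gsign S {} = 1"
  by (simp_all add: gsign_def)

lemma gmult_gscal_left:
  assumes "gelem a"
  shows "gmult (gscal c) a = (\<lambda>S. c * a S)"
proof
  fix S
  show "gmult (gscal c) a S = c * a S"
  proof (cases "finite S")
    case True
    have "gmult (gscal c) a S = (\<Sum>T\<in>Pow S. if T = {} then c * a S else 0)"
      unfolding gmult_def by (rule sum.cong) (auto simp: gscal_def)
    then show ?thesis using True by (simp add: sum.delta)
  qed (use assms in \<open>simp add: gmult_infinite gelem_infinite\<close>)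
qed

lemma gmult_gscal_right:
  assumes "gelem a"
  shows "gmult a (gscal c) = (\<lambda>S. c * a S)"
proof
  fix S
  show "gmult a (gscal c) S = c * a S"
  proof (cases "finite S")
    case True
    have "gmult a (gscal c) S = (\<Sum>T\<in>Pow S. if T = S then c * a S else 0)"
      unfolding gmult_def by (rule sum.cong) (auto simp: gscal_def)
    then show ?thesis using True by (simp add: sum.delta)
  qed (use assms in \<open>simp add: gmult_infinite gelem_infinite\<close>)
qed

lemma gscal_commute: "gelem a \<Longrightarrow> gmult a (gscal c) = gmult (gscal c) a"
  by (simp add: gmult_gscal_left gmult_gscal_right)

lemma gmult_gone_left [simp]: "gelem a \<Longrightarrow> gmult gone a = a"
  by (simp add: gone_def gmult_gscal_left)

lemma gmult_gone_right [simp]: "gelem a \<Longrightarrow> gmult a gone = a"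
  by (simp add: gone_def gmult_gscal_right)

lemma gscal_0 [simp]: "gscal 0 = 0"
  by (rule ext) (simp add: gscal_def)

lemma gscal_mult: "gscal (c * d) = gmult (gscal c) (gscal d)"
  unfolding gmult_gscal_left[OF gelem_gscal] by (rule ext) (simp add: gscal_def)

lemma gscal_sum: "gscal (sum f A) = (\<Sum>i\<in>A. gscal (f i))"
proof -
  have "gscal (x + y) = gscal x + gscal y" for x y by (rule ext) (simp add: gscal_def)
  then show ?thesis by (induction A rule: infinite_finite_induct) simp_all
qed

lemma gscal_minus: "gscal (- c) = - gscal c"
  by (rule ext) (simp add: gscal_def)

lemma gpowr_gscal: "gpowr (gscal c) k = gscal (c ^ k)"
  by (induction k) (simp_all add: gone_def mult.commute flip: gscal_mult)

section \<open>Parity twists and supercommutativity\<close>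

definition gtw :: "nat \<Rightarrow> gr \<Rightarrow> gr" where
  "gtw p a = (if odd p then gflip a else a)"

lemma gflip_gflip [simp]: "gflip (gflip a) = a"
  by (rule ext) (simp add: gflip_def flip: mult.assoc power_mult_distrib)

lemma gflip_0 [simp]: "gflip 0 = 0"
  by (rule ext) (simp add: gflip_def)

lemma gflip_gscal [simp]: "gflip (gscal c) = gscal c"
  by (rule ext) (simp add: gflip_def gscal_def)

lemma gflip_add: "gflip (a + b) = gflip a + gflip b"
  by (rule ext) (simp add: gflip_def algebra_simps)

lemma gflip_gmult: "gflip (gmult a b) = gmult (gflip a) (gflip b)"
proof
  fix S
  show "gflip (gmult a b) S = gmult (gflip a) (gflip b) S"
  proof (cases "finite S")
    case True
    have "(-1) ^ card S = (-1) ^ card T * (-1 :: complex) ^ card (S - T)" if "T \<subseteq> S" for T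
      using that True
      by (metis card_Diff_subset card_mono finite_subset le_add_diff_inverse power_add)
    then show ?thesis
      unfolding gmult_def gflip_def sum_distrib_left by (intro sum.cong) (auto simp: algebra_simps)
  qed (simp add: gmult_infinite gflip_def)
qed

lemma gflipw_gtw: "gflipw m w = gtw (wpar m w)"
  by (rule ext) (simp add: gflipw_def gtw_def wpar_def odd_iff_mod_2_eq_one)

lemma gtw_gmult: "gtw p (gmult a b) = gmult (gtw p a) (gtw p b)"
  by (simp add: gtw_def gflip_gmult)

lemma gtw_0 [simp]: "gtw p 0 = 0"
  by (simp add: gtw_def)

lemma gtw_even [simp]: "even p \<Longrightarrow> gtw p a = a"
  by (simp add: gtw_def)

lemma gtw_gscal [simp]: "gtw p (gscal c) = gscal c"
  by (simp add: gtw_def)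

lemma gtw_gone [simp]: "gtw p gone = gone"
  by (simp add: gone_def)

lemma gtw_add: "gtw p (a + b) = gtw p a + gtw p b"
  by (simp add: gtw_def gflip_add)

lemma gtw_sum: "gtw p (sum f A) = (\<Sum>i\<in>A. gtw p (f i))"
  using sum_comp_morphism[of "gtw p" f A] by (simp add: gtw_add comp_def)

lemma gtw_gtw: "gtw p (gtw q a) = gtw (p + q) a"
  by (simp add: gtw_def)

lemma gelem_gtw [simp]: "gelem a \<Longrightarrow> gelem (gtw p a)"
  by (simp add: gtw_def)

lemma gtw_cong_parity: "even p = even q \<Longrightarrow> gtw p = gtw q"
  by (rule ext) (simp add: gtw_def)

text \<open>Only \<open>p mod 2\<close> matters, so parities can be added as plain numbers; zero is
  homogeneous of both parities.\<close>

definition ghom :: "nat \<Rightarrow> gr \<Rightarrow> bool" where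
  "ghom p a \<longleftrightarrow> (\<forall>S. a S \<noteq> 0 \<longrightarrow> card S mod 2 = p mod 2)"

lemma ghom_gscal [simp]: "even p \<Longrightarrow> ghom p (gscal c)"
  by (simp add: ghom_def gscal_def)

lemma ghom_gpart: "ghom p (gpart p a)"
  by (simp add: ghom_def gpart_def)

lemma ghom_cong_parity: "even p = even q \<Longrightarrow> ghom p a = ghom q a"
  by (simp add: ghom_def mod2_eq_if)

lemma gtw_ghom:
  assumes "ghom p a"
  shows "gtw q a = (if odd p \<and> odd q then - a else a)"
proof (cases "odd q")
  case True
  have "(-1) ^ card S * a S = (if odd p then - a S else a S)" for S
  proof (cases "a S = 0")
    case False
    then have "card S mod 2 = p mod 2" using assms by (simp add: ghom_def)
    then have "even (card S) = even p" by presburger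
    then show ?thesis by (simp add: uminus_power_if)
  qed simp
  with True show ?thesis by (auto simp: gtw_def gflip_def fun_eq_iff)
qed simp

text \<open>Reindexing the product by complements reduces the claim to \<open>gsign_swap\<close>.
  The sign with exponent \<open>card (S - T) * card T\<close> depends on \<open>T\<close> only
  through \<open>p\<close> and \<open>S - T\<close>, so it is a twist of \<open>b\<close>, which may
  be inhomogeneous.\<close>

lemma gmult_supercommute:
  assumes "ghom p a"
  shows "gmult a b = gmult (gtw p b) a"
proof
  fix S
  show "gmult a b S = gmult (gtw p b) a S"
  proof (cases "finite S")
    case True
    have "gmult (gtw p b) a S = (\<Sum>T\<in>Pow S. gsign (S - T) T * gtw p b (S - T) * a T)"
      unfolding gmult_def
      by (rule sum.reindex_bij_witness[where i = "\<lambda>T. S - T" and j = "\<lambda>T. S - T"])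
        (auto simp: double_diff)
    also have "\<dots> = (\<Sum>T\<in>Pow S. gsign T (S - T) * a T * b (S - T))"
    proof (rule sum.cong[OF refl])
      fix T assume T: "T \<in> Pow S"
      show "gsign (S - T) T * gtw p b (S - T) * a T = gsign T (S - T) * a T * b (S - T)"
      proof (cases "a T = 0")
        case False
        then have "card T mod 2 = p mod 2" using assms by (simp add: ghom_def)
        then have ev: "even (card T) = even p" by presburger
        have "gsign (S - T) T = (-1) ^ (card (S - T) * card T) * gsign T (S - T)"
          using T True by (intro gsign_swap) (auto intro: finite_subset)
        moreover have "gtw p b (S - T) = (-1) ^ (card (S - T) * card T) * b (S - T)"
          using ev by (auto simp: gtw_def gflip_def uminus_power_if)
        ultimately show ?thesis
          by (simp add: uminus_power_if)
      qed simp
    qed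
    finally show ?thesis by (simp add: gmult_def)
  qed (simp add: gmult_infinite)
qed

lemma gpart_split: "gpart p a + gpart (Suc p) a = a"
  by (rule ext) (simp add: gpart_def mod2_eq_if)

text \<open>The sign rule of \<open>mtens\<close> is used in this form: the even and odd parts of
  the second map recombine into a single twist. Here \<open>r\<close> is the degree that a matrix
  entry has in an even map, and \<open>q\<close> is the parity of the vector that is passed.\<close>

lemma gpart_twist:
  "gpart r a + (if even q then gpart (Suc r) a else - gpart (Suc r) a)
    = (if odd r \<and> odd q then - gtw q a else gtw q a)"
proof -
  have "gtw q a = gtw q (gpart r a) + gtw q (gpart (Suc r) a)"
    by (simp add: gpart_split flip: gtw_add)
  then show ?thesis
    by (auto simp: gtw_ghom[OF ghom_gpart] gpart_split)
qed

section \<open>State sums of perfect matchings\<close>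

definition matching :: "(nat \<Rightarrow> nat) \<Rightarrow> nat list \<Rightarrow> bool" where
  "matching p xs \<longleftrightarrow> distinct xs \<and> (\<forall>x\<in>set xs. p x \<in> set xs \<and> p x \<noteq> x \<and> p (p x) = x)"

lemma matching_front_partners:
  assumes "matching p (x # y # zs)" "p x \<noteq> y"
  shows "p x \<in> set zs" "p y \<in> set zs" "p x \<noteq> p y" "x \<notin> set zs" "y \<notin> set zs" "x \<noteq> y" "distinct zs"
proof -
  have 1: "p x \<in> insert x (insert y (set zs))" "p y \<in> insert x (insert y (set zs))" "p x \<noteq> x" "p y \<noteq> y"
    "p (p x) = x" "p (p y) = y" and d: "distinct (x # y # zs)"
    using assms(1) unfolding matching_def by auto
  from d show "x \<notin> set zs" "y \<notin> set zs" "x \<noteq> y" "distinct zs" by simp_all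
  from 1 assms(2) show "p x \<in> set zs" by blast
  from 1(5,6) assms(2) have "p y \<noteq> x" by metis
  with 1 show "p y \<in> set zs" by blast
  from 1(5,6) \<open>x \<noteq> y\<close> show "p x \<noteq> p y" by metis
qed

lemma matching_perm: "matching p xs \<Longrightarrow> mset ys = mset xs \<Longrightarrow> matching p ys"
  unfolding matching_def by (metis mset_eq_imp_distinct_iff mset_eq_setD)

lemma matching_remove:
  assumes "matching p (x # us @ p x # zs)"
  shows "matching p (us @ zs)"
proof -
  have "p z \<noteq> x \<and> p z \<noteq> p x" if z: "z \<in> set (us @ zs)" for z
  proof -
    have "z \<noteq> x" "z \<noteq> p x" "p (p z) = z" "p (p x) = x"
      using assms z by (auto simp: matching_def)
    then show ?thesis by metis
  qed
  then show ?thesis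
    using assms unfolding matching_def by auto
qed

lemma matching_split:
  assumes "matching p (x # xs)"
  obtains us zs where "xs = us @ p x # zs" "p x \<notin> set us"
proof -
  have "p x \<in> set xs" using assms by (auto simp: matching_def)
  then show ?thesis using that by (meson split_list_first)
qed

lemma matching_cong: "(\<And>x. x \<in> set xs \<Longrightarrow> p x = q x) \<Longrightarrow> matching p xs = matching q xs"
  unfolding matching_def by auto

text \<open>The values at \<open>x\<close> and \<open>y\<close> themselves are stale: both points
  leave the list of points when their strands are joined.\<close>

definition reconnect :: "(nat \<Rightarrow> nat) \<Rightarrow> nat \<Rightarrow> nat \<Rightarrow> nat \<Rightarrow> nat" where
  "reconnect p x y = p(p x := p y, p y := p x)"

text \<open>A supersymmetric even form on colours. Abstracting from \<open>eta\<close> allows basis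
  vectors and dual basis vectors to be colours of one kind.\<close>

locale superform =
  fixes B :: "'c \<Rightarrow> 'c \<Rightarrow> complex" and od :: "'c \<Rightarrow> bool"
  assumes B_sym: "B y x = (if od x \<and> od y then - 1 else 1) * B x y"
    and B_parity: "od x \<noteq> od y \<Longrightarrow> B x y = 0"
begin

definition ks :: "'c \<Rightarrow> 'c \<Rightarrow> complex" where
  "ks x y = (if od x \<and> od y then - 1 else 1)"

definition ksl :: "'c \<Rightarrow> 'c list \<Rightarrow> complex" where
  "ksl x ys = prod_list (map (ks x) ys)"

lemma ksl_simps [simp]: "ksl x [] = 1" "ksl x (y # ys) = ks x y * ksl x ys"
  "ksl x (ys @ zs) = ksl x ys * ksl x zs"
  by (simp_all add: ksl_def)

lemma ks_commute: "ks x y = ks y x"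
  by (simp add: ks_def)

lemma ks_square [simp]: "ks x y * ks x y = 1" "ks x y * (ks x y * z) = z"
  by (simp_all add: ks_def)

lemma ks_parity: "od x = od y \<Longrightarrow> ks x = ks y"
  by (rule ext) (simp add: ks_def)

lemma ksl_parity: "od x = od y \<Longrightarrow> ksl x = ksl y"
  by (rule ext) (simp only: ksl_def ks_parity[of x y])

lemma ksl_square [simp]: "ksl x ys * ksl x ys = 1"
  by (induction ys) (simp_all add: ks_def)

lemma B_swap: "B x y = ks x y * B y x"
  unfolding ks_def by (subst B_sym) auto

text \<open>The state sum of a perfect matching \<open>p\<close> of the points in a list: the Pfaffian-type
  expansion along the first point. The matched points are multiplied with the form after
  being brought together, with the Koszul sign for passing the points in between.\<close>

function Z :: "(nat \<Rightarrow> nat) \<Rightarrow> (nat \<Rightarrow> 'c) \<Rightarrow> nat list \<Rightarrow> complex" where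
  "Z p c [] = 1"
| "Z p c (x # xs) = B (c x) (c (p x)) * ksl (c (p x)) (map c (takeWhile (\<lambda>y. y \<noteq> p x) xs))
      * Z p c (remove1 (p x) xs)"
  by pat_completeness auto
termination
  by (relation "measure (\<lambda>(p, c, xs). length xs)") (auto simp: length_remove1 le_imp_less_Suc)

declare Z.simps(2) [simp del]

lemma Z_expand:
  assumes "p x \<notin> set us"
  shows "Z p c (x # us @ p x # zs) = B (c x) (c (p x)) * ksl (c (p x)) (map c us) * Z p c (us @ zs)"
proof -
  have "takeWhile (\<lambda>y. y \<noteq> p x) (us @ p x # zs) = us"
    using assms by (subst takeWhile_append2) auto
  moreover have "remove1 (p x) (us @ p x # zs) = us @ zs"
    using assms by (simp add: remove1_append)
  ultimately show ?thesis by (simp add: Z.simps(2))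
qed

lemma Z_expand':
  assumes "y = p x" "y \<notin> set us"
  shows "Z p c (x # us @ y # zs) = B (c x) (c y) * ksl (c y) (map c us) * Z p c (us @ zs)"
  using Z_expand assms by simp

lemma Z_cong:
  assumes "matching p xs" "\<And>x. x \<in> set xs \<Longrightarrow> p x = q x" "\<And>x. x \<in> set xs \<Longrightarrow> c x = c' x"
  shows "Z p c xs = Z q c' xs"
  using assms
proof (induction xs rule: length_induct)
  case (1 xs)
  show ?case
  proof (cases xs)
    case (Cons x ys)
    obtain us zs where ys: "ys = us @ p x # zs" "p x \<notin> set us"
      using matching_split "1.prems"(1) Cons by metis
    have m: "matching p (us @ zs)" using matching_remove "1.prems"(1) Cons ys by metis
    have "Z p c (us @ zs) = Z q c' (us @ zs)"
      by (rule "1.IH"[rule_format, OF _ m]) (use "1.prems"(2,3) Cons ys in auto)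
    moreover have "map c us = map c' us" using "1.prems"(3) Cons ys by simp
    moreover have "c x = c' x" "c (p x) = c' (p x)" "p x = q x"
      using "1.prems"(2,3) Cons ys by auto
    ultimately show ?thesis
      using Z_expand[of p x us c zs] Z_expand[of q x us c' zs] ys Cons by (simp del: map_eq_conv)
  qed simp
qed

text \<open>If \<open>x\<close> and \<open>y\<close> are matched, this is supersymmetry of
  \<open>B\<close>. Otherwise expanding both lists along their first two points removes the same
  four points, and only the signs differ; these depend on the order in which the two partners
  occur.\<close>

lemma Z_swap_front:
  assumes "matching p (x # y # zs)"
  shows "Z p c (x # y # zs) = ks (c x) (c y) * Z p c (y # x # zs)"
proof (cases "p x = y")
  case True
  then have "p y = x" using assms by (auto simp: matching_def)
  then have "Z p c (x # y # zs) = B (c x) (c y) * Z p c zs" "Z p c (y # x # zs) = B (c y) (c x) * Z p c zs"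
    using Z_expand'[of y p x "[]" c zs] Z_expand'[of x p y "[]" c zs] True by simp_all
  then show ?thesis by (simp add: B_swap[of "c x" "c y"])
next
  case False
  define x' y' where "x' = p x" and "y' = p y"
  have px: "p x \<in> set zs" "p y \<in> set zs" "p x \<noteq> p y" "x \<notin> set zs" "y \<notin> set zs" "x \<noteq> y" "distinct zs"
    using matching_front_partners[OF assms False] by simp_all
  consider (1) zs1 zs2 zs3 where "zs = zs1 @ x' # zs2 @ y' # zs3"
    | (2) zs1 zs2 zs3 where "zs = zs1 @ y' # zs2 @ x' # zs3"
  proof -
    obtain zs1 vs where b: "zs = zs1 @ x' # vs" using split_list px x'_def by metis
    consider "y' \<in> set zs1" | "y' \<in> set vs" using px b x'_def y'_def by auto
    then show thesis
    proof cases
      case 1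
      then obtain vs1 vs2 where "zs1 = vs1 @ y' # vs2" using split_list by metis
      then show ?thesis using that(2) b by simp
    next
      case 2
      then obtain vs1 vs2 where "vs = vs1 @ y' # vs2" using split_list by metis
      then show ?thesis using that(1) b by simp
    qed
  qed
  then show ?thesis
  proof cases
    case 1
    have d: "x' \<notin> set (y # zs1)" "y' \<notin> set (zs1 @ zs2)" "y' \<notin> set (x # zs1 @ x' # zs2)" "x' \<notin> set zs1"
      using px[folded x'_def y'_def] 1 by auto
    have l: "Z p c (x # y # zs) = B (c x) (c x') * ksl (c x') (map c (y # zs1))
        * (B (c y) (c y') * ksl (c y') (map c (zs1 @ zs2)) * Z p c (zs1 @ zs2 @ zs3))"
      using Z_expand'[of x' p x "y # zs1" c "zs2 @ y' # zs3"] Z_expand'[of y' p y "zs1 @ zs2" c zs3] d 1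
      by (simp add: x'_def y'_def)
    have r: "Z p c (y # x # zs) = B (c y) (c y') * ksl (c y') (map c (x # zs1 @ x' # zs2))
        * (B (c x) (c x') * ksl (c x') (map c zs1) * Z p c (zs1 @ zs2 @ zs3))"
      using Z_expand'[of y' p y "x # zs1 @ x' # zs2" c zs3] Z_expand'[of x' p x zs1 c "zs2 @ zs3"] d 1
      by (simp add: x'_def y'_def)
    show ?thesis
    \<comment> \<open>Matched colours of different parity make both sides vanish. Otherwise every
      sign by which the two sides differ is a power of \<open>ks (c x) (c y)\<close>.\<close>
    proof (cases "od (c x) = od (c x') \<and> od (c y) = od (c y')")
      case True
      then have "ks (c x') = ks (c x)" "ks (c y') = ks (c y)" "ks (c y) (c x) = ks (c x) (c y)"
        "ks (c y) (c x') = ks (c x) (c y)" "ks (c x) (c y') = ks (c x) (c y)"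
        by (auto simp: ks_def)
      then show ?thesis
        unfolding l r by (simp add: mult_ac)
    next
      case False
      then have "B (c x) (c x') = 0 \<or> B (c y) (c y') = 0" using B_parity by blast
      then show ?thesis unfolding l r by auto
    qed
  next
    case 2
    have d: "x' \<notin> set (y # zs1 @ y' # zs2)" "y' \<notin> set zs1" "y' \<notin> set (x # zs1)" "x' \<notin> set (zs1 @ zs2)"
      using px[folded x'_def y'_def] 2 by auto
    have l: "Z p c (x # y # zs) = B (c x) (c x') * ksl (c x') (map c (y # zs1 @ y' # zs2))
        * (B (c y) (c y') * ksl (c y') (map c zs1) * Z p c (zs1 @ zs2 @ zs3))"
      using Z_expand'[of x' p x "y # zs1 @ y' # zs2" c zs3] Z_expand'[of y' p y zs1 c "zs2 @ zs3"] d 2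
      by (simp add: x'_def y'_def)
    have r: "Z p c (y # x # zs) = B (c y) (c y') * ksl (c y') (map c (x # zs1))
        * (B (c x) (c x') * ksl (c x') (map c (zs1 @ zs2)) * Z p c (zs1 @ zs2 @ zs3))"
      using Z_expand'[of y' p y "x # zs1" c "zs2 @ x' # zs3"] Z_expand'[of x' p x "zs1 @ zs2" c zs3] d 2
      by (simp add: x'_def y'_def)
    show ?thesis
    proof (cases "od (c x) = od (c x') \<and> od (c y) = od (c y')")
      case True
      then have "ks (c x') = ks (c x)" "ks (c y') = ks (c y)" "ks (c y) (c x) = ks (c x) (c y)"
        "ks (c y) (c x') = ks (c x) (c y)" "ks (c x) (c y') = ks (c x) (c y)"
        by (auto simp: ks_def)
      then show ?thesis
        unfolding l r by (simp add: mult_ac)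
    next
      case False
      then have "B (c x) (c x') = 0 \<or> B (c y) (c y') = 0" using B_parity by blast
      then show ?thesis unfolding l r by auto
    qed
  qed
qed

text \<open>Peeling off the first point \<open>a\<close> shortens the prefix. If the partner of
  \<open>a\<close> is \<open>x\<close> or \<open>y\<close>, the exchange adds or removes exactly one
  point that it passes, which gives the sign; otherwise it passes both or neither, and the exchange
  survives in the remaining list.\<close>

lemma Z_swap:
  assumes "matching p (us @ x # y # zs)"
  shows "Z p c (us @ x # y # zs) = ks (c x) (c y) * Z p c (us @ y # x # zs)"
  using assms
proof (induction "length us" arbitrary: us zs rule: less_induct)
  case less
  show ?case
  proof (cases us)
    case Nil
    then show ?thesis using Z_swap_front less.prems by simp
  next
    case (Cons a vs)
    define b where "b = p a"
    have m: "matching p (a # vs @ x # y # zs)" using less.prems Cons by simp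
    then have d: "distinct (a # vs @ x # y # zs)" "b \<in> set (vs @ x # y # zs)"
      unfolding b_def by (auto simp: matching_def)
    then consider "b = x" | "b = y" | "b \<in> set vs" | "b \<in> set zs" by auto
    then show ?thesis
    proof cases
      case 1
      then show ?thesis
        using Z_expand'[of x p a vs c "y # zs"] Z_expand'[of x p a "vs @ [y]" c zs] d Cons
        by (simp add: b_def)
    next
      case 2
      then show ?thesis
        using Z_expand'[of y p a vs c "x # zs"] Z_expand'[of y p a "vs @ [x]" c zs] d Cons
        by (simp add: b_def ks_commute[of "c x" "c y"])
    next
      case 3
      then obtain vs1 vs2 where g: "vs = vs1 @ b # vs2" using split_list by metis
      have "matching p ((vs1 @ vs2) @ x # y # zs)"
        using matching_remove[of p a vs1 "vs2 @ x # y # zs"] m g b_def by simp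
      then have "Z p c ((vs1 @ vs2) @ x # y # zs) = ks (c x) (c y) * Z p c ((vs1 @ vs2) @ y # x # zs)"
        by (rule less.hyps[rotated]) (use g Cons in simp)
      then show ?thesis
        using Z_expand'[of b p a vs1 c "vs2 @ x # y # zs"] Z_expand'[of b p a vs1 c "vs2 @ y # x # zs"] d Cons g
        by (simp add: b_def)
    next
      case 4
      then obtain vs1 vs2 where g: "zs = vs1 @ b # vs2" using split_list by metis
      have "matching p (vs @ x # y # vs1 @ vs2)"
        using matching_remove[of p a "vs @ x # y # vs1" "vs2"] m g b_def by simp
      then have "Z p c (vs @ x # y # vs1 @ vs2) = ks (c x) (c y) * Z p c (vs @ y # x # vs1 @ vs2)"
        by (rule less.hyps[rotated]) (use g Cons in simp)
      then show ?thesis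
        using Z_expand'[of b p a "vs @ x # y # vs1" c vs2] Z_expand'[of b p a "vs @ y # x # vs1" c vs2] d Cons g
        by (simp add: b_def mult_ac)
    qed
  qed
qed

lemma Z_move:
  assumes "matching p (us @ vs @ x # zs)"
  shows "Z p c (us @ vs @ x # zs) = ksl (c x) (map c vs) * Z p c (us @ x # vs @ zs)"
  using assms
proof (induction vs arbitrary: zs rule: rev_induct)
  case (snoc y vs)
  have "Z p c (us @ vs @ y # x # zs) = ks (c y) (c x) * Z p c (us @ vs @ x # y # zs)"
    using Z_swap[of p "us @ vs" y x zs] snoc.prems by simp
  moreover have "matching p (us @ vs @ x # y # zs)"
    using snoc.prems by (rule matching_perm) simp
  ultimately show ?case using snoc.IH[of "y # zs"] by (simp add: ks_commute)
qed simp

text \<open>Colours of equal parity acquire the same sign on the way to the front, and the two signs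
  cancel.\<close>

lemma Z_move_pair:
  assumes "matching p (us @ x # y # zs)" "od (c x) = od (c y)"
  shows "Z p c (us @ x # y # zs) = Z p c (x # y # us @ zs)"
proof -
  have "Z p c (us @ x # y # zs) = ksl (c x) (map c us) * Z p c ([x] @ us @ y # zs)"
    using Z_move[of p "[]" us x "y # zs"] assms by simp
  also have "matching p ([x] @ us @ y # zs)"
    using assms(1) by (rule matching_perm) simp
  then have "Z p c ([x] @ us @ y # zs) = ksl (c y) (map c us) * Z p c ([x] @ y # us @ zs)"
    by (rule Z_move)
  finally show ?thesis
    using assms(2) by (simp add: ksl_parity[of "c x" "c y"] flip: mult.assoc)
qed

text \<open>The number \<sigma> collects everything that does not involve the colours of
  \<open>x\<close> and \<open>y\<close>. It is the same for all recolourings \<open>c'\<close> of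
  these two points and for the reconnected matching, so a sum over their colours acts on three
  explicit factors only.\<close>

lemma Z_contract_front:
  assumes m: "matching p (x # y # vs)" and "p x \<noteq> y" and m': "matching (reconnect p x y) vs"
  shows "\<exists>\<sigma>. \<forall>c'. (\<forall>z\<in>set vs. c' z = c z) \<longrightarrow>
      Z p c' (x # y # vs) = B (c' x) (c (p x)) * ks (c (p x)) (c' y) * B (c' y) (c (p y)) * \<sigma> \<and>
      Z (reconnect p x y) c vs = B (c (p x)) (c (p y)) * \<sigma>"
proof -
  define x' y' where "x' = p x" and "y' = p y"
  define q where "q = reconnect p x y"
  have px: "x' \<in> set vs" "y' \<in> set vs" "x' \<noteq> y'" "x \<notin> set vs" "y \<notin> set vs" "x \<noteq> y" "distinct vs"
    using matching_front_partners[OF assms(1,2)] unfolding x'_def y'_def by simp_all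
  obtain vs1 vs2 where g: "vs = vs1 @ x' # vs2" using px split_list by metis
  then have "y' \<in> set (vs1 @ vs2)" using px by auto
  then obtain \<delta>1 \<delta>2 where d: "vs1 @ vs2 = \<delta>1 @ y' # \<delta>2" using split_list by metis
  define vs' where "vs' = \<delta>1 @ \<delta>2"
  have perm1: "mset (x' # \<delta>1 @ y' # \<delta>2) = mset vs" using g d[symmetric] by simp
  have perm2: "mset (x' # y' # vs') = mset vs" using perm1 by (simp add: vs'_def)
  have ma: "matching p ([x, y, x'] @ \<delta>1 @ y' # \<delta>2)" "matching p ([x, y] @ x' # y' # vs')"
    using m by (auto intro: matching_perm simp: perm1[simplified] perm2[simplified])
  have ma': "matching q ([x'] @ \<delta>1 @ y' # \<delta>2)" "matching q (x' # y' # vs')"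
    using m' by (auto intro: matching_perm simp: perm1[simplified] perm2[simplified] q_def)
  have dd: "distinct (x # y # x' # y' # vs')" using ma(2) by (simp add: matching_def)
  define \<sigma>1 where "\<sigma>1 = ksl (c x') (map c vs1) * ksl (c y') (map c \<delta>1)"
  have q: "q x' = y'" "q y' = x'" using px by (auto simp: q_def reconnect_def x'_def y'_def)
  have "matching p (y # y' # vs')"
    using matching_remove[of p x "[y]" "y' # vs'"] ma(2) x'_def by simp
  then have mg: "matching p vs'"
    using matching_remove[of p y "[]" vs'] y'_def by simp
  have zq: "Z q c vs' = Z p c vs'"
    by (rule Z_cong[OF mg, symmetric]) (use dd in \<open>auto simp: q_def reconnect_def x'_def y'_def\<close>)
  have "Z q c ([] @ vs1 @ x' # vs2) = ksl (c x') (map c vs1) * Z q c ([] @ x' # vs1 @ vs2)"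
    by (rule Z_move) (use m' g q_def in simp)
  moreover have "Z q c ([x'] @ \<delta>1 @ y' # \<delta>2) = ksl (c y') (map c \<delta>1) * Z q c ([x'] @ y' # \<delta>1 @ \<delta>2)"
    by (rule Z_move) (use ma' in simp)
  ultimately have z1: "Z q c vs = \<sigma>1 * (B (c x') (c y') * Z p c vs')"
    using Z_expand'[of y' q x' "[]" c vs'] q d zq by (simp add: \<sigma>1_def vs'_def g)
  have "Z p c' (x # y # vs) = B (c' x) (c x') * ks (c x') (c' y) * B (c' y) (c y') * (\<sigma>1 * Z p c vs')"
    if c': "\<forall>z\<in>set vs. c' z = c z" for c'
  proof -
    have ceq: "c' x' = c x'" "c' y' = c y'" "map c' vs1 = map c vs1" using c' px g by auto
    have "set \<delta>1 \<subseteq> set vs" "set vs' \<subseteq> set vs" using perm2 vs'_def by (metis mset_eq_setD set_append set_subset_Cons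
      subset_trans sup_ge1)+
    then have ceq2: "map c' \<delta>1 = map c \<delta>1" "Z p c' vs' = Z p c vs'"
      using c' by (auto intro!: Z_cong mg)
    have "Z p c' ([x, y] @ vs1 @ x' # vs2) = ksl (c' x') (map c' vs1) * Z p c' ([x, y] @ x' # vs1 @ vs2)"
      by (rule Z_move) (use m g in simp)
    moreover have "Z p c' ([x, y, x'] @ \<delta>1 @ y' # \<delta>2)
        = ksl (c' y') (map c' \<delta>1) * Z p c' ([x, y, x'] @ y' # \<delta>1 @ \<delta>2)"
      by (rule Z_move) (use ma in simp)
    moreover have "Z p c' (x # [y] @ x' # y' # vs') = B (c' x) (c' x') * ks (c' x') (c' y) * Z p c' (y # y' # vs')"
      using Z_expand'[of x' p x "[y]" c' "y' # vs'"] dd by (simp add: x'_def)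
    moreover have "Z p c' (y # y' # vs') = B (c' y) (c' y') * Z p c' vs'"
      using Z_expand'[of y' p y "[]" c' vs'] by (simp add: y'_def)
    ultimately show ?thesis
      by (simp add: g d ceq ceq2[unfolded vs'_def] \<sigma>1_def vs'_def mult_ac)
  qed
  then show ?thesis
    using z1 by (intro exI[of _ "\<sigma>1 * Z p c vs'"]) (simp add: q_def x'_def y'_def mult_ac)
qed

text \<open>In a nonzero state sum matched points have equal parity, so the signs of
  \<open>u\<close> against them cancel in pairs. In effect the number of odd colours is
  even.\<close>

lemma Z_nonzero_ksl:
  assumes "matching p xs" "Z p c xs \<noteq> 0"
  shows "ksl u (map c xs) = 1"
  using assms
proof (induction xs rule: length_induct)
  case (1 xs)
  show ?case
  proof (cases xs)
    case (Cons x ys)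
    obtain us zs where ys: "ys = us @ p x # zs" "p x \<notin> set us"
      using matching_split "1.prems"(1) Cons by metis
    have m: "matching p (us @ zs)" using matching_remove "1.prems"(1) Cons ys by metis
    have nz: "B (c x) (c (p x)) \<noteq> 0" "Z p c (us @ zs) \<noteq> 0"
      using "1.prems"(2) Z_expand[of p x us c zs] ys Cons by auto
    then have "ksl u (map c (us @ zs)) = 1"
      by (intro "1.IH"[rule_format, OF _ m]) (use Cons ys in auto)
    moreover have "ks u (c x) = ks u (c (p x))"
      using B_parity nz by (auto simp: ks_def)
    ultimately show ?thesis by (simp add: Cons ys mult_ac)
  qed simp
qed

lemma Z_append:
  assumes "matching p vs" "matching p (vs @ zs)"
  shows "Z p c (vs @ zs) = Z p c vs * Z p c zs"
  using assms
proof (induction vs rule: length_induct)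
  case (1 vs)
  show ?case
  proof (cases vs)
    case (Cons x ys)
    obtain vs1 vs2 where ys: "ys = vs1 @ p x # vs2" "p x \<notin> set vs1"
      using matching_split "1.prems"(1) Cons by metis
    have "matching p (vs1 @ vs2)" "matching p ((vs1 @ vs2) @ zs)"
      using matching_remove[of p x vs1 "vs2"] matching_remove[of p x vs1 "vs2 @ zs"] "1.prems" Cons ys by auto
    then have "Z p c ((vs1 @ vs2) @ zs) = Z p c (vs1 @ vs2) * Z p c zs"
      by (intro "1.IH"[rule_format]) (use Cons ys in auto)
    then show ?thesis
      using Z_expand[of p x vs1 c "vs2 @ zs"] Z_expand[of p x vs1 c vs2] ys Cons by simp
  qed simp
qed

text \<open>A strand of outer points that jumps over the block \<open>vs\<close> acquires the total
  sign of the block, which is 1 by \<open>Z_nonzero_ksl\<close> unless the factor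
  \<open>Z p c vs\<close> is zero.\<close>

lemma Z_block:
  assumes "matching p vs" "matching p (us @ vs @ zs)"
  shows "Z p c (us @ vs @ zs) = Z p c (us @ zs) * Z p c vs"
  using assms(2)
proof (induction "length us" arbitrary: us zs rule: less_induct)
  case less
  show ?case
  proof (cases us)
    case Nil
    then show ?thesis using Z_append assms(1) less.prems by simp
  next
    case (Cons a \<delta>)
    define b where "b = p a"
    have m: "matching p (a # \<delta> @ vs @ zs)" using less.prems Cons by simp
    then have d: "distinct (a # \<delta> @ vs @ zs)" "b \<in> set (\<delta> @ vs @ zs)"
      unfolding b_def by (auto simp: matching_def)
    have "b \<notin> set vs"
    proof
      assume "b \<in> set vs"
      then have "p b \<in> set vs" using assms(1) unfolding matching_def by blast
      moreover have "p b = a" using m unfolding b_def matching_def by auto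
      ultimately show False using d(1) by auto
    qed
    then consider "b \<in> set \<delta>" | "b \<in> set zs" using d by auto
    then show ?thesis
    proof cases
      case 1
      then obtain \<delta>1 \<delta>2 where g: "\<delta> = \<delta>1 @ b # \<delta>2" using split_list by metis
      have "matching p ((\<delta>1 @ \<delta>2) @ vs @ zs)"
        using matching_remove[of p a \<delta>1 "\<delta>2 @ vs @ zs"] m g b_def by simp
      then have "Z p c ((\<delta>1 @ \<delta>2) @ vs @ zs) = Z p c ((\<delta>1 @ \<delta>2) @ zs) * Z p c vs"
        by (rule less.hyps[rotated]) (use g Cons in simp)
      then show ?thesis
        using Z_expand'[of b p a \<delta>1 c "\<delta>2 @ vs @ zs"] Z_expand'[of b p a \<delta>1 c "\<delta>2 @ zs"] d Cons g
        by (simp add: b_def)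
    next
      case 2
      then obtain zs1 zs2 where g: "zs = zs1 @ b # zs2" using split_list by metis
      have "matching p (\<delta> @ vs @ zs1 @ zs2)"
        using matching_remove[of p a "\<delta> @ vs @ zs1" "zs2"] m g b_def by simp
      then have "Z p c (\<delta> @ vs @ zs1 @ zs2) = Z p c (\<delta> @ zs1 @ zs2) * Z p c vs"
        by (rule less.hyps[rotated]) (use g Cons in simp)
      moreover have "Z p c vs \<noteq> 0 \<Longrightarrow> ksl (c b) (map c vs) = 1"
        using Z_nonzero_ksl assms(1) by simp
      ultimately show ?thesis
        using Z_expand'[of b p a "\<delta> @ vs @ zs1" c zs2] Z_expand'[of b p a "\<delta> @ zs1" c zs2] d Cons g
        by (cases "Z p c vs = 0") (simp_all add: b_def)
    qed
  qed
qed

end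

section \<open>Contraction\<close>

lemma matching_reconnect:
  assumes "matching p (us @ x # y # zs)" "p x \<noteq> y"
  shows "matching (reconnect p x y) (us @ zs)"
proof -
  have m: "matching p (x # y # us @ zs)"
    using assms(1) by (rule matching_perm) simp
  note f = matching_front_partners[OF m assms(2)]
  have pp: "p (p x) = x" "p (p y) = y" using m by (auto simp: matching_def)
  have z: "p z \<in> set (us @ zs) \<and> p z \<noteq> z \<and> p (p z) = z \<and> p z \<noteq> p x \<and> p z \<noteq> p y"
    if z: "z \<in> set (us @ zs)" "z \<noteq> p x" "z \<noteq> p y" for z
  proof -
    have "p z \<in> insert x (insert y (set (us @ zs)))" "p z \<noteq> z" "p (p z) = z" "z \<noteq> x" "z \<noteq> y"
      using m z unfolding matching_def by auto
    then show ?thesis using z pp by (metis insertE)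
  qed
  show ?thesis
    unfolding matching_def reconnect_def using z f by auto
qed

text \<open>Pairs are contracted in list order, and whether a pair closes a loop is decided by the
  matching that the earlier pairs leave over. Values at contracted points are stale.\<close>

fun contr :: "(nat \<Rightarrow> nat) \<Rightarrow> (nat \<times> nat) list \<Rightarrow> nat \<Rightarrow> nat" where
  "contr p [] = p"
| "contr p ((x, y) # es) = contr (if p x = y then p else reconnect p x y) es"

fun loops :: "(nat \<Rightarrow> nat) \<Rightarrow> (nat \<times> nat) list \<Rightarrow> nat" where
  "loops p [] = 0"
| "loops p ((x, y) # es) = (if p x = y then Suc (loops p es) else loops (reconnect p x y) es)"

definition strings :: "nat \<Rightarrow> nat \<Rightarrow> nat list set" where
  "strings N r = {w. length w = r \<and> (\<forall>a\<in>set w. a < N)}"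

lemma finite_strings [simp]: "finite (strings N r)"
proof -
  have "strings N r = {w. set w \<subseteq> {..<N} \<and> length w = r}" by (auto simp: strings_def)
  then show ?thesis by (simp add: finite_lists_length_eq)
qed

lemma strings_0 [simp]: "strings N 0 = {[]}"
  by (auto simp: strings_def)

lemma sum_strings_Suc: "(\<Sum>w\<in>strings N (Suc r). f w) = (\<Sum>w\<in>strings N r. \<Sum>a<N. f (a # w))"
proof -
  have "(\<Sum>w\<in>strings N r. \<Sum>a<N. f (a # w)) = (\<Sum>(w, a)\<in>strings N r \<times> {..<N}. f (a # w))"
    by (simp add: sum.cartesian_product)
  also have "\<dots> = (\<Sum>w\<in>strings N (Suc r). f w)"
    by (rule sum.reindex_bij_witness[where i = "\<lambda>w. (tl w, hd w)" and j = "\<lambda>(w, a). a # w"])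
      (auto simp: strings_def length_Suc_conv)
  finally show ?thesis by simp
qed

text \<open>\<open>L\<close> and \<open>R\<close> play the roles of a basis and its dual basis, with
  \<open>resolution\<close> as the expansion of the identity. \<open>V\<close> is the range in which
  it is required, since the colour type may contain indices beyond \<open>N\<close>.\<close>

locale superspace = superform B od for B :: "'c \<Rightarrow> 'c \<Rightarrow> complex" and od +
  fixes R L :: "nat \<Rightarrow> 'c" and N :: nat and V :: "'c set"
  assumes od_R_L: "a < N \<Longrightarrow> od (R a) = od (L a)"
    and R_V: "a < N \<Longrightarrow> R a \<in> V" and L_V: "a < N \<Longrightarrow> L a \<in> V"
    and resolution: "u \<in> V \<Longrightarrow> v \<in> V \<Longrightarrow> (\<Sum>a<N. B u (R a) * B (L a) v) = B u v"
begin

text \<open>The supertrace of the identity, which is what a strand leaves behind when its two ends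
  are contracted with each other.\<close>

definition sdim :: complex where
  "sdim = (\<Sum>a<N. B (R a) (L a))"

lemma Z_contract:
  assumes m: "matching p (us @ x # y # zs)" and V: "\<And>z. z \<in> set (us @ zs) \<Longrightarrow> c z \<in> V"
  shows "(\<Sum>a<N. Z p (c(x := R a, y := L a)) (us @ x # y # zs)) =
    (if p x = y then sdim * Z p c (us @ zs) else Z (reconnect p x y) c (us @ zs))"
proof -
  have m': "matching p (x # y # us @ zs)" using m by (rule matching_perm) simp
  have xy: "x \<noteq> y" "x \<notin> set (us @ zs)" "y \<notin> set (us @ zs)"
    using m' unfolding matching_def by auto
  \<comment> \<open>\<open>R a\<close> and \<open>L a\<close> have equal parity, so for each single
    colour the adjacent pair moves to the front without a sign.\<close>
  have front: "Z p (c(x := R a, y := L a)) (us @ x # y # zs) = Z p (c(x := R a, y := L a)) (x # y # us @ zs)"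
    if "a < N" for a
    using od_R_L[OF that] xy by (intro Z_move_pair[OF m]) simp
  show ?thesis
  proof (cases "p x = y")
    case True
    have mm: "matching p (us @ zs)"
      using matching_remove[of p x "[]" "us @ zs"] m' True by simp
    have "Z p (c(x := R a, y := L a)) (us @ x # y # zs) = B (R a) (L a) * Z p c (us @ zs)" if a: "a < N" for a
    proof -
      have "Z p (c(x := R a, y := L a)) (us @ zs) = Z p c (us @ zs)"
        by (rule Z_cong[OF mm]) (use xy in auto)
      then show ?thesis
        unfolding front[OF a] using Z_expand'[of y p x "[]" "c(x := R a, y := L a)" "us @ zs"] True xy
        by simp
    qed
    then show ?thesis using True by (simp add: sdim_def sum_distrib_right)
  next
    case False
    note f = matching_front_partners[OF m' False]
    have mr: "matching (reconnect p x y) (us @ zs)"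
      using matching_reconnect m False by blast
    obtain \<sigma> where \<sigma>: "\<And>c'. (\<forall>z\<in>set (us @ zs). c' z = c z) \<Longrightarrow>
        Z p c' (x # y # us @ zs) = B (c' x) (c (p x)) * ks (c (p x)) (c' y) * B (c' y) (c (p y)) * \<sigma>"
      "Z (reconnect p x y) c (us @ zs) = B (c (p x)) (c (p y)) * \<sigma>"
      using Z_contract_front[OF m' False mr, of c] by blast
    have "Z p (c(x := R a, y := L a)) (us @ x # y # zs) = B (c (p x)) (R a) * B (L a) (c (p y)) * \<sigma>"
      if a: "a < N" for a
    proof -
      have "Z p (c(x := R a, y := L a)) (x # y # us @ zs)
          = B (R a) (c (p x)) * ks (c (p x)) (L a) * B (L a) (c (p y)) * \<sigma>"
      proof -
        have "\<forall>z\<in>set (us @ zs). (c(x := R a, y := L a)) z = c z" using xy by auto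
        from \<sigma>(1)[of "c(x := R a, y := L a)", OF this] show ?thesis using xy by simp
      qed
      \<comment> \<open>The sign left by \<open>Z_contract_front\<close> becomes the one that turns
        \<open>B (R a) (c (p x))\<close> around, which produces the order of factors in
        \<open>resolution\<close>.\<close>
      moreover have "ks (c (p x)) (L a) = ks (c (p x)) (R a)"
        using od_R_L[OF a] by (simp add: ks_def)
      ultimately show ?thesis
        unfolding front[OF a] by (simp add: B_swap[of "c (p x)" "R a"] mult_ac)
    qed
    then have "(\<Sum>a<N. Z p (c(x := R a, y := L a)) (us @ x # y # zs))
        = (\<Sum>a<N. B (c (p x)) (R a) * B (L a) (c (p y))) * \<sigma>"
      by (simp add: sum_distrib_right)
    also have "\<dots> = B (c (p x)) (c (p y)) * \<sigma>"
      using resolution V f by simp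
    finally show ?thesis using \<sigma>(2) False by simp
  qed
qed

fun colour :: "(nat \<Rightarrow> 'c) \<Rightarrow> (nat \<times> nat) list \<Rightarrow> nat list \<Rightarrow> nat \<Rightarrow> 'c" where
  "colour c ((x, y) # es) (a # w) = (colour c es w)(x := R a, y := L a)"
| "colour c _ _ = c"

lemma colour_V:
  assumes "\<forall>z\<in>A. c z \<in> V" "w \<in> strings N (length es)" "z \<in> A \<union> fst ` set es \<union> snd ` set es"
  shows "colour c es w z \<in> V"
  using assms
proof (induction es arbitrary: w)
  case (Cons e es)
  obtain x y where e: "e = (x, y)" by force
  from Cons.prems(2) obtain a w' where w: "w = a # w'" "a < N" "w' \<in> strings N (length es)"
    by (auto simp: strings_def length_Suc_conv)
  show ?case using Cons.IH[of w'] Cons.prems w e R_V L_V by auto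
qed auto

text \<open>With the first components reversed the pairs are nested like brackets: the head of
  \<open>es\<close> is adjacent, and after its contraction the other pairs form the same
  configuration. That the remaining involution is again a matching comes out of the same
  induction.\<close>

lemma Z_contract_all:
  assumes "matching p (us @ rev (map fst es) @ map snd es @ zs)" "\<forall>z\<in>set (us @ zs). c z \<in> V"
  shows "(\<Sum>w\<in>strings N (length es). Z p (colour c es w) (us @ rev (map fst es) @ map snd es @ zs))
      = sdim ^ loops p es * Z (contr p es) c (us @ zs)
    \<and> matching (contr p es) (us @ zs)"
  using assms
proof (induction es arbitrary: p)
  case (Cons e es)
  obtain x y where e: "e = (x, y)" by force
  let ?us = "us @ rev (map fst es)" and ?zs = "map snd es @ zs"
  define q where "q = (if p x = y then p else reconnect p x y)"
  have m: "matching p (?us @ x # y # ?zs)" using Cons.prems(1) e by simp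
  have mq: "matching q (?us @ ?zs)"
  proof (cases "p x = y")
    case True
    have "matching p (x # [] @ p x # (?us @ ?zs))" by (rule matching_perm[OF m]) (simp add: True)
    then show ?thesis using matching_remove[of p x "[]" "?us @ ?zs"] True q_def by simp
  qed (use matching_reconnect[OF m] q_def in auto)
  have "(\<Sum>w\<in>strings N (length (e # es)). Z p (colour c (e # es) w) (us @ rev (map fst (e # es)) @ map snd (e # es) @ zs))
     = (\<Sum>w\<in>strings N (length es). \<Sum>a<N. Z p ((colour c es w)(x := R a, y := L a)) (?us @ x # y # ?zs))"
    by (simp add: sum_strings_Suc e)
  also have "\<dots> = (\<Sum>w\<in>strings N (length es). (if p x = y then sdim else 1) * Z q (colour c es w) (?us @ ?zs))"
  proof (rule sum.cong[OF refl])
    fix w assume w: "w \<in> strings N (length es)"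
    have "colour c es w z \<in> V" if "z \<in> set (?us @ ?zs)" for z
      by (rule colour_V[OF Cons.prems(2) w]) (use that in auto)
    then show "(\<Sum>a<N. Z p ((colour c es w)(x := R a, y := L a)) (?us @ x # y # ?zs))
      = (if p x = y then sdim else 1) * Z q (colour c es w) (?us @ ?zs)"
      by (subst Z_contract[OF m]) (simp_all add: q_def)
  qed
  also have "\<dots> = (if p x = y then sdim else 1) * (sdim ^ loops q es * Z (contr q es) c (us @ zs))"
    using Cons.IH[of q] mq Cons.prems(2) by (simp flip: sum_distrib_left)
  finally show ?case
    using Cons.IH[of q] mq Cons.prems(2) by (simp add: e q_def)
qed simp

end

text \<open>For an equivalence relation \<open>E\<close> this closed form already is the equivalence
  relation generated by \<open>E\<close> and \<open>(x, y)\<close>; it makes a single gluing step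
  comparable with \<open>reconnect\<close>.\<close>

definition join :: "nat rel \<Rightarrow> nat \<Rightarrow> nat \<Rightarrow> nat rel" where
  "join E x y = {(u, v). (u, v) \<in> E \<or> (u, x) \<in> E \<and> (y, v) \<in> E \<or> (u, y) \<in> E \<and> (x, v) \<in> E}"

fun joins :: "nat rel \<Rightarrow> (nat \<times> nat) list \<Rightarrow> nat rel" where
  "joins E [] = E"
| "joins E ((x, y) # es) = joins (join E x y) es"

lemma equiv_UNIV_iff:
  "equiv UNIV E \<longleftrightarrow> (\<forall>u. (u, u) \<in> E) \<and> (\<forall>u v. (u, v) \<in> E \<longrightarrow> (v, u) \<in> E) \<and>
    (\<forall>u v w. (u, v) \<in> E \<longrightarrow> (v, w) \<in> E \<longrightarrow> (u, w) \<in> E)"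
  unfolding equiv_def refl_on_def sym_def trans_def by auto

lemma equiv_join: "equiv UNIV E \<Longrightarrow> equiv UNIV (join E x y)"
  unfolding equiv_UNIV_iff join_def by blast

lemma equiv_joins: "equiv UNIV E \<Longrightarrow> equiv UNIV (joins E es)"
  by (induction E es rule: joins.induct) (simp_all add: equiv_join)

lemma joins_superset: "equiv UNIV E \<Longrightarrow> E \<union> set es \<subseteq> joins E es"
proof (induction E es rule: joins.induct)
  case (2 E x y es)
  have "(x, y) \<in> join E x y" "E \<subseteq> join E x y"
    using equiv_class_self[OF 2(2)] by (auto simp: join_def)
  then show ?case using 2(1)[OF equiv_join[OF 2(2)]] by auto
qed simp

lemma joins_least:
  "equiv UNIV T \<Longrightarrow> E \<subseteq> T \<Longrightarrow> set es \<subseteq> T \<Longrightarrow> joins E es \<subseteq> T"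
proof (induction E es rule: joins.induct)
  case (2 E x y es)
  have T: "(u, v) \<in> T \<Longrightarrow> (v, u) \<in> T" "(u, v) \<in> T \<Longrightarrow> (v, w) \<in> T \<Longrightarrow> (u, w) \<in> T" for u v w
    using 2(2) unfolding equiv_UNIV_iff by blast+
  have xy: "(x, y) \<in> T" "(y, x) \<in> T" using 2(4) T(1) by auto
  have "join E x y \<subseteq> T"
  proof (rule subrelI)
    fix u v assume "(u, v) \<in> join E x y"
    then consider "(u, v) \<in> T" | "(u, x) \<in> T" "(y, v) \<in> T" | "(u, y) \<in> T" "(x, v) \<in> T"
      using 2(3) unfolding join_def by blast
    then show "(u, v) \<in> T" using T(2) xy by cases blast+
  qed
  then show ?case using 2 by simp
qed simp

text \<open>A class that contains no end of a remaining pair is never enlarged again. This is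
  applied to a strand that has just closed into a loop.\<close>

lemma joins_image_unchanged:
  assumes "equiv UNIV E" "\<forall>(x, y)\<in>set es. (u, x) \<notin> E \<and> (u, y) \<notin> E"
  shows "joins E es `` {u} = E `` {u}"
  using assms
proof (induction E es rule: joins.induct)
  case (2 E x y es)
  have u: "(u, v) \<in> join E x y \<longleftrightarrow> (u, v) \<in> E" for v
    using 2(3) by (auto simp: join_def)
  have "joins (join E x y) es `` {u} = join E x y `` {u}"
    by (rule 2(1)[OF equiv_join[OF 2(2)]]) (use 2(3) u in auto)
  then show ?case using u by auto
qed simp

definition ends :: "(nat \<times> nat) list \<Rightarrow> nat set" where
  "ends es = fst ` set es \<union> snd ` set es"

lemma ends_Cons [simp]: "ends ((x, y) # es) = insert x (insert y (ends es))"
  by (auto simp: ends_def)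

text \<open>These are the closed loops of the glued picture, \<open>Q\<close> being the set of its
  outer points and \<open>M\<close> that of the glued ones.\<close>

definition closed_classes :: "nat rel \<Rightarrow> nat set \<Rightarrow> nat set \<Rightarrow> nat set set" where
  "closed_classes E M Q = {C. \<exists>z\<in>M. C = E `` {z} \<and> C \<inter> Q = {}}"

text \<open>The invariant of the contraction process: the classes of the equivalence relation
  generated so far meet the remaining points in the pairs of the remaining matching.\<close>

lemma contr_joins:
  assumes "matching p xs" "set xs = Q \<union> ends es" "Q \<inter> ends es = {}" "distinct (map fst es @ map snd es)"
    "equiv UNIV E" "\<forall>x\<in>set xs. E `` {x} \<inter> set xs = {x, p x}"
  shows "(\<forall>x\<in>Q. joins E es `` {x} \<inter> Q = {x, contr p es x}) \<and>
    card (closed_classes (joins E es) (ends es) Q) = loops p es"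
  using assms
proof (induction es arbitrary: p xs E)
  case Nil
  then show ?case by (simp add: ends_def closed_classes_def)
next
  case (Cons e es)
  obtain x y where e: "e = (x, y)" by force
  define q where "q = (if p x = y then p else reconnect p x y)"
  define E1 where "E1 = join E x y"
  have xy: "x \<noteq> y" "x \<notin> ends es" "y \<notin> ends es" "x \<notin> Q" "y \<notin> Q" "distinct (map fst es @ map snd es)"
    using Cons.prems(3,4) e by (auto simp: ends_def)
  have in_xs: "x \<in> set xs" "y \<in> set xs" using Cons.prems(2) e by auto
  define ys where "ys = remove1 x (remove1 y xs)"
  have d: "distinct xs" using Cons.prems(1) by (simp add: matching_def)
  have "add_mset x (mset ys) = mset (remove1 y xs)"
    unfolding ys_def mset_remove1[of x] using in_xs xy(1) by (intro insert_DiffM) (simp del: mset_remove1)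
  then have perm: "mset (x # y # ys) = mset xs"
    using in_xs insert_DiffM[of y "mset xs"] by (simp add: add_mset_commute[of x y])
  have ys: "set ys = Q \<union> ends es"
    using Cons.prems(2) xy e d unfolding ys_def by auto
  have m: "matching p (x # y # ys)" using Cons.prems(1) perm by (rule matching_perm)
  have mq: "matching q ys"
  proof (cases "p x = y")
    case True
    then show ?thesis using matching_remove[of p x "[]" ys] m q_def by simp
  qed (use matching_reconnect[of p "[]"] m q_def in auto)
  have E1: "equiv UNIV E1" unfolding E1_def using Cons.prems(5) by (rule equiv_join)
  have inv: "(u, v) \<in> E \<longleftrightarrow> v = u \<or> v = p u" if "u \<in> set xs" "v \<in> set xs" for u v
    using Cons.prems(6) that by blast
  have sub: "u \<in> set xs" "u \<noteq> x" "u \<noteq> y" if "u \<in> set ys" for u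
    using that d by (auto simp: ys_def)
  have pp: "p (p x) = x" "p (p y) = y" "p x \<in> set xs" "p y \<in> set xs"
    using Cons.prems(1) in_xs by (auto simp: matching_def)
  have pz: "p (p z) = z" if "z \<in> set xs" for z
    using Cons.prems(1) that by (auto simp: matching_def)
  have inv1: "(u, v) \<in> E1 \<longleftrightarrow> v = u \<or> v = q u" if uv: "u \<in> set ys" "v \<in> set ys" for u v
  proof -
    \<comment> \<open>Gluing \<open>x\<close> to \<open>y\<close> newly relates two remaining points
      exactly when they are the partners of \<open>x\<close> and \<open>y\<close>, in either order;
      this is the change that \<open>reconnect\<close> makes.\<close>
    have "(u, v) \<in> E1 \<longleftrightarrow> (v = u \<or> v = p u) \<or> x = p u \<and> v = p y \<or> y = p u \<and> v = p x"
      unfolding E1_def join_def using inv[of u v] inv[of u x] inv[of u y] inv[of x v] inv[of y v]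
        sub[OF uv(1)] sub[OF uv(2)] in_xs by auto
    also have "\<dots> \<longleftrightarrow> v = u \<or> v = q u"
    proof (cases "p x = y")
      case True
      then have "p u \<noteq> x" "p u \<noteq> y" using pz[of u] sub[OF uv(1)] pp by metis+
      then show ?thesis using True by (auto simp: q_def)
    next
      case False
      note f = matching_front_partners[OF m False]
      have a: "x = p u \<longleftrightarrow> u = p x" "y = p u \<longleftrightarrow> u = p y" using pz[of u] sub[OF uv(1)] pp by metis+
      show ?thesis
        using False f sub[OF uv(1)] sub[OF uv(2)] pp unfolding q_def reconnect_def
        by (auto simp: a)
    qed
    finally show ?thesis .
  qed
  have q_in: "q u \<in> set ys" if "u \<in> set ys" for u
    using mq that by (auto simp: matching_def)
  have IH: "(\<forall>x\<in>Q. joins E1 es `` {x} \<inter> Q = {x, contr q es x}) \<and>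
    card (closed_classes (joins E1 es) (ends es) Q) = loops q es"
  proof (rule Cons.IH[OF mq ys _ xy(6) E1])
    show "Q \<inter> ends es = {}" using Cons.prems(3) e by auto
    show "\<forall>x\<in>set ys. E1 `` {x} \<inter> set ys = {x, q x}"
      using inv1 q_in by (auto simp: Image_singleton_iff)
  qed
  let ?J = "joins E1 es"
  have J: "equiv UNIV ?J" using E1 by (rule equiv_joins)
  have fin: "finite (closed_classes ?J (ends es) Q)"
    by (rule finite_subset[of _ "(\<lambda>z. ?J `` {z}) ` ends es"]) (auto simp: closed_classes_def ends_def)
  have "(x, y) \<in> E1"
    using equiv_class_self[OF Cons.prems(5)] by (auto simp: E1_def join_def)
  then have xyJ: "(x, y) \<in> ?J"
    using joins_superset[OF E1, of es] by blast
  then have Jxy: "?J `` {x} = ?J `` {y}" using J by (meson equiv_class_eq)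
  \<comment> \<open>A pair whose points are matched with each other adds the new closed class of
    \<open>x\<close>. Otherwise that class contains \<open>p x\<close>, which is an outer point or
    an end of a later pair, so the class is not closed or is already counted.\<close>
  have "card (closed_classes ?J (insert x (insert y (ends es))) Q)
      = (if p x = y then Suc (loops q es) else loops q es)"
  proof (cases "p x = y")
    case True
    have no: "(x, z) \<notin> E1" if "z \<in> set ys" for z
      unfolding E1_def join_def using inv[of x z] inv[of y z] inv[of x x] inv[of x y] sub[OF that] in_xs True pp by auto
    have Jx: "?J `` {x} = E1 `` {x}"
      by (rule joins_image_unchanged[OF E1]) (use no ys in \<open>force simp: ends_def\<close>)
    then have dis: "?J `` {x} \<inter> set ys = {}" using no by auto
    have "?J `` {x} \<notin> closed_classes ?J (ends es) Q"
    proof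
      assume "?J `` {x} \<in> closed_classes ?J (ends es) Q"
      then obtain z where z: "z \<in> ends es" "?J `` {x} = ?J `` {z}" by (auto simp: closed_classes_def)
      then have "z \<in> ?J `` {x}" using J by (auto simp: equiv_UNIV_iff)
      then show False using dis ys z by auto
    qed
    moreover have "closed_classes ?J (insert x (insert y (ends es))) Q
        = insert (?J `` {x}) (closed_classes ?J (ends es) Q)"
      using dis ys Jxy by (auto simp: closed_classes_def)
    ultimately show ?thesis using IH fin True by simp
  next
    case False
    note f = matching_front_partners[OF m False]
    have "(x, p x) \<in> E" using inv[of x "p x"] in_xs pp by simp
    then have "(x, p x) \<in> ?J" using joins_superset[OF E1, of es] by (auto simp: E1_def join_def)
    then have Jx: "?J `` {x} = ?J `` {p x}" using J by (meson equiv_class_eq)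
    have "p x \<in> Q \<Longrightarrow> ?J `` {x} \<inter> Q \<noteq> {}" using \<open>(x, p x) \<in> ?J\<close> by auto
    moreover have "p x \<in> Q \<or> p x \<in> ends es" using f ys by auto
    ultimately have "closed_classes ?J (insert x (insert y (ends es))) Q = closed_classes ?J (ends es) Q"
      using Jx Jxy unfolding closed_classes_def by auto
    then show ?thesis using IH False by simp
  qed
  then show ?case using IH by (simp add: e E1_def q_def)
qed

section \<open>Composition of diagrams\<close>

definition pts :: "nat \<Rightarrow> nat \<Rightarrow> nat list" where
  "pts k l = [0..<k] @ rev [k..<k + l]"

lemma set_pts [simp]: "set (pts k l) = {..<k + l}"
  by (auto simp: pts_def)

lemma distinct_pts [simp]: "distinct (pts k l)"
  by (auto simp: pts_def)

lemma brauer_matching: "brauer k l p \<Longrightarrow> matching p (pts k l)"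
  by (simp add: brauer_def matching_def)

lemma matching_brauer:
  "matching p (pts k l) \<Longrightarrow> (\<And>i. k + l \<le> i \<Longrightarrow> p i = i) \<Longrightarrow> brauer k l p"
  by (simp add: brauer_def matching_def)

lemma brauer_lt: "brauer k l p \<Longrightarrow> i < k + l \<Longrightarrow> p i < k + l"
  by (simp add: brauer_def)

lemma brauer_ne: "brauer k l p \<Longrightarrow> i < k + l \<Longrightarrow> p i \<noteq> i"
  by (simp add: brauer_def)

lemma brauer_outside: "brauer k l p \<Longrightarrow> k + l \<le> i \<Longrightarrow> p i = i"
  by (simp add: brauer_def)

lemma brauer_invol [simp]: "brauer k l p \<Longrightarrow> p (p i) = i"
  by (cases "i < k + l") (simp_all add: brauer_def)

text \<open>The diagrams are first placed one after the other with two copies of the middle row;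
  \<open>P\<close> is the involution on this doubled picture and \<open>es\<close> pairs the copies.
  \<open>proj\<close> identifies the copies and lands in the numbering of \<open>dglue\<close>,
  while \<open>emb\<close> places the points of the composite among the doubled ones.\<close>

locale gluing =
  fixes k l q :: nat and p1 p2 :: "nat \<Rightarrow> nat"
  assumes p1: "brauer k l p1" and p2: "brauer l q p2"
begin

text \<open>The number of points of the doubled picture, not the \<open>n\<close> of the
  superdimension.\<close>

abbreviation n :: nat where
  "n \<equiv> k + l + l + q"

definition P :: "nat \<Rightarrow> nat" where
  "P i = (if i < k + l then p1 i else k + l + p2 (i - (k + l)))"

definition es :: "(nat \<times> nat) list" where
  "es = map (\<lambda>j. (k + j, k + l + j)) [0..<l]"

definition Q :: "nat set" where
  "Q = {..<k} \<union> {k + l + l..<n}"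

definition proj :: "nat \<Rightarrow> nat" where
  "proj i = (if i < k + l then i else i - l)"

definition emb :: "nat \<Rightarrow> nat" where
  "emb i = (if i < k then i else i + l + l)"

definition E0 :: "nat rel" where
  "E0 = {(u, v). v = u \<or> v = P u}"

definition J :: "nat rel" where
  "J = joins E0 es"

definition G :: "nat rel" where
  "G = {(i, p1 i) | i. i < k + l} \<union> {(k + i, k + p2 i) | i. i < l + q}"

lemma dglue_G: "dglue k l q p2 p1 = G\<^sup>*"
  by (simp add: dglue_def G_def)

lemma P_invol [simp]: "P (P i) = i"
  using brauer_lt[OF p1] brauer_invol[OF p1] brauer_invol[OF p2] by (auto simp: P_def)

lemma equiv_E0: "equiv UNIV E0"
  unfolding equiv_UNIV_iff E0_def by auto

lemma equiv_J: "equiv UNIV J"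
  unfolding J_def by (rule equiv_joins[OF equiv_E0])

lemma length_es [simp]: "length es = l"
  by (simp add: es_def)

lemma map_fst_es: "map fst es = [k..<k + l]"
  by (rule nth_equalityI) (simp_all add: es_def)

lemma map_snd_es: "map snd es = [k + l..<k + l + l]"
  by (rule nth_equalityI) (simp_all add: es_def)

lemma ends_es: "ends es = {k..<k + l + l}"
proof -
  have "set (map fst es) \<union> set (map snd es) = {k..<k + l + l}"
    unfolding map_fst_es map_snd_es by auto
  then show ?thesis by (simp add: ends_def)
qed

lemma sym_G: "sym G"
proof (rule symI)
  fix a b assume "(a, b) \<in> G"
  then consider i where "a = i" "b = p1 i" "i < k + l" | i where "a = k + i" "b = k + p2 i" "i < l + q"
    by (auto simp: G_def)
  then show "(b, a) \<in> G"
  proof cases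
    case 1
    then have "(p1 i, p1 (p1 i)) \<in> G" using brauer_lt[OF p1] unfolding G_def by blast
    then show ?thesis using 1 p1 by simp
  next
    case 2
    then have "(k + p2 i, k + p2 (p2 i)) \<in> G" using brauer_lt[OF p2] unfolding G_def by blast
    then show ?thesis using 2 p2 by simp
  qed
qed

lemma equiv_G: "equiv UNIV (G\<^sup>*)"
  unfolding equiv_UNIV_iff using sym_G by (auto intro: symD[OF sym_rtrancl])

lemma P_lt: "u < n \<Longrightarrow> P u < n"
  using brauer_lt[OF p1, of u] brauer_lt[OF p2, of "u - (k + l)"] by (auto simp: P_def)

lemma P_ge: "n \<le> u \<Longrightarrow> P u = u"
  using brauer_outside[OF p2, of "u - (k + l)"] by (auto simp: P_def)

lemma proj_P: "u < n \<Longrightarrow> (proj u, proj (P u)) \<in> G\<^sup>*"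
proof -
  assume u: "u < n"
  show ?thesis
  proof (cases "u < k + l")
    case True
    then have "(u, p1 u) \<in> G" by (auto simp: G_def)
    then show ?thesis using True brauer_lt[OF p1, of u] by (simp add: proj_def P_def)
  next
    case False
    then have "(k + (u - (k + l)), k + p2 (u - (k + l))) \<in> G" using u unfolding G_def by fastforce
    then show ?thesis using False by (auto simp: proj_def P_def)
  qed
qed

text \<open>The pullback \<open>T\<close> of \<open>G\<^sup>*\<close> along \<open>proj\<close> is
  an equivalence relation containing all edges and all pairs, hence contains the generated relation
  \<open>J\<close>. The bound is carried along so that classes stay within the points of the
  picture.\<close>

lemma J_imp_G: "(u, v) \<in> J \<Longrightarrow> (u < n \<longleftrightarrow> v < n) \<and> (u < n \<longrightarrow> (proj u, proj v) \<in> G\<^sup>*)"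
proof -
  define T where "T = {(u, v). (u < n \<longleftrightarrow> v < n) \<and> (u < n \<longrightarrow> (proj u, proj v) \<in> G\<^sup>*)}"
  have "equiv UNIV T"
    using equiv_G unfolding equiv_UNIV_iff T_def by blast
  moreover have "E0 \<subseteq> T"
    using P_lt P_ge proj_P unfolding E0_def T_def by (auto simp: not_less) (metis not_le)
  moreover have "set es \<subseteq> T"
    by (auto simp: es_def T_def proj_def)
  ultimately have "J \<subseteq> T" unfolding J_def by (rule joins_least)
  then show "(u, v) \<in> J \<Longrightarrow> ?thesis" unfolding T_def by blast
qed

lemma J_rules: "(u, u) \<in> J" "(u, v) \<in> J \<Longrightarrow> (v, u) \<in> J" "(u, v) \<in> J \<Longrightarrow> (v, w) \<in> J \<Longrightarrow> (u, w) \<in> J"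
  using equiv_J unfolding equiv_UNIV_iff by blast+

lemma J_P: "(u, P u) \<in> J"
  using joins_superset[OF equiv_E0, of es] unfolding J_def E0_def by blast

lemma proj_eq_J:
  assumes "proj u = proj v"
  shows "(u, v) \<in> J"
proof -
  have *: "(i, i + l) \<in> J" if "k \<le> i" "i < k + l" for i
  proof -
    have "(k + (i - k), k + l + (i - k)) \<in> set es" using that
      unfolding es_def by (auto simp: image_iff intro!: bexI[of _ "i - k"])
    then have "(i, i + l) \<in> set es" using that by (simp add: add.commute)
    then show ?thesis using joins_superset[OF equiv_E0, of es] unfolding J_def by blast
  qed
  consider "u = v" | "v = u + l" "k \<le> u" "u < k + l" | "u = v + l" "k \<le> v" "v < k + l"
    using assms by (force simp: proj_def split: if_splits)
  then show ?thesis using * J_rules by cases blast+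
qed

lemma G_imp_J: "(a, b) \<in> G\<^sup>* \<Longrightarrow> proj u = a \<Longrightarrow> proj v = b \<Longrightarrow> (u, v) \<in> J"
proof (induction arbitrary: v rule: rtrancl_induct)
  case base
  then show ?case by (intro proj_eq_J) simp
next
  case (step b c)
  from step.hyps(2) consider i where "b = i" "c = p1 i" "i < k + l" | i where "b = k + i" "c = k + p2 i" "i < l + q"
    by (auto simp: G_def)
  \<comment> \<open>An edge of \<open>p1\<close> lifts to the first block of points and an edge of
    \<open>p2\<close> to the second. The lifts of consecutive edges may start in different copies of
    a middle point, which \<open>proj_eq_J\<close> repairs.\<close>
  then obtain s where s: "proj s = b" "proj (P s) = c"
  proof cases
    case 1
    then show ?thesis using that[of i] brauer_lt[OF p1, of i] by (simp add: proj_def P_def)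
  next
    case 2
    then show ?thesis using that[of "k + l + i"] by (simp add: proj_def P_def)
  qed
  have "(u, s) \<in> J" using step.IH step.prems(1) s by blast
  moreover have "(P s, v) \<in> J" using s step.prems(2) by (intro proj_eq_J) simp
  ultimately show ?case using J_P[of s] J_rules(3)[of u s "P s"] J_rules(3)[of u "P s" v] by blast
qed

lemma J_iff: "u < n \<Longrightarrow> (u, v) \<in> J \<longleftrightarrow> v < n \<and> (proj u, proj v) \<in> G\<^sup>*"
  using J_imp_G G_imp_J by blast

lemma proj_emb: "proj (emb i) = douter k l i"
  by (simp add: proj_def emb_def douter_def)

lemma emb_inj: "emb i = emb j \<longleftrightarrow> i = j"
  by (auto simp: emb_def split: if_splits)

lemma Q_emb: "Q = emb ` {..<k + q}"
proof
  show "Q \<subseteq> emb ` {..<k + q}"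
  proof
    fix x assume x: "x \<in> Q"
    show "x \<in> emb ` {..<k + q}"
    proof (cases "x < k")
      case True
      then show ?thesis by (intro image_eqI[of _ _ x]) (auto simp: emb_def)
    next
      case False
      then show ?thesis using x by (intro image_eqI[of _ _ "x - l - l"]) (auto simp: emb_def Q_def)
    qed
  qed
qed (auto simp: emb_def Q_def)

definition big :: "nat list" where
  "big = [0..<k] @ rev (map fst es) @ map snd es @ rev [k + l + l..<n]"

lemma map_add_upt_shift: "map (\<lambda>i. i + j) [a..<b] = [a + j..<b + j]"
  by (rule nth_equalityI) auto

lemma map_add_rev: "map (\<lambda>i. i + j) (rev [a..<b]) = rev [a + j..<b + j]"
  unfolding rev_map[symmetric] by (subst map_add_upt_shift) (rule refl)

lemma big_pts: "big = pts k l @ map (\<lambda>i. i + (k + l)) (pts l q)"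
  unfolding big_def map_fst_es map_snd_es pts_def map_append map_add_rev
  by (simp add: map_add_upt_shift add_ac)

lemma outer_pts: "[0..<k] @ rev [k + l + l..<n] = map emb (pts k q)"
proof -
  have "map emb [0..<k] = [0..<k]" by (rule nth_equalityI) (auto simp: emb_def)
  moreover have "map emb (rev [k..<k + q]) = map (\<lambda>i. i + (l + l)) (rev [k..<k + q])"
    by (rule map_cong) (auto simp: emb_def)
  ultimately show ?thesis
    unfolding pts_def map_append map_add_rev by (simp add: add_ac)
qed

lemma matching_big: "matching P big"
proof -
  have "set big = {..<n}" unfolding big_pts by (auto simp: image_iff intro: bexI[of _ "_ - (k + l)"])
    (metis add_diff_inverse_nat add.commute add_less_cancel_left lessThan_iff group_cancel.add1)
  moreover have "distinct big" unfolding big_pts by (auto simp: distinct_map inj_on_def)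
  moreover have "P x \<noteq> x" if "x < n" for x
  proof (cases "x < k + l")
    case False
    then have "x - (k + l) < l + q" using that by simp
    then show ?thesis using brauer_ne[OF p2] False by (fastforce simp: P_def)
  qed (use brauer_ne[OF p1] in \<open>simp add: P_def\<close>)
  ultimately show ?thesis using P_lt by (simp add: matching_def)
qed

lemma set_big: "set big = Q \<union> ends es"
proof -
  have "set big = set ([0..<k] @ rev [k + l + l..<n]) \<union> ends es"
    unfolding big_def by (auto simp: ends_def)
  moreover have "set ([0..<k] @ rev [k + l + l..<n]) = Q" by (auto simp: Q_def)
  ultimately show ?thesis by blast
qed

lemma contr_P:
  "x \<in> Q \<Longrightarrow> J `` {x} \<inter> Q = {x, contr P es x}"
  "card (closed_classes J (ends es) Q) = loops P es"
proof -
  have "(\<forall>x\<in>Q. joins E0 es `` {x} \<inter> Q = {x, contr P es x}) \<and>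
    card (closed_classes (joins E0 es) (ends es) Q) = loops P es"
  proof (rule contr_joins[OF matching_big set_big _ _ equiv_E0])
    show "Q \<inter> ends es = {}" unfolding ends_es Q_def by auto
    show "distinct (map fst es @ map snd es)" unfolding map_fst_es map_snd_es by auto
    show "\<forall>x\<in>set big. E0 `` {x} \<inter> set big = {x, P x}"
      using matching_big by (auto simp: E0_def matching_def)
  qed
  then show "x \<in> Q \<Longrightarrow> J `` {x} \<inter> Q = {x, contr P es x}"
    "card (closed_classes J (ends es) Q) = loops P es"
    unfolding J_def by blast+
qed

text \<open>The class of an outer point meets \<open>Q\<close> only in this point and its contracted
  partner, so the definite description in \<open>dcomp\<close> has exactly one solution.\<close>

lemma dcomp_iff:
  assumes i: "i < k + q" and m: "matching (contr P es) (map emb (pts k q))"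
  shows "j = dcomp k l q p2 p1 i \<longleftrightarrow> emb j = contr P es (emb i)"
proof -
  have Q: "set (map emb (pts k q)) = Q" by (simp add: Q_emb)
  have iQ: "emb i \<in> Q" using i by (simp add: Q_emb)
  then have "contr P es (emb i) \<in> Q" and ne: "contr P es (emb i) \<noteq> emb i"
    using m Q unfolding matching_def by blast+
  then obtain j0 where j0: "j0 < k + q" "emb j0 = contr P es (emb i)" by (auto simp: Q_emb)
  have lt: "x \<in> Q \<Longrightarrow> x < n" for x by (auto simp: Q_def)
  have "(douter k l i, douter k l j) \<in> dglue k l q p2 p1 \<longleftrightarrow> j = i \<or> j = j0" if "j < k + q" for j
  proof -
    have jQ: "emb j \<in> Q" using that by (simp add: Q_emb)
    have "(douter k l i, douter k l j) \<in> dglue k l q p2 p1 \<longleftrightarrow> (emb i, emb j) \<in> J"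
      using J_iff[OF lt[OF iQ]] lt[OF jQ] by (simp add: dglue_G proj_emb)
    also have "\<dots> \<longleftrightarrow> emb j \<in> {emb i, contr P es (emb i)}"
      using contr_P(1)[OF iQ] jQ by blast
    finally show ?thesis by (auto simp: emb_inj simp flip: j0(2))
  qed
  then have "(j < k + q \<and> j \<noteq> i \<and> (douter k l i, douter k l j) \<in> dglue k l q p2 p1) \<longleftrightarrow> j = j0" for j
    using j0(1) ne by (auto simp flip: j0(2))
  then have "dcomp k l q p2 p1 i = j0" using i by (simp add: dcomp_def)
  then show ?thesis by (auto simp: emb_inj simp flip: j0(2))
qed

lemma G_lt: "(a, b) \<in> G\<^sup>* \<Longrightarrow> a < k + l + q \<Longrightarrow> b < k + l + q"
proof (induction rule: rtrancl_induct)
  case (step b c)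
  then show ?case using brauer_lt[OF p1] brauer_lt[OF p2] by (fastforce simp: G_def)
qed

lemma proj_class: "u < n \<Longrightarrow> proj ` (J `` {u}) = G\<^sup>* `` {proj u}"
proof
  assume u: "u < n"
  show "proj ` (J `` {u}) \<subseteq> G\<^sup>* `` {proj u}" using J_iff[OF u] by auto
  show "G\<^sup>* `` {proj u} \<subseteq> proj ` (J `` {u})"
  proof
    fix b assume b: "b \<in> G\<^sup>* `` {proj u}"
    have "proj u < k + l + q" using u by (auto simp: proj_def)
    then have "b < k + l + q" using b G_lt by blast
    then obtain v where v: "v < n" "proj v = b"
      by (intro that[of "if b < k + l then b else b + l"]) (auto simp: proj_def)
    then have "(u, v) \<in> J" using b J_iff[OF u] by simp
    then show "b \<in> proj ` (J `` {u})" using v by blast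
  qed
qed

text \<open>Taking images under \<open>proj\<close> maps the closed classes of the doubled picture
  bijectively to the loops of the glued one; a class of a middle point misses \<open>Q\<close>
  exactly if its image lies in the middle row.\<close>

lemma dloops_eq: "dloops k l q p2 p1 = loops P es"
proof -
  have mid: "J `` {z} \<inter> Q = {} \<longleftrightarrow> G\<^sup>* `` {proj z} \<subseteq> {k..<k + l}" if "z \<in> ends es" for z
  proof -
    have z: "z < n" using that by (auto simp: ends_es)
    have "v \<in> Q \<longleftrightarrow> proj v \<notin> {k..<k + l}" if "v < n" for v
      using that by (auto simp: Q_def proj_def)
    then have "J `` {z} \<inter> Q = {} \<longleftrightarrow> proj ` (J `` {z}) \<subseteq> {k..<k + l}"
      using J_iff[OF z] by blast
    then show ?thesis by (simp add: proj_class[OF z])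
  qed
  have lt: "z \<in> ends es \<Longrightarrow> z < n" for z by (auto simp: ends_es)
  have "bij_betw (image proj) (closed_classes J (ends es) Q)
    {C. \<exists>x. k \<le> x \<and> x < k + l \<and> C = G\<^sup>* `` {x} \<and> C \<subseteq> {k..<k + l}}" (is "bij_betw _ ?A ?B")
  proof (rule bij_betw_imageI)
    show "inj_on (image proj) ?A"
    proof (rule inj_onI)
      fix C D assume "C \<in> ?A" "D \<in> ?A" and eq: "proj ` C = proj ` D"
      then obtain z w where zw: "z \<in> ends es" "w \<in> ends es" "C = J `` {z}" "D = J `` {w}"
        by (auto simp: closed_classes_def)
      then have "proj w \<in> G\<^sup>* `` {proj z}"
        using eq proj_class[OF lt[OF zw(1)]] proj_class[OF lt[OF zw(2)]] by simp
      then have "(z, w) \<in> J" using J_iff[OF lt[OF zw(1)]] lt[OF zw(2)] by simp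
      then show "C = D" using zw equiv_J by (meson equiv_class_eq)
    qed
    show "image proj ` ?A = ?B"
    proof
      show "image proj ` ?A \<subseteq> ?B"
      proof
        fix C assume "C \<in> image proj ` ?A"
        then obtain z where z: "z \<in> ends es" "C = proj ` (J `` {z})" "J `` {z} \<inter> Q = {}"
          by (auto simp: closed_classes_def)
        then have "C = G\<^sup>* `` {proj z}" "C \<subseteq> {k..<k + l}"
          using proj_class[OF lt[OF z(1)]] mid[OF z(1)] by auto
        moreover have "k \<le> proj z" "proj z < k + l" using z(1) by (auto simp: ends_es proj_def)
        ultimately show "C \<in> ?B" by blast
      qed
      show "?B \<subseteq> image proj ` ?A"
      proof
        fix C assume "C \<in> ?B"
        then obtain x where x: "k \<le> x" "x < k + l" "C = G\<^sup>* `` {x}" "C \<subseteq> {k..<k + l}" by blast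
        then have xe: "x \<in> ends es" "proj x = x" by (auto simp: ends_es proj_def)
        then have "C = proj ` (J `` {x})" using proj_class[OF lt[OF xe(1)]] x by simp
        moreover have "J `` {x} \<in> ?A" using mid[OF xe(1)] xe x by (auto simp: closed_classes_def)
        ultimately show "C \<in> image proj ` ?A" by blast
      qed
    qed
  qed
  then have "card ?A = card ?B" by (rule bij_betw_same_card)
  then show ?thesis using contr_P(2) by (simp add: dloops_def dglue_G)
qed

end

context superform
begin

lemma Z_map:
  assumes "matching p xs" "inj_on f (set xs)" "\<And>x. x \<in> set xs \<Longrightarrow> q (f x) = f (p x)"
  shows "Z q c (map f xs) = Z p (\<lambda>z. c (f z)) xs"
  using assms
proof (induction xs rule: length_induct)
  case (1 xs)
  show ?case
  proof (cases xs)
    case (Cons x ys)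
    obtain us zs where ys: "ys = us @ p x # zs" "p x \<notin> set us"
      using matching_split "1.prems"(1) Cons by metis
    have m: "matching p (us @ zs)" using matching_remove "1.prems"(1) Cons ys by metis
    have "Z q c (map f (us @ zs)) = Z p (\<lambda>z. c (f z)) (us @ zs)"
      by (rule "1.IH"[rule_format, OF _ m]) (use "1.prems"(2,3) Cons ys in \<open>auto simp: inj_on_def\<close>)
    moreover have "f (p x) \<notin> set (map f us)"
    proof
      assume "f (p x) \<in> set (map f us)"
      then obtain z where z: "z \<in> set us" "f (p x) = f z" by auto
      then have "p x = z" using "1.prems"(2) Cons ys by (auto simp: inj_on_def)
      then show False using z ys by simp
    qed
    ultimately show ?thesis
      using Z_expand[of p x us "\<lambda>z. c (f z)" zs] Z_expand'[of "f (p x)" q "f x" "map f us" c "map f zs"]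
        "1.prems"(3)[of x] ys Cons by (simp add: comp_def)
  qed simp
qed

end

section \<open>Matrix coefficients of diagrams and of their composites\<close>

context superspace
begin

definition dcol :: "nat \<Rightarrow> nat list \<Rightarrow> nat list \<Rightarrow> nat \<Rightarrow> 'c" where
  "dcol k u v i = (if i < k then L (u ! i) else R (v ! (i - k)))"

text \<open>This becomes the coefficient of the basis tensor of \<open>v\<close> in the image of the
  basis tensor of \<open>u\<close> under the diagram: bottom points carry basis colours, top points
  dual colours.\<close>

definition dval :: "(nat \<Rightarrow> nat) \<Rightarrow> nat \<Rightarrow> nat \<Rightarrow> nat list \<Rightarrow> nat list \<Rightarrow> complex" where
  "dval p k l u v = Z p (dcol k u v) (pts k l)"

lemma colour_outside: "z \<notin> ends es \<Longrightarrow> colour c es w z = c z"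
  by (induction c es w rule: colour.induct) auto

lemma colour_ends:
  assumes "distinct (map fst es @ map snd es)" "length w = length es" "j < length es"
  shows "colour c es w (fst (es ! j)) = R (w ! j) \<and> colour c es w (snd (es ! j)) = L (w ! j)"
  using assms
proof (induction es arbitrary: w j)
  case (Cons e es)
  obtain x y where e: "e = (x, y)" by force
  from Cons.prems(2) obtain a w' where w: "w = a # w'" "length w' = length es"
    by (cases w) auto
  show ?case
  proof (cases j)
    case (Suc i)
    then have i: "i < length es" using Cons.prems by simp
    then have mem: "fst (es ! i) \<in> set (map fst es)" "snd (es ! i) \<in> set (map snd es)" by simp_all
    then have ne: "fst (es ! i) \<noteq> x" "fst (es ! i) \<noteq> y" "snd (es ! i) \<noteq> x" "snd (es ! i) \<noteq> y"
      using Cons.prems(1) e by (simp_all, metis+)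
    show ?thesis using Cons.IH[of w' i] Cons.prems(1) ne w i Suc e by auto
  qed (use Cons.prems(1) e w in auto)
qed simp

end

locale superspace_gluing = superspace + gluing
begin

text \<open>Both sides evaluate the same sum over the doubled picture: before contraction each state
  sum factors into those of the two diagrams, afterwards it is that of the composite with one factor
  \<open>sdim\<close> per loop. The involution property of the composite is a by-product of the
  contraction.\<close>

lemma dval_dcomp_aux:
  assumes u: "u \<in> strings N k" and v: "v \<in> strings N q"
  shows "(\<Sum>w\<in>strings N l. dval p1 k l u w * dval p2 l q w v)
      = sdim ^ dloops k l q p2 p1 * dval (dcomp k l q p2 p1) k q u v \<and>
    brauer k q (dcomp k l q p2 p1)"
proof -
  define c where "c z = (if z < k then L (u ! z) else R (v ! (z - (k + l + l))))" for z
  have len: "length u = k" "length v = q" using u v by (auto simp: strings_def)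
  have V: "\<forall>z\<in>set ([0..<k] @ rev [k + l + l..<n]). c z \<in> V"
    using u v len L_V R_V by (auto simp: c_def strings_def)
  have m: "matching P ([0..<k] @ rev (map fst es) @ map snd es @ rev [k + l + l..<n])"
    using matching_big by (simp add: big_def)
  note all = Z_contract_all[OF m V]
  have m': "matching (contr P es) (map emb (pts k q))"
    using all by (simp add: outer_pts)
  have dc: "emb (dcomp k l q p2 p1 i) = contr P es (emb i)" if "i < k + q" for i
    using dcomp_iff[OF that m'] by blast
  have inj: "inj_on emb (set (pts k q))" by (simp add: inj_on_def emb_inj)
  have md: "matching (dcomp k l q p2 p1) (pts k q)"
    unfolding matching_def
  proof (intro conjI ballI)
    fix x assume x: "x \<in> set (pts k q)"
    let ?y = "dcomp k l q p2 p1 x"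
    have e: "emb ?y = contr P es (emb x)" using x by (intro dc) simp
    have "emb ?y \<in> emb ` set (pts k q)" "emb ?y \<noteq> emb x" "contr P es (emb ?y) = emb x"
      using m' x unfolding e matching_def by auto
    then show y: "?y \<in> set (pts k q)" "?y \<noteq> x" by (auto simp: emb_inj)
    then show "dcomp k l q p2 p1 ?y = x"
      using dcomp_iff[OF _ m', of ?y x] \<open>contr P es (emb ?y) = emb x\<close> by simp
  qed simp
  have "Z P (colour c es w) big = dval p1 k l u w * dval p2 l q w v" if w: "w \<in> strings N l" for w
  proof -
    have lw: "length w = length es" using w by (simp add: strings_def)
    have dis: "distinct (map fst es @ map snd es)" unfolding map_fst_es map_snd_es by auto
    have lo: "colour c es w (k + j) = R (w ! j)" and hi: "colour c es w (k + l + j) = L (w ! j)" if "j < l" for j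
      using colour_ends[OF dis lw, of j c] that by (simp_all add: es_def)
    have out: "colour c es w z = c z" if "z < k \<or> k + l + l \<le> z" for z
      using that by (intro colour_outside) (auto simp: ends_es)
    have m1: "matching P (pts k l)"
      using brauer_matching[OF p1] by (subst matching_cong[of _ P p1]) (auto simp: P_def)
    have "Z P (colour c es w) big
        = Z P (colour c es w) (pts k l) * Z P (colour c es w) (map (\<lambda>i. i + (k + l)) (pts l q))"
      using Z_append[OF m1] matching_big unfolding big_pts by blast
    also have "Z P (colour c es w) (pts k l) = dval p1 k l u w"
      unfolding dval_def
    proof (rule Z_cong[OF m1])
      fix x assume "x \<in> set (pts k l)"
      then have "x < k + l" by simp
      then show "P x = p1 x" "colour c es w x = dcol k u w x"
        using lo[of "x - k"] out[of x] by (auto simp: P_def dcol_def c_def)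
    qed
    also have "Z P (colour c es w) (map (\<lambda>i. i + (k + l)) (pts l q))
        = Z p2 (\<lambda>z. colour c es w (z + (k + l))) (pts l q)"
      by (rule Z_map[OF brauer_matching[OF p2]]) (auto simp: P_def inj_on_def)
    also have "\<dots> = dval p2 l q w v"
      unfolding dval_def
    proof (rule Z_cong[OF brauer_matching[OF p2] refl])
      fix x assume "x \<in> set (pts l q)"
      then show "colour c es w (x + (k + l)) = dcol l w v x"
        using hi[of x] out[of "x + (k + l)"] by (auto simp: dcol_def c_def add_ac)
    qed
    finally show ?thesis .
  qed
  then have "(\<Sum>w\<in>strings N l. dval p1 k l u w * dval p2 l q w v)
      = sdim ^ loops P es * Z (contr P es) c (map emb (pts k q))"
    using all by (simp add: outer_pts big_def)
  also have "Z (contr P es) c (map emb (pts k q)) = Z (dcomp k l q p2 p1) (\<lambda>z. c (emb z)) (pts k q)"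
    by (rule Z_map[OF md inj]) (simp add: dc)
  also have "\<dots> = dval (dcomp k l q p2 p1) k q u v"
    unfolding dval_def by (rule Z_cong[OF md refl]) (auto simp: c_def emb_def dcol_def)
  finally have "(\<Sum>w\<in>strings N l. dval p1 k l u w * dval p2 l q w v)
      = sdim ^ dloops k l q p2 p1 * dval (dcomp k l q p2 p1) k q u v"
    by (simp add: dloops_eq)
  moreover have "brauer k q (dcomp k l q p2 p1)"
    by (rule matching_brauer[OF md]) (simp add: dcomp_def)
  ultimately show ?thesis ..
qed

end

section \<open>The orthosymplectic state sum\<close>

text \<open>Colours: \<open>Inl a\<close> is the basis vector \<open>e\<^sub>a\<close>, \<open>Inr a\<close> the dual vector \<open>e\<^sup>a\<close>
  with \<open>(e\<^sub>a, e\<^sup>b) = \<delta>\<^sub>a\<^sub>b\<close>.\<close>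

fun bform :: "nat \<Rightarrow> nat + nat \<Rightarrow> nat + nat \<Rightarrow> complex" where
  "bform m (Inl a) (Inl b) = eta m a b"
| "bform m (Inl a) (Inr b) = (if a = b then 1 else 0)"
| "bform m (Inr a) (Inl b) = (if a = b then (if m \<le> a then - 1 else 1) else 0)"
| "bform m (Inr a) (Inr b) = eta_inv m b a"

fun bodd :: "nat \<Rightarrow> nat + nat \<Rightarrow> bool" where
  "bodd m (Inl a) = (m \<le> a)"
| "bodd m (Inr a) = (m \<le> a)"

lemma eta_sym: "eta m b a = (if m \<le> a \<and> m \<le> b then - 1 else 1) * eta m a b"
  by (auto simp: eta_def)

lemma eta_inv_sym: "eta_inv m b a = (if m \<le> a \<and> m \<le> b then - 1 else 1) * eta_inv m a b"
  by (auto simp: eta_inv_def)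

lemma eta_parity: "eta m a b \<noteq> 0 \<Longrightarrow> m \<le> a \<longleftrightarrow> m \<le> b"
  by (auto simp: eta_def split: if_splits)

lemma eta_inv_parity: "eta_inv m a b \<noteq> 0 \<Longrightarrow> m \<le> a \<longleftrightarrow> m \<le> b"
  by (auto simp: eta_inv_def split: if_splits)

lemma sum_eta_inv_eta:
  assumes "b < m + 2 * n"
  shows "(\<Sum>a<m + 2 * n. eta_inv m b a * eta m a c) = (if b = c then 1 else 0)"
proof -
  \<comment> \<open>\<open>a0\<close> is the only index at which row \<open>b\<close> of
    \<open>eta_inv\<close> is nonzero: \<open>b\<close> itself in the even part, the other index of
    its two-element block in the odd part. It stays in range because such blocks fill the
    \<open>2 * n\<close> odd indices.\<close>
  define a0 where "a0 = (if b < m then b else if even (b - m) then b + 1 else b - 1)"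
  have "a0 < m + 2 * n"
  proof (cases "b < m \<or> odd (b - m)")
    case False
    then have "b - m < 2 * n" "even (b - m)" using assms by auto
    then have "b - m + 1 < 2 * n" by presburger
    moreover have "a0 = b + 1" using False unfolding a0_def by argo
    ultimately show ?thesis using False by linarith
  qed (use assms in \<open>auto simp: a0_def\<close>)
  moreover have "eta_inv m b a * eta m a c = (if a = a0 then (if b = c then 1 else 0) else 0)" for a
  proof (cases "b < m")
    case True
    then show ?thesis by (auto simp: a0_def eta_def eta_inv_def)
  next
    case b: False
    show ?thesis
    proof (cases "even (b - m)")
      case True
      then show ?thesis using b by (auto simp: a0_def eta_def eta_inv_def)
    next
      case False
      then have "m < b" using b by (cases "b = m") auto
      then obtain d where "b = m + Suc d" by (auto dest: less_imp_Suc_add)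
      then show ?thesis using False by (auto simp: a0_def eta_def eta_inv_def)
    qed
  qed
  ultimately show ?thesis by (simp add: sum.delta)
qed

text \<open>The inverse agrees with \<open>eta\<close> on the even part and is its negative on the
  odd part. Both factors of a nonzero product change by the same sign, so the two matrices may be
  exchanged.\<close>

lemma sum_eta_eta_inv:
  assumes "b < m + 2 * n"
  shows "(\<Sum>a<m + 2 * n. eta m b a * eta_inv m a c) = (if b = c then 1 else 0)"
proof -
  have "eta m b a = (if m \<le> b then - 1 else 1) * eta_inv m b a"
    "eta_inv m a c = (if m \<le> a then - 1 else 1) * eta m a c" for a
    by (auto simp: eta_def eta_inv_def)
  then have "eta m b a * eta_inv m a c = eta_inv m b a * eta m a c" for a
    using eta_inv_parity[of m b a] by (cases "eta_inv m b a = 0") auto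
  then show ?thesis using sum_eta_inv_eta[OF assms] by simp
qed

interpretation bf: superform "bform m" "bodd m" for m
proof
  fix x y
  show "bform m y x = (if bodd m x \<and> bodd m y then - 1 else 1) * bform m x y"
  proof (cases x; cases y)
    fix a b assume "x = Inl a" "y = Inl b"
    then show ?thesis using eta_sym[of m b a] by simp
  next
    fix a b assume "x = Inr a" "y = Inr b"
    then show ?thesis using eta_inv_sym[of m a b] by simp
  qed auto
  show "bodd m x \<noteq> bodd m y \<Longrightarrow> bform m x y = 0"
    using eta_parity[of m] eta_inv_parity[of m] by (cases x; cases y; fastforce)
qed

text \<open>In three of the four cases one factor of \<open>resolution\<close> is a Kronecker delta
  and the sum collapses; only a dual vector paired with a basis vector uses the inverse
  matrix.\<close>

interpretation bs: superspace "bform m" "bodd m" Inr Inl "m + 2 * n"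
  "Inl ` {..<m + 2 * n} \<union> Inr ` {..<m + 2 * n}" for m n
proof
  fix u v :: "nat + nat"
  let ?V = "Inl ` {..<m + 2 * n} \<union> Inr ` {..<m + 2 * n}"
  assume u: "u \<in> ?V" and v: "v \<in> ?V"
  have 1: "(\<Sum>a<m + 2 * n. eta_inv m a b * eta m a c) = (if b = c then if m \<le> b then - 1 else 1 else 0)"
    if "b < m + 2 * n" for b c
  proof -
    have "(\<Sum>a<m + 2 * n. eta_inv m a b * eta m a c)
      = (\<Sum>a<m + 2 * n. (if m \<le> b then - 1 else 1) * (eta_inv m b a * eta m a c))"
      by (rule sum.cong[OF refl]) (auto simp: eta_inv_def)
    also have "\<dots> = (if m \<le> b then - 1 else 1) * (if b = c then 1 else 0)"
      by (simp only: sum_distrib_left[symmetric] sum_eta_inv_eta[OF that])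
    finally show ?thesis by simp
  qed
  show "(\<Sum>a<m + 2 * n. bform m u (Inr a) * bform m (Inl a) v) = bform m u v"
  proof (cases u; cases v)
    fix b c assume "u = Inl b" "v = Inl c"
    then show ?thesis using u by (simp add: if_distrib[of "\<lambda>x. x * _"] sum.delta cong: if_cong) auto
  next
    fix b c assume "u = Inl b" "v = Inr c"
    then show ?thesis using u by (simp add: if_distrib[of "\<lambda>x. x * _"] sum.delta cong: if_cong) auto
  next
    fix b c assume "u = Inr b" "v = Inl c"
    then show ?thesis using u by (auto simp: 1)
  next
    fix b c assume "u = Inr b" "v = Inr c"
    then show ?thesis using v by (simp add: if_distrib[of "\<lambda>x. _ * x"] sum.delta cong: if_cong) auto
  qed
qed auto

lemma sdim_bform: "bs.sdim m n = of_int (int m - 2 * int n)"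
proof -
  have "bs.sdim m n = (\<Sum>a<m + 2 * n. if m \<le> a then - 1 else 1)"
    by (simp add: bs.sdim_def)
  also have "\<dots> = (\<Sum>a<m. 1) + (\<Sum>a = m..<m + 2 * n. - 1)"
    by (simp add: lessThan_atLeast0 sum.atLeastLessThan_concat[of 0 m "m + 2 * n", symmetric])
  finally show ?thesis by simp
qed

abbreviation dval :: "nat \<Rightarrow> (nat \<Rightarrow> nat) \<Rightarrow> nat \<Rightarrow> nat \<Rightarrow> nat list \<Rightarrow> nat list \<Rightarrow> complex" where
  "dval m \<equiv> bs.dval m"

lemma words_strings: "words m n r = strings (m + 2 * n) r"
  by (simp add: words_def strings_def)

text \<open>The claim is purely combinatorial but is read off from \<open>dval_dcomp_aux\<close>,
  for which a superspace with at least one colour has to be chosen; the purely odd one with two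
  basis vectors serves.\<close>

lemma brauer_dcomp:
  assumes "brauer k l p1" "brauer l q p2"
  shows "brauer k q (dcomp k l q p2 p1)"
proof -
  interpret g: superspace_gluing "bform 0" "bodd 0" Inr Inl "0 + 2 * 1"
    "Inl ` {..<0 + 2 * 1} \<union> Inr ` {..<0 + 2 * 1}" k l q p1 p2
    using assms by unfold_locales
  have "replicate k 0 \<in> strings (0 + 2 * 1) k" "replicate q 0 \<in> strings (0 + 2 * 1) q"
    by (auto simp: strings_def)
  from g.dval_dcomp_aux[OF this] show ?thesis ..
qed

lemma dval_dcomp:
  assumes "brauer k l p1" "brauer l q p2" "u \<in> words m n k" "v \<in> words m n q"
  shows "(\<Sum>w\<in>words m n l. dval m p1 k l u w * dval m p2 l q w v)
      = of_int (int m - 2 * int n) ^ dloops k l q p2 p1 * dval m (dcomp k l q p2 p1) k q u v"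
proof -
  interpret g: superspace_gluing "bform m" "bodd m" Inr Inl "m + 2 * n"
    "Inl ` {..<m + 2 * n} \<union> Inr ` {..<m + 2 * n}" k l q p1 p2
    using assms by unfold_locales
  show ?thesis
    using g.dval_dcomp_aux[of u v] assms by (simp add: words_strings sdim_bform)
qed

text \<open>The odd colour \<open>Inl m\<close> serves as a probe: its total sign against the
  boundary points records the parity of the number of odd letters, and \<open>Z_nonzero_ksl\<close>
  makes this sign 1.\<close>

lemma dval_parity:
  assumes D: "brauer k l D" and u: "length u = k" and v: "length v = l" and nz: "dval m D k l u v \<noteq> 0"
  shows "wpar m u = wpar m v"
proof -
  define c where "c = bs.dcol k u v"
  have par: "bf.ksl m (Inl m) cs = (-1) ^ length (filter (bodd m) cs)" for cs
    by (induction cs) (simp_all add: bf.ks_def)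
  have "bf.ksl m (Inl m) (map c (pts k l)) = 1"
    by (rule bf.Z_nonzero_ksl[OF brauer_matching[OF D]]) (use nz c_def bs.dval_def in simp)
  then have "even (length (filter (bodd m) (map c (pts k l))))"
    by (simp add: par uminus_power_if split: if_splits)
  moreover have "map c [0..<k] = map Inl u"
    by (rule nth_equalityI) (simp_all add: c_def bs.dcol_def u)
  moreover have "map c [k..<k + l] = map Inr v"
    by (rule nth_equalityI) (simp_all add: c_def bs.dcol_def v)
  ultimately have "even (length (filter (bodd m) (map Inl u)) + length (filter (bodd m) (map Inr v)))"
    by (simp add: pts_def rev_map[symmetric] rev_filter[symmetric])
  then show ?thesis
    by (simp add: wpar_def filter_map comp_def mod2_eq_if)
qed

section \<open>Juxtaposition of diagrams\<close>

lemma pts_tensor: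
  "pts (k + k') (l + l') = [0..<k] @ map (demb2 k k' l) (pts k' l') @ rev [k + k'..<k + k' + l]"
  "map (demb1 k k') (pts k l) = [0..<k] @ rev [k + k'..<k + k' + l]"
proof -
  have "map (demb2 k k' l) [0..<k'] = [k..<k + k']"
    "map (demb2 k k' l) [k'..<k' + l'] = [k + k' + l..<k + k' + l + l']"
    by (rule nth_equalityI; simp add: demb2_def)+
  moreover have "[0..<k + k'] = [0..<k] @ [k..<k + k']"
    by (rule upt_add_eq_append) simp
  moreover have "[k + k'..<k + k' + (l + l')] = [k + k'..<k + k' + l] @ [k + k' + l..<k + k' + l + l']"
    using upt_add_eq_append[of "k + k'" "k + k' + l" l'] by (simp add: add.assoc)
  ultimately show "pts (k + k') (l + l') = [0..<k] @ map (demb2 k k' l) (pts k' l') @ rev [k + k'..<k + k' + l]"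
    by (simp add: pts_def rev_map[symmetric])
  have "map (demb1 k k') [0..<k] = [0..<k]" "map (demb1 k k') [k..<k + l] = [k + k'..<k + k' + l]"
    by (rule nth_equalityI; simp add: demb1_def)+
  then show "map (demb1 k k') (pts k l) = [0..<k] @ rev [k + k'..<k + k' + l]"
    by (simp add: pts_def rev_map[symmetric])
qed

lemma dtens_demb1: "brauer k l p \<Longrightarrow> i < k + l \<Longrightarrow> dtens k l k' l' p p' (demb1 k k' i) = demb1 k k' (p i)"
  by (auto simp: dtens_def demb1_def)

lemma dtens_demb2:
  "brauer k' l' p' \<Longrightarrow> i < k' + l' \<Longrightarrow> dtens k l k' l' p p' (demb2 k k' l i) = demb2 k k' l (p' i)"
  by (auto simp: dtens_def demb2_def)

lemma demb1_inj: "demb1 k k' i = demb1 k k' j \<longleftrightarrow> i = j"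
  by (auto simp: demb1_def split: if_splits)

lemma demb2_inj: "demb2 k k' l i = demb2 k k' l j \<longleftrightarrow> i = j"
  by (auto simp: demb2_def split: if_splits)

lemma demb_cases:
  assumes "j < k + k' + (l + l')"
  obtains i where "j = demb1 k k' i" "i < k + l" | i where "j = demb2 k k' l i" "i < k' + l'"
proof -
  consider "j < k" | "k \<le> j" "j < k + k'" | "k + k' \<le> j" "j < k + k' + l" | "k + k' + l \<le> j"
    by linarith
  then show ?thesis
  proof cases
    case 1 then show ?thesis using that(1)[of j] by (simp add: demb1_def)
  next
    case 2
    then have "j - k < k'" by linarith
    then show ?thesis using 2 that(2)[of "j - k"] by (simp add: demb2_def)
  next
    case 3 then show ?thesis using that(1)[of "j - k'"] by (simp add: demb1_def)
  next
    case 4 then show ?thesis using that(2)[of "j - k - l"] assms by (simp add: demb2_def)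
  qed
qed

lemma demb_lt:
  "i < k + l \<Longrightarrow> demb1 k k' i < k + k' + (l + l')" "i < k' + l' \<Longrightarrow> demb2 k k' l i < k + k' + (l + l')"
  by (auto simp: demb1_def demb2_def)

lemma brauer_dtens:
  assumes p: "brauer k l p" and p': "brauer k' l' p'"
  shows "brauer (k + k') (l + l') (dtens k l k' l' p p')"
  unfolding brauer_def
proof (intro conjI allI impI)
  fix j assume j: "j < k + k' + (l + l')"
  let ?t = "dtens k l k' l' p p'"
  have "?t j < k + k' + (l + l') \<and> ?t j \<noteq> j \<and> ?t (?t j) = j"
    using j
  proof (cases rule: demb_cases)
    case (1 i)
    then show ?thesis
      using p brauer_lt[OF p, of i] brauer_ne[OF p, of i] demb_lt(1)[of "p i" k l k' l']
      by (simp add: dtens_demb1 demb1_inj)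
  next
    case (2 i)
    then show ?thesis
      using p' brauer_lt[OF p', of i] brauer_ne[OF p', of i] demb_lt(2)[of "p' i" k' l' k l]
      by (simp add: dtens_demb2 demb2_inj)
  qed
  then show "?t j < k + k' + (l + l')" "?t j \<noteq> j" "?t (?t j) = j" by auto
qed (simp add: dtens_def)

text \<open>The points of the second diagram form a contiguous block that is matched within itself,
  so \<open>Z_block\<close> splits off its state sum without a sign.\<close>

lemma dval_dtens:
  assumes p: "brauer k l p" and p': "brauer k' l' p'"
    and len: "length u = k" "length u' = k'" "length v = l" "length v' = l'"
  shows "dval m (dtens k l k' l' p p') (k + k') (l + l') (u @ u') (v @ v')
    = dval m p k l u v * dval m p' k' l' u' v'"
proof -
  let ?t = "dtens k l k' l' p p'" and ?c = "bs.dcol (k + k') (u @ u') (v @ v')"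
  let ?vs = "map (demb2 k k' l) (pts k' l')"
  have mt: "matching ?t ([0..<k] @ ?vs @ rev [k + k'..<k + k' + l])"
    using brauer_matching[OF brauer_dtens[OF p p']] by (simp add: pts_tensor(1))
  have mg: "matching ?t ?vs"
    using brauer_matching[OF p'] p'
    by (auto simp: matching_def distinct_map inj_on_def demb2_inj dtens_demb2)
  have "bf.Z m ?t ?c (pts (k + k') (l + l')) = bf.Z m ?t ?c (map (demb1 k k') (pts k l)) * bf.Z m ?t ?c ?vs"
    unfolding pts_tensor using bf.Z_block[OF mg mt] .
  also have "bf.Z m ?t ?c (map (demb1 k k') (pts k l)) = bf.Z m p (\<lambda>z. ?c (demb1 k k' z)) (pts k l)"
    by (rule bf.Z_map[OF brauer_matching[OF p]]) (auto simp: inj_on_def demb1_inj dtens_demb1[OF p])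
  also have "\<dots> = bf.Z m p (bs.dcol k u v) (pts k l)"
    by (rule bf.Z_cong[OF brauer_matching[OF p] refl])
      (auto simp: bs.dcol_def demb1_def nth_append len)
  also have "bf.Z m ?t ?c ?vs = bf.Z m p' (\<lambda>z. ?c (demb2 k k' l z)) (pts k' l')"
    by (rule bf.Z_map[OF brauer_matching[OF p']]) (auto simp: inj_on_def demb2_inj dtens_demb2[OF p'])
  also have "\<dots> = bf.Z m p' (bs.dcol k' u' v') (pts k' l')"
    by (rule bf.Z_cong[OF brauer_matching[OF p'] refl])
      (auto simp: bs.dcol_def demb2_def nth_append len)
  finally show ?thesis by (simp add: bs.dval_def)
qed

lemma brauer_did: "brauer k k (did k)"
  by (auto simp: brauer_def did_def)

lemma brauer_dI: "brauer 1 1 dI"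
  unfolding dI_def by (rule brauer_did)

lemma brauer_dX: "brauer 2 2 dX"
  by (auto simp: brauer_def dX_def)

lemma brauer_dA: "brauer 2 0 dA"
  by (auto simp: brauer_def dA_def)

lemma brauer_dU: "brauer 0 2 dU"
  by (auto simp: brauer_def dU_def)

lemma did_Suc: "did (Suc k) = dtens k k 1 1 (did k) dI"
  by (rule ext) (auto simp: dtens_def did_def dI_def demb1_def demb2_def)

lemma dval_dI: "dval m dI 1 1 [a] [b] = (if a = b then 1 else 0)"
  using bf.Z_expand'[of 1 dI 0 "[]" m "bs.dcol 1 [a] [b]" "[]"]
  by (simp add: bs.dval_def pts_def upt_rec bs.dcol_def dI_def did_def)

lemma dval_dX: "dval m dX 2 2 [a, b] [c, d]
    = (if a = d \<and> b = c then if m \<le> a \<and> m \<le> b then - 1 else 1 else 0)"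
  using bf.Z_expand'[of 3 dX 0 "[1]" m "bs.dcol 2 [a, b] [c, d]" "[2]"]
    bf.Z_expand'[of 2 dX 1 "[]" m "bs.dcol 2 [a, b] [c, d]" "[]"]
  by (simp add: bs.dval_def pts_def upt_rec bs.dcol_def dX_def bf.ks_def)

lemma dval_dA: "dval m dA 2 0 [a, b] [] = eta m a b"
  using bf.Z_expand'[of 1 dA 0 "[]" m "bs.dcol 2 [a, b] []" "[]"]
  by (simp add: bs.dval_def pts_def upt_rec bs.dcol_def dA_def)

text \<open>The top row is read backwards, so the point 1 comes first; the transposed indices in the
  value of \<open>bform\<close> on two dual colours restore the order \<open>a\<close>,
  \<open>b\<close>.\<close>

lemma dval_dU: "dval m dU 0 2 [] [a, b] = eta_inv m a b"
  using bf.Z_expand'[of 0 dU 1 "[]" m "bs.dcol 0 [] [a, b]" "[]"]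
  by (simp add: bs.dval_def pts_def upt_rec bs.dcol_def dU_def)

lemma dval_did: "length u = k \<Longrightarrow> length v = k \<Longrightarrow> dval m (did k) k k u v = (if u = v then 1 else 0)"
proof (induction k arbitrary: u v)
  case 0
  then show ?case by (simp add: bs.dval_def pts_def)
next
  case (Suc k)
  obtain u' a where u: "u = u' @ [a]" "length u' = k"
    using Suc.prems(1) by (cases u rule: rev_cases) auto
  obtain v' b where v: "v = v' @ [b]" "length v' = k"
    using Suc.prems(2) by (cases v rule: rev_cases) auto
  have "dval m (did (Suc k)) (k + 1) (k + 1) u v = dval m (did k) k k u' v' * dval m dI 1 1 [a] [b]"
    unfolding did_Suc u v by (rule dval_dtens[OF brauer_did brauer_dI]) (simp_all add: u v)
  then show ?case using Suc.IH[of u' v'] u v by (simp add: dval_dI[simplified])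
qed

section \<open>Matrices of linear maps and the functor\<close>

lemma sum_fun_apply: "(sum g A) w = (\<Sum>i\<in>A. g i w)"
  using sum_comp_morphism[of "\<lambda>f. f w" g A] by (simp add: comp_def)

lemma finite_words [simp]: "finite (words m n r)"
  by (simp add: words_strings)

lemma words_append: "length u = k \<Longrightarrow> u @ u' \<in> words m n (k + k') \<longleftrightarrow> u \<in> words m n k \<and> u' \<in> words m n k'"
  by (auto simp: words_def)

lemma words_take_drop:
  "w \<in> words m n (k + k') \<longleftrightarrow> length w = k + k' \<and> take k w \<in> words m n k \<and> drop k w \<in> words m n k'"
proof (cases "length w = k + k'")
  case True
  then show ?thesis using words_append[of "take k w" k "drop k w" m n k'] by simp
qed (auto simp: words_def)

lemma sum_words_append:
  "(\<Sum>w\<in>words m n (k + k'). f (take k w) (drop k w)) = (\<Sum>u\<in>words m n k. \<Sum>u'\<in>words m n k'. f u u')"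
proof -
  have "(\<Sum>w\<in>words m n (k + k'). f (take k w) (drop k w)) = (\<Sum>(u, u')\<in>words m n k \<times> words m n k'. f u u')"
    by (rule sum.reindex_bij_witness[where i = "\<lambda>(u, u'). u @ u'" and j = "\<lambda>w. (take k w, drop k w)"])
      (auto simp: words_take_drop words_def dest: in_set_takeD in_set_dropD)
  then show ?thesis by (simp add: sum.cartesian_product)
qed

lemma wpar_append: "wpar m (u @ v) = (wpar m u + wpar m v) mod 2"
  by (simp add: wpar_def mod_add_eq)

lemma wpar_take_drop: "even (wpar m (take k w) + wpar m (drop k w)) = even (wpar m w)"
  using wpar_append[of m "take k w" "drop k w"] by simp

lemma tens_0 [simp]: "0 \<in> tens m n r"
  by (simp add: tens_def)

lemma tens_add: "x \<in> tens m n r \<Longrightarrow> y \<in> tens m n r \<Longrightarrow> x + y \<in> tens m n r"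
  by (simp add: tens_def)

lemma tens_sum: "(\<And>i. i \<in> A \<Longrightarrow> g i \<in> tens m n r) \<Longrightarrow> sum g A \<in> tens m n r"
  by (induction A rule: infinite_finite_induct) (simp_all add: tens_add)

lemma tens_gelem: "x \<in> tens m n r \<Longrightarrow> gelem (x w)"
  by (simp add: tens_def)

lemma tens_outside: "x \<in> tens m n r \<Longrightarrow> w \<notin> words m n r \<Longrightarrow> x w = 0"
  by (simp add: tens_def)

lemma vbasis_tens: "w \<in> words m n r \<Longrightarrow> vbasis w \<in> tens m n r"
  by (simp add: tens_def vbasis_def)

lemma rsmul_tens: "x \<in> tens m n r \<Longrightarrow> gelem c \<Longrightarrow> rsmul x c \<in> tens m n r"
  by (simp add: tens_def rsmul_def)

lemma is_lin_tens: "is_lin m n k l f \<Longrightarrow> x \<in> tens m n k \<Longrightarrow> f x \<in> tens m n l"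
  by (simp add: is_lin_def)

lemma is_lin_0: "is_lin m n k l f \<Longrightarrow> f 0 = 0"
proof -
  assume "is_lin m n k l f"
  then have "f (0 + 0) = f 0 + f 0" unfolding is_lin_def using tens_0 by blast
  then show "f 0 = 0" by simp
qed

lemma is_lin_sum:
  assumes f: "is_lin m n k l f" and "finite A" "\<And>i. i \<in> A \<Longrightarrow> g i \<in> tens m n k"
  shows "f (sum g A) = (\<Sum>i\<in>A. f (g i))"
  using assms(2,3)
proof (induction rule: finite_induct)
  case empty
  show ?case by (simp only: sum.empty is_lin_0[OF f])
next
  case (insert i A)
  have "f (g i + sum g A) = f (g i) + f (sum g A)"
    using f insert.prems tens_sum[of A g m n k] unfolding is_lin_def by simp
  then show ?case
    by (simp only: sum.insert[OF insert.hyps] insert.IH[OF insert.prems[OF insertI2]])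
qed

lemma tens_decomp:
  assumes "x \<in> tens m n k"
  shows "x = (\<Sum>u\<in>words m n k. rsmul (vbasis u) (x u))"
proof
  fix w
  have "(\<Sum>u\<in>words m n k. rsmul (vbasis u) (x u)) w = (\<Sum>u\<in>words m n k. rsmul (vbasis u) (x u) w)"
    by (rule sum_fun_apply)
  also have "\<dots> = (\<Sum>u\<in>words m n k. if w = u then x u else 0)"
    using tens_gelem[OF assms] by (intro sum.cong) (auto simp: rsmul_def vbasis_def)
  finally have "(\<Sum>u\<in>words m n k. rsmul (vbasis u) (x u)) w = (\<Sum>u\<in>words m n k. if w = u then x u else 0)" .
  then show "x w = (\<Sum>u\<in>words m n k. rsmul (vbasis u) (x u)) w"
    using tens_outside[OF assms, of w] by (auto simp: sum.delta')
qed

text \<open>With coefficients on the right, right-linear maps act by left multiplication with matrix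
  entries, and composition is the plain matrix product without signs.\<close>

definition app :: "nat \<Rightarrow> nat \<Rightarrow> nat \<Rightarrow> nat \<Rightarrow> (nat list \<Rightarrow> nat list \<Rightarrow> gr) \<Rightarrow> vmap" where
  "app m n k l M x = (\<lambda>v. if v \<in> words m n l then \<Sum>u\<in>words m n k. gmult (M v u) (x u) else 0)"

lemma app_tens:
  assumes "\<And>u v. u \<in> words m n k \<Longrightarrow> v \<in> words m n l \<Longrightarrow> gelem (M v u)" "x \<in> tens m n k"
  shows "app m n k l M x \<in> tens m n l"
  using assms by (auto simp: tens_def app_def intro!: gelem_sum)

lemma app_cong:
  assumes "\<And>u v. u \<in> words m n k \<Longrightarrow> v \<in> words m n l \<Longrightarrow> M v u = M' v u"
  shows "app m n k l M = app m n k l M'"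
  using assms by (intro ext) (simp add: app_def cong: sum.cong)

lemma app_add_matrix: "app m n k l (\<lambda>v u. M v u + M' v u) x = app m n k l M x + app m n k l M' x"
  by (rule ext) (simp add: app_def gmult_add_left sum.distrib)

lemma is_lin_app:
  assumes "\<And>u v. u \<in> words m n k \<Longrightarrow> v \<in> words m n l \<Longrightarrow> gelem (M v u)"
  shows "is_lin m n k l (app m n k l M)"
  unfolding is_lin_def
proof (intro conjI ballI allI impI)
  show "x \<in> tens m n k \<Longrightarrow> app m n k l M x \<in> tens m n l" for x
    using assms by (rule app_tens)
  show "app m n k l M (x + y) = app m n k l M x + app m n k l M y" for x y
    by (rule ext) (simp add: app_def gmult_add_right sum.distrib)
  show "app m n k l M (rsmul x c) = rsmul (app m n k l M x) c" for x c
    by (rule ext) (simp add: app_def rsmul_def gmult_sum_left gmult_assoc)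
qed

lemma is_lin_eq_app:
  assumes f: "is_lin m n k l f" and x: "x \<in> tens m n k"
  shows "f x = app m n k l (\<lambda>v u. f (vbasis u) v) x"
proof
  fix v
  have "f x = (\<Sum>u\<in>words m n k. f (rsmul (vbasis u) (x u)))"
    by (subst tens_decomp[OF x], rule is_lin_sum[OF f])
      (use x in \<open>auto intro: rsmul_tens vbasis_tens tens_gelem\<close>)
  also have "\<dots> = (\<Sum>u\<in>words m n k. rsmul (f (vbasis u)) (x u))"
    using f tens_gelem[OF x] vbasis_tens unfolding is_lin_def by (intro sum.cong) blast+
  finally have "f x v = (\<Sum>u\<in>words m n k. gmult (f (vbasis u) v) (x u))"
    by (simp add: sum_fun_apply rsmul_def)
  then show "f x v = app m n k l (\<lambda>v u. f (vbasis u) v) x v"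
    using tens_outside[OF is_lin_tens[OF f x]] by (auto simp: app_def)
qed

lemma app_vbasis:
  assumes "\<And>u v. u \<in> words m n k \<Longrightarrow> v \<in> words m n l \<Longrightarrow> gelem (M v u)"
    "u \<in> words m n k" "v \<in> words m n l"
  shows "app m n k l M (vbasis u) v = M v u"
proof -
  have "(\<Sum>w\<in>words m n k. gmult (M v w) (vbasis u w)) = (\<Sum>w\<in>words m n k. if w = u then M v w else 0)"
    using assms by (intro sum.cong) (auto simp: vbasis_def)
  then show ?thesis using assms by (simp add: app_def sum.delta)
qed

lemma app_app:
  "app m n l q M2 (app m n k l M1 x) = app m n k q (\<lambda>v u. \<Sum>w\<in>words m n l. gmult (M2 v w) (M1 w u)) x"
proof
  fix v
  have "(\<Sum>w\<in>words m n l. gmult (M2 v w) (\<Sum>u\<in>words m n k. gmult (M1 w u) (x u)))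
      = (\<Sum>u\<in>words m n k. gmult (\<Sum>w\<in>words m n l. gmult (M2 v w) (M1 w u)) (x u))"
    unfolding gmult_sum_right gmult_sum_left by (subst sum.swap) (simp add: gmult_assoc)
  then show "app m n l q M2 (app m n k l M1 x) v
      = app m n k q (\<lambda>v u. \<Sum>w\<in>words m n l. gmult (M2 v w) (M1 w u)) x v"
    by (simp add: app_def cong: sum.cong)
qed

lemma lin_ext_eq_app:
  assumes "\<And>w v. w \<in> words m n k \<Longrightarrow> v \<notin> words m n l \<Longrightarrow> C w v = 0"
  shows "lin_ext m n k C x = app m n k l (\<lambda>v u. C u v) x"
  by (rule ext) (use assms in \<open>simp add: lin_ext_def app_def sum_fun_apply rsmul_def\<close>)

text \<open>This is how an entry of the second map of a tensor product changes when it passes a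
  vector of parity \<open>q\<close>, where \<open>r\<close> is the sum of the parities of its row
  and column. Entries of an even map have degree \<open>r\<close> and stay unchanged.\<close>

definition twist :: "nat \<Rightarrow> nat \<Rightarrow> gr \<Rightarrow> gr" where
  "twist r q a = (if odd r \<and> odd q then - gtw q a else gtw q a)"

lemma twist_0 [simp]: "twist r q 0 = 0"
  by (simp add: twist_def)

lemma twist_ghom: "ghom r a \<Longrightarrow> twist r q a = a"
  by (simp add: twist_def gtw_ghom)

lemma gpart_cong_parity: "even p = even q \<Longrightarrow> gpart p = gpart q"
  by (rule ext) (simp add: gpart_def mod2_eq_if)

lemma vev_vbasis: "vev m (vbasis u) = (if even (wpar m u) then vbasis u else 0)"
  and vodd_vbasis: "vodd m (vbasis u) = (if even (wpar m u) then 0 else vbasis u)"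
  by (rule ext, simp add: vev_def vodd_def vbasis_def gpart_def gone_def gscal_def fun_eq_iff mod2_eq_if)+

lemma mev_vbasis:
  assumes "g 0 = 0"
  shows "mev m g (vbasis u) v = gpart (wpar m v + wpar m u) (g (vbasis u) v)"
    and "modd m g (vbasis u) v = gpart (Suc (wpar m v + wpar m u)) (g (vbasis u) v)"
proof -
  have "vev m 0 = 0" "vodd m 0 = 0" by (simp_all add: vev_def vodd_def fun_eq_iff gpart_def)
  then have "mev m g (vbasis u) = (if even (wpar m u) then vev m (g (vbasis u)) else vodd m (g (vbasis u)))"
    "modd m g (vbasis u) = (if even (wpar m u) then vodd m (g (vbasis u)) else vev m (g (vbasis u)))"
    by (simp_all add: mev_def modd_def vev_vbasis vodd_vbasis assms)
  then show "mev m g (vbasis u) v = gpart (wpar m v + wpar m u) (g (vbasis u) v)"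
    "modd m g (vbasis u) v = gpart (Suc (wpar m v + wpar m u)) (g (vbasis u) v)"
    by (auto simp: vev_def vodd_def intro!: fun_cong[OF gpart_cong_parity])
qed

text \<open>\<open>vtens\<close> twists the entry of \<open>f\<close> by the parity of the second
  output word, and the even and odd parts of \<open>g\<close> recombine by
  \<open>gpart_twist\<close>.\<close>

lemma mtens_eq_app:
  assumes f: "is_lin m n k l f" and g: "is_lin m n k' l' g"
  shows "mtens m n k l k' f g x = app m n (k + k') (l + l') (\<lambda>z w.
    gmult (gtw (wpar m (drop l z)) (f (vbasis (take k w)) (take l z)))
      (twist (wpar m (drop l z) + wpar m (drop k w)) (wpar m (take k w)) (g (vbasis (drop k w)) (drop l z)))) x"
  (is "_ = app _ _ _ _ ?M x")
proof -
  define C where "C w = vtens m l (f (vbasis (take k w))) (mev m g (vbasis (drop k w))) +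
          (if wpar m (take k w) = 0
           then vtens m l (f (vbasis (take k w))) (modd m g (vbasis (drop k w)))
           else - vtens m l (f (vbasis (take k w))) (modd m g (vbasis (drop k w))))" for w
  have CM: "C w z = ?M z w" for w z
  proof -
    let ?a = "gtw (wpar m (drop l z)) (f (vbasis (take k w)) (take l z))"
    let ?b = "g (vbasis (drop k w)) (drop l z)" and ?r = "wpar m (drop l z) + wpar m (drop k w)"
    have ev: "wpar m (take k w) = 0 \<longleftrightarrow> even (wpar m (take k w))"
      by (auto simp: wpar_def mod2_eq_if)
    have "C w z = gmult ?a (gpart ?r ?b + (if even (wpar m (take k w)) then gpart (Suc ?r) ?b else - gpart (Suc ?r) ?b))"
      unfolding C_def ev
      by (simp add: vtens_def gflipw_gtw mev_vbasis[where g = g, OF is_lin_0[OF g]] gmult_add_right gmult_minus_right)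
    then show ?thesis by (simp only: gpart_twist twist_def)
  qed
  have "lin_ext m n (k + k') C x = app m n (k + k') (l + l') (\<lambda>v u. C u v) x"
  proof (rule lin_ext_eq_app)
    fix w z assume w: "w \<in> words m n (k + k')" and z: "z \<notin> words m n (l + l')"
    have t: "f (vbasis (take k w)) \<in> tens m n l" "g (vbasis (drop k w)) \<in> tens m n l'"
      using w f g by (auto simp: words_take_drop intro: is_lin_tens vbasis_tens)
    have "take l z \<notin> words m n l \<or> drop l z \<notin> words m n l'"
      using z by (auto simp: words_take_drop) (auto simp: words_def)
    then show "C w z = 0"
      unfolding CM using tens_outside[OF t(1)] tens_outside[OF t(2)] by auto
  qed
  then show ?thesis unfolding mtens_def C_def[symmetric] CM .
qed

section \<open>The functor on linear combinations of diagrams\<close>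

lemma finite_diagrams [simp]: "finite (diagrams k l)"
proof -
  let ?r = "\<lambda>p i. if i < k + l then p i else (0::nat)"
  have "finite {f. \<forall>x. (x \<in> {..<k + l} \<longrightarrow> f x \<in> {..<k + l}) \<and> (x \<notin> {..<k + l} \<longrightarrow> f x = (0::nat))}"
    by (rule finite_set_of_finite_funs) auto
  moreover have "?r ` diagrams k l \<subseteq> \<dots>"
    by (auto simp: diagrams_def brauer_def)
  moreover have "inj_on ?r (diagrams k l)"
  proof (rule inj_onI, rule ext)
    fix p p' i assume "p \<in> diagrams k l" "p' \<in> diagrams k l" "?r p = ?r p'"
    then show "p i = p' i"
      using fun_cong[of "?r p" "?r p'" i] by (cases "i < k + l") (auto simp: diagrams_def brauer_def)
  qed
  ultimately show ?thesis by (meson finite_imageD finite_subset)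
qed

text \<open>A Grassmann coefficient of a diagram acts from the left; moving it to the right of the
  output basis tensor of \<open>v\<close> costs the twist by the parity of \<open>v\<close>.\<close>

definition Fmat :: "nat \<Rightarrow> nat \<Rightarrow> nat \<Rightarrow> bm \<Rightarrow> nat list \<Rightarrow> nat list \<Rightarrow> gr" where
  "Fmat m k l c v u = (\<Sum>D\<in>diagrams k l. gmult (gtw (wpar m v) (c D)) (gscal (dval m D k l u v)))"

definition brauer_rep :: "nat \<Rightarrow> nat \<Rightarrow> nat \<Rightarrow> nat \<Rightarrow> bm \<Rightarrow> vmap" where
  "brauer_rep m n k l c = app m n k l (Fmat m k l c)"

lemma bmor_gelem: "c \<in> bmor k l \<Longrightarrow> gelem (c D)"
  by (simp add: bmor_def)

lemma gelem_Fmat: "c \<in> bmor k l \<Longrightarrow> gelem (Fmat m k l c v u)"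
  unfolding Fmat_def by (intro gelem_sum) (simp add: bmor_gelem)

lemma is_lin_brauer_rep: "c \<in> bmor k l \<Longrightarrow> is_lin m n k l (brauer_rep m n k l c)"
  unfolding brauer_rep_def by (rule is_lin_app) (rule gelem_Fmat)

lemma brauer_rep_add: "brauer_rep m n k l (c + c') x = brauer_rep m n k l c x + brauer_rep m n k l c' x"
  unfolding brauer_rep_def app_add_matrix[symmetric]
  by (rule fun_cong[OF app_cong]) (simp add: Fmat_def gtw_add gmult_add_left sum.distrib)

lemma brauer_rep_bsmul: "brauer_rep m n k l (bsmul a c) x = lsmul m a (brauer_rep m n k l c x)"
proof -
  have "Fmat m k l (bsmul a c) v u = gmult (gtw (wpar m v) a) (Fmat m k l c v u)" for v u
    by (simp add: Fmat_def bsmul_def gtw_gmult gmult_assoc gmult_sum_right)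
  then show ?thesis
    by (intro ext) (simp add: brauer_rep_def app_def lsmul_def gflipw_gtw gmult_sum_right gmult_assoc)
qed

lemma Fmat_bdiag: "brauer k l D \<Longrightarrow> Fmat m k l (bdiag D) v u = gscal (dval m D k l u v)"
proof -
  assume D: "brauer k l D"
  have "Fmat m k l (bdiag D) v u = (\<Sum>E\<in>diagrams k l. if E = D then gscal (dval m D k l u v) else 0)"
    unfolding Fmat_def by (rule sum.cong) (auto simp: bdiag_def)
  moreover have "D \<in> diagrams k l" using D by (simp add: diagrams_def)
  ultimately show ?thesis by (simp add: sum.delta)
qed

lemma gmult_scalar_pair:
  "gelem b \<Longrightarrow> gmult (gmult a (gscal s)) (gmult b (gscal t)) = gmult (gmult a b) (gscal (s * t))"
proof -
  assume b: "gelem b"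
  have "gmult (gscal s) (gmult b (gscal t)) = gmult b (gscal (s * t))"
    by (simp only: gmult_assoc[symmetric] gscal_commute[OF b, of s, symmetric] gscal_mult)
  then show ?thesis by (simp add: gmult_assoc)
qed

lemma Fmat_collect:
  assumes "\<And>i j. i \<in> A \<Longrightarrow> j \<in> A' \<Longrightarrow> e i j \<in> diagrams k l"
  shows "Fmat m k l (\<lambda>E. \<Sum>i\<in>A. \<Sum>j\<in>A'. if e i j = E then h i j else 0) v u
    = (\<Sum>i\<in>A. \<Sum>j\<in>A'. gmult (gtw (wpar m v) (h i j)) (gscal (dval m (e i j) k l u v)))"
proof -
  let ?t = "\<lambda>E i j. if E = e i j then gmult (gtw (wpar m v) (h i j)) (gscal (dval m E k l u v)) else 0"
  have "Fmat m k l (\<lambda>E. \<Sum>i\<in>A. \<Sum>j\<in>A'. if e i j = E then h i j else 0) v u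
      = (\<Sum>E\<in>diagrams k l. \<Sum>i\<in>A. \<Sum>j\<in>A'. ?t E i j)"
    unfolding Fmat_def gtw_sum gmult_sum_left by (intro sum.cong refl) auto
  also have "\<dots> = (\<Sum>i\<in>A. \<Sum>j\<in>A'. \<Sum>E\<in>diagrams k l. ?t E i j)"
    by (subst sum.swap, intro sum.cong refl, subst sum.swap, rule refl)
  also have "\<dots> = (\<Sum>i\<in>A. \<Sum>j\<in>A'. gmult (gtw (wpar m v) (h i j)) (gscal (dval m (e i j) k l u v)))"
    by (intro sum.cong refl) (simp add: sum.delta assms)
  finally show ?thesis .
qed

lemma Fmat_bcomp:
  assumes c1: "c1 \<in> bmor k l" and c2: "c2 \<in> bmor l q" and u: "u \<in> words m n k" and v: "v \<in> words m n q"
  shows "Fmat m k q (bcomp (gscal (of_int (int m - 2 * int n))) k l q c2 c1) v u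
    = (\<Sum>w\<in>words m n l. gmult (Fmat m l q c2 v w) (Fmat m k l c1 w u))"
proof -
  let ?\<delta> = "of_int (int m - 2 * int n) :: complex"
  have "Fmat m k q (bcomp (gscal ?\<delta>) k l q c2 c1) v u
     = (\<Sum>D1\<in>diagrams k l. \<Sum>D2\<in>diagrams l q.
        gmult (gtw (wpar m v) (gmult (gmult (c2 D2) (c1 D1)) (gpowr (gscal ?\<delta>) (dloops k l q D2 D1))))
          (gscal (dval m (dcomp k l q D2 D1) k q u v)))"
    unfolding bcomp_def by (rule Fmat_collect) (simp add: diagrams_def brauer_dcomp)
  also have "\<dots> = (\<Sum>D1\<in>diagrams k l. \<Sum>D2\<in>diagrams l q. \<Sum>w\<in>words m n l.
      gmult (gmult (gtw (wpar m v) (c2 D2)) (gscal (dval m D2 l q w v)))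
        (gmult (gtw (wpar m w) (c1 D1)) (gscal (dval m D1 k l u w))))"
  proof (intro sum.cong refl, goal_cases)
    case D: (1 D1 D2)
    let ?a = "gtw (wpar m v) (gmult (c2 D2) (c1 D1))"
    have "gmult (gtw (wpar m v) (gmult (gmult (c2 D2) (c1 D1)) (gpowr (gscal ?\<delta>) (dloops k l q D2 D1))))
          (gscal (dval m (dcomp k l q D2 D1) k q u v))
      = gmult ?a (gscal (?\<delta> ^ dloops k l q D2 D1 * dval m (dcomp k l q D2 D1) k q u v))"
      by (simp only: gpowr_gscal gtw_gmult gtw_gscal gmult_assoc gscal_mult)
    also have "\<dots> = (\<Sum>w\<in>words m n l. gmult ?a (gscal (dval m D1 k l u w * dval m D2 l q w v)))"
      using dval_dcomp[of k l D1 q D2 u m n v] D u v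
      by (simp add: diagrams_def flip: gscal_sum gmult_sum_right)
    also have "\<dots> = (\<Sum>w\<in>words m n l. gmult (gmult (gtw (wpar m v) (c2 D2)) (gscal (dval m D2 l q w v)))
        (gmult (gtw (wpar m w) (c1 D1)) (gscal (dval m D1 k l u w))))"
    proof (intro sum.cong refl, goal_cases)
      case w: (1 w)
      show ?case
      \<comment> \<open>The coefficient of \<open>D1\<close> is twisted by the middle word in the
        matrix product and by the output word in the composite. The two words have equal parity
        wherever the state sum of \<open>D2\<close> is nonzero.\<close>
      proof (cases "dval m D2 l q w v = 0")
        case False
        then have "wpar m w = wpar m v"
          using dval_parity[of l q D2 w v m] D v w by (simp add: diagrams_def words_def)
        then show ?thesis
          by (simp add: gmult_scalar_pair bmor_gelem[OF c1] gtw_gmult mult.commute)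
      qed simp
    qed
    finally show ?case .
  qed
  also have "\<dots> = (\<Sum>D1\<in>diagrams k l. \<Sum>w\<in>words m n l. \<Sum>D2\<in>diagrams l q.
      gmult (gmult (gtw (wpar m v) (c2 D2)) (gscal (dval m D2 l q w v)))
        (gmult (gtw (wpar m w) (c1 D1)) (gscal (dval m D1 k l u w))))"
    by (rule sum.cong[OF refl], rule sum.swap)
  also have "\<dots> = (\<Sum>w\<in>words m n l. \<Sum>D1\<in>diagrams k l. \<Sum>D2\<in>diagrams l q.
      gmult (gmult (gtw (wpar m v) (c2 D2)) (gscal (dval m D2 l q w v)))
        (gmult (gtw (wpar m w) (c1 D1)) (gscal (dval m D1 k l u w))))"
    by (rule sum.swap)
  also have "\<dots> = (\<Sum>w\<in>words m n l. gmult (Fmat m l q c2 v w) (Fmat m k l c1 w u))"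
    unfolding Fmat_def gmult_sum_left gmult_sum_right by (rule refl)
  finally show ?thesis .
qed

lemma brauer_rep_bcomp:
  assumes "c1 \<in> bmor k l" "c2 \<in> bmor l q"
  shows "brauer_rep m n k q (bcomp (gscal (of_int (int m - 2 * int n))) k l q c2 c1) x
    = brauer_rep m n l q c2 (brauer_rep m n k l c1 x)"
  unfolding brauer_rep_def app_app
  by (rule fun_cong[OF app_cong]) (rule Fmat_bcomp[OF assms])

lemma Fmat_btens:
  assumes c: "c \<in> bmor k l" and c': "c' \<in> bmor k' l'"
    and w: "w \<in> words m n (k + k')" and z: "z \<in> words m n (l + l')"
  shows "Fmat m (k + k') (l + l') (btens k l k' l' c c') z w
    = gmult (gtw (wpar m (drop l z)) (Fmat m k l c (take l z) (take k w)))
      (twist (wpar m (drop l z) + wpar m (drop k w)) (wpar m (take k w)) (Fmat m k' l' c' (drop l z) (drop k w)))"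
proof -
  define v v' u u' where "v = take l z" "v' = drop l z" "u = take k w" "u' = drop k w"
  note vu = this
  have len: "length u = k" "length u' = k'" "length v = l" "length v' = l'" "z = v @ v'" "w = u @ u'"
    using w z by (auto simp: vu words_def)
  \<comment> \<open>Diagrams act as even maps: entries of odd total parity vanish, so the additional
    sign in \<open>twist\<close> never occurs.\<close>
  have tw: "twist (wpar m v' + wpar m u') (wpar m u) (Fmat m k' l' c' v' u') = gtw (wpar m u) (Fmat m k' l' c' v' u')"
  proof (cases "even (wpar m v' + wpar m u')")
    case False
    have "dval m D k' l' u' v' = 0" if "D \<in> diagrams k' l'" for D
    proof (rule ccontr)
      assume "dval m D k' l' u' v' \<noteq> 0"
      then have "wpar m u' = wpar m v'"
        using dval_parity[of k' l' D u' v' m] that len by (simp add: diagrams_def)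
      then show False using False by simp
    qed
    then have "Fmat m k' l' c' v' u' = 0" by (simp add: Fmat_def)
    then show ?thesis by simp
  qed (simp add: twist_def)
  have "Fmat m (k + k') (l + l') (btens k l k' l' c c') z w
     = (\<Sum>D\<in>diagrams k l. \<Sum>D'\<in>diagrams k' l'. gmult (gtw (wpar m z) (gmult (c D) (c' D')))
          (gscal (dval m (dtens k l k' l' D D') (k + k') (l + l') w z)))"
    unfolding btens_def by (rule Fmat_collect) (simp add: diagrams_def brauer_dtens)
  also have "\<dots> = (\<Sum>D\<in>diagrams k l. \<Sum>D'\<in>diagrams k' l'.
      gmult (gtw (wpar m v') (gmult (gtw (wpar m v) (c D)) (gscal (dval m D k l u v))))
        (gtw (wpar m u) (gmult (gtw (wpar m v') (c' D')) (gscal (dval m D' k' l' u' v')))))"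
  proof (intro sum.cong refl, goal_cases)
    case D: (1 D D')
    have dv: "dval m (dtens k l k' l' D D') (k + k') (l + l') w z = dval m D k l u v * dval m D' k' l' u' v'"
      unfolding len(5,6) using D len(1-4) by (intro dval_dtens) (simp_all add: diagrams_def)
    show ?case
    proof (cases "dval m D k l u v = 0")
      case False
      \<comment> \<open>The coefficient of \<open>D'\<close> is twisted by \<open>v\<close> and
        \<open>v'\<close> on one side and by \<open>u\<close> and \<open>v'\<close> on the other;
        parity conservation of the first diagram reconciles them.\<close>
      then have uv: "wpar m u = wpar m v" using dval_parity[of k l D u v m] D len by (simp add: diagrams_def)
      have z: "gtw (wpar m z) = gtw (wpar m v' + wpar m v)" "gtw (wpar m v + wpar m v') = gtw (wpar m v' + wpar m v)"
        by (rule gtw_cong_parity, simp add: len wpar_append add.commute)+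
      show ?thesis
        unfolding dv uv gtw_gmult gtw_gscal gtw_gtw z
        by (rule gmult_scalar_pair[symmetric]) (simp add: bmor_gelem[OF c'])
    qed (simp add: dv)
  qed
  also have "\<dots> = gmult (gtw (wpar m v') (Fmat m k l c v u)) (gtw (wpar m u) (Fmat m k' l' c' v' u'))"
    unfolding Fmat_def gtw_sum gmult_sum_left gmult_sum_right by (subst sum.swap) (rule refl)
  finally show ?thesis unfolding vu(1)[symmetric] vu(2)[symmetric] vu(3)[symmetric] vu(4)[symmetric] tw .
qed

lemma brauer_rep_btens:
  assumes "c \<in> bmor k l" "c' \<in> bmor k' l'"
  shows "brauer_rep m n (k + k') (l + l') (btens k l k' l' c c') x
    = mtens m n k l k' (brauer_rep m n k l c) (brauer_rep m n k' l' c') x"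
  unfolding mtens_eq_app[OF is_lin_brauer_rep[OF assms(1)] is_lin_brauer_rep[OF assms(2)]]
  unfolding brauer_rep_def
proof (rule fun_cong[OF app_cong], goal_cases)
  case (1 w z)
  note w = 1(1) and z = 1(2)
  have "app m n k l (Fmat m k l c) (vbasis (take k w)) (take l z) = Fmat m k l c (take l z) (take k w)"
    by (rule app_vbasis) (use w z assms gelem_Fmat in \<open>auto simp: words_take_drop\<close>)
  moreover have "app m n k' l' (Fmat m k' l' c') (vbasis (drop k w)) (drop l z) = Fmat m k' l' c' (drop l z) (drop k w)"
    by (rule app_vbasis) (use w z assms gelem_Fmat in \<open>auto simp: words_take_drop\<close>)
  ultimately show ?case
    using Fmat_btens[OF assms w z] by simp
qed

lemma brauer_rep_bdiag: "brauer k l D \<Longrightarrow> brauer_rep m n k l (bdiag D) = app m n k l (\<lambda>v u. gscal (dval m D k l u v))"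
  unfolding brauer_rep_def by (rule app_cong) (rule Fmat_bdiag)

lemma brauer_rep_did:
  assumes "x \<in> tens m n k"
  shows "brauer_rep m n k k (bdiag (did k)) x = x"
proof
  fix v
  have "(\<Sum>u\<in>words m n k. gmult (gscal (dval m (did k) k k u v)) (x u)) = (\<Sum>u\<in>words m n k. if u = v then x u else 0)"
    if "v \<in> words m n k"
    using that tens_gelem[OF assms]
    by (intro sum.cong) (auto simp: words_def dval_did simp flip: gone_def)
  then show "brauer_rep m n k k (bdiag (did k)) x v = x v"
    using tens_outside[OF assms] by (auto simp: brauer_rep_bdiag[OF brauer_did] app_def sum.delta)
qed

lemma words_2: "w \<in> words m n 2 \<longleftrightarrow> (\<exists>a b. w = [a, b] \<and> a < m + 2 * n \<and> b < m + 2 * n)"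
  by (auto simp: words_def numeral_2_eq_2 length_Suc_conv)

lemma words_0 [simp]: "words m n 0 = {[]}"
  by (auto simp: words_def)

lemma words_1: "w \<in> words m n 1 \<longleftrightarrow> (\<exists>a. w = [a] \<and> a < m + 2 * n)"
  by (auto simp: words_def length_Suc_conv)

lemma brauer_rep_dX: "brauer_rep m n 2 2 (bdiag dX) x = tau m n x"
proof -
  have "tau m n x = app m n 2 2 (\<lambda>v u. (if m \<le> u ! 0 \<and> m \<le> u ! 1 then - vbasis (rev u) else vbasis (rev u)) v) x"
    unfolding tau_def by (rule lin_ext_eq_app) (auto simp: vbasis_def words_def)
  also have "\<dots> = app m n 2 2 (\<lambda>v u. gscal (dval m dX 2 2 u v)) x"
    by (rule fun_cong[OF app_cong])
      (auto simp: words_2 dval_dX vbasis_def gscal_minus gone_def)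
  finally show ?thesis by (simp add: brauer_rep_bdiag[OF brauer_dX])
qed

lemma brauer_rep_dU: "brauer_rep m n 0 2 (bdiag dU) x = Ccheck m n x"
proof -
  have "Ccheck m n x = app m n 0 2 (\<lambda>v u. c0 m n v) x"
    unfolding Ccheck_def by (rule lin_ext_eq_app) (simp add: c0_def)
  also have "\<dots> = app m n 0 2 (\<lambda>v u. gscal (dval m dU 0 2 u v)) x"
    by (rule fun_cong[OF app_cong]) (auto simp: words_2 dval_dU c0_def)
  finally show ?thesis by (simp add: brauer_rep_bdiag[OF brauer_dU])
qed

lemma brauer_rep_dA: "brauer_rep m n 2 0 (bdiag dA) x = Chat m n x"
proof -
  have "Chat m n x = app m n 2 0 (\<lambda>v u. (\<lambda>w'. if w' = [] then gscal (eta m (u ! 0) (u ! 1)) else 0) v) x"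
    unfolding Chat_def by (rule lin_ext_eq_app) simp
  also have "\<dots> = app m n 2 0 (\<lambda>v u. gscal (dval m dA 2 0 u v)) x"
    by (rule fun_cong[OF app_cong]) (auto simp: words_2 dval_dA)
  finally show ?thesis by (simp add: brauer_rep_bdiag[OF brauer_dA])
qed

section \<open>Generation by elementary diagrams\<close>

text \<open>The function \<open>r\<close> sends every point of the glued picture to an endpoint of its strand.\<close>

lemma dcomp_eqI:
  assumes p1: "brauer k l p1" and p2: "brauer l q p2" and E: "brauer k q E"
    and r_outer: "\<And>i. i < k + q \<Longrightarrow> r (douter k l i) = i"
    and r_lt: "\<And>x. x < k + l + q \<Longrightarrow> r x < k + q"
    and r_rel: "\<And>x. x < k + l + q \<Longrightarrow> (x, douter k l (r x)) \<in> dglue k l q p2 p1"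
    and edge1: "\<And>i. i < k + l \<Longrightarrow> r (p1 i) = r i \<or> r (p1 i) = E (r i)"
    and edge2: "\<And>i. i < l + q \<Longrightarrow> r (k + p2 i) = r (k + i) \<or> r (k + p2 i) = E (r (k + i))"
    and ex: "\<And>i. i < k + q \<Longrightarrow> \<exists>j<l + q. r (k + j) = i \<and> r (k + p2 j) = E i"
  shows "dcomp k l q p2 p1 = E \<and> dloops k l q p2 p1 = 0"
proof -
  let ?G = "dglue k l q p2 p1"
  interpret g: gluing k l q p1 p2 using p1 p2 by unfold_locales
  have EE [simp]: "E (E i) = i" for i using E by simp
  \<comment> \<open>Along an edge \<open>r\<close> keeps its value or passes to the other endpoint
    given by \<open>E\<close>, so connected points never leave one strand of
    \<open>E\<close>.\<close>
  have rel: "r y = r x \<or> r y = E (r x)" if "(x, y) \<in> ?G" for x y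
    using that unfolding dglue_def
  proof (induction rule: rtrancl_induct)
    case (step y z)
    then have "r z = r y \<or> r z = E (r y)" using edge1 edge2 by auto
    then show ?case using step.IH by auto
  qed simp
  have S: "(y, x) \<in> ?G" if "(x, y) \<in> ?G" for x y
    using that g.equiv_G unfolding g.dglue_G equiv_UNIV_iff by blast
  have T: "(x, z) \<in> ?G" if "(x, y) \<in> ?G" "(y, z) \<in> ?G" for x y z
    using that unfolding dglue_def by (rule rtrancl_trans)
  have e2: "(k + j, k + p2 j) \<in> ?G" if "j < l + q" for j
    unfolding dglue_def using that by blast
  have ED: "(douter k l i, douter k l (E i)) \<in> ?G" if i: "i < k + q" for i
  proof -
    obtain j where j: "j < l + q" "r (k + j) = i" "r (k + p2 j) = E i" using ex[OF i] by blast
    have "(k + j, douter k l i) \<in> ?G" using r_rel[of "k + j"] j by simp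
    moreover have "(k + p2 j, douter k l (E i)) \<in> ?G"
      using r_rel[of "k + p2 j"] j brauer_lt[OF p2, of j] by simp
    ultimately show ?thesis using S T e2[OF j(1)] by blast
  qed
  have "dcomp k l q p2 p1 i = E i" for i
  proof (cases "i < k + q")
    case True
    have "(j < k + q \<and> j \<noteq> i \<and> (douter k l i, douter k l j) \<in> ?G) \<longleftrightarrow> j = E i" for j
    proof
      assume j: "j < k + q \<and> j \<noteq> i \<and> (douter k l i, douter k l j) \<in> ?G"
      then have "r (douter k l j) = r (douter k l i) \<or> r (douter k l j) = E (r (douter k l i))" using rel by blast
      then show "j = E i" using j r_outer True by auto
    qed (use True ED brauer_lt[OF E] brauer_ne[OF E] in auto)
    then show ?thesis using True by (simp add: dcomp_def)
  qed (use brauer_outside[OF E] in \<open>auto simp: dcomp_def\<close>)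
  \<comment> \<open>Every middle point is connected with the outer point that \<open>r\<close>
    assigns to it, so no class is confined to the middle row.\<close>
  moreover have "\<not> ?G `` {x} \<subseteq> {k..<k + l}" if "x < k + l" for x
  proof
    assume "?G `` {x} \<subseteq> {k..<k + l}"
    then have "douter k l (r x) \<in> {k..<k + l}" using r_rel[of x] that by auto
    then show False by (auto simp: douter_def split: if_splits)
  qed
  then have "{C. \<exists>x. k \<le> x \<and> x < k + l \<and> C = ?G `` {x} \<and> C \<subseteq> {k..<k + l}} = {}"
    by blast
  then have "dloops k l q p2 p1 = 0" unfolding dloops_def by (simp only: card.empty)
  ultimately show ?thesis by auto
qed

definition swp :: "nat \<Rightarrow> nat \<Rightarrow> nat" where
  "swp i x = (if x = i then Suc i else if x = Suc i then i else x)"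

lemma swp_swp [simp]: "swp i (swp i x) = x"
  by (simp add: swp_def)

lemma swp_lt: "Suc i < N \<Longrightarrow> swp i x < N \<longleftrightarrow> x < N"
  by (auto simp: swp_def)

text \<open>The permutation diagram on \<open>N\<close> strands in which the neighbouring strands
  \<open>i\<close> and \<open>i + 1\<close> cross.\<close>

definition dswap :: "nat \<Rightarrow> nat \<Rightarrow> nat \<Rightarrow> nat" where
  "dswap N i x = (if x < N then N + swp i x else if x < 2 * N then swp i (x - N) else x)"

lemma brauer_dswap:
  assumes "Suc i < N"
  shows "brauer N N (dswap N i)"
  unfolding brauer_def
proof (intro conjI allI impI)
  fix x assume x: "x < N + N"
  have "dswap N i x < N + N \<and> dswap N i x \<noteq> x \<and> dswap N i (dswap N i x) = x"
  proof (cases "x < N")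
    case False
    then have "x - N < N" using x by linarith
    then have "swp i (x - N) < N" using swp_lt[OF assms] by blast
    then show ?thesis using False x by (auto simp: dswap_def)
  qed (use swp_lt[OF assms, of x] in \<open>auto simp: dswap_def\<close>)
  then show "dswap N i x < N + N" "dswap N i x \<noteq> x" "dswap N i (dswap N i x) = x" by auto
qed (simp add: dswap_def)

lemma dtens_eqI:
  assumes "brauer (k + k') (l + l') E" "brauer k l p" "brauer k' l' p'"
    and 1: "\<And>i. i < k + l \<Longrightarrow> E (demb1 k k' i) = demb1 k k' (p i)"
    and 2: "\<And>i. i < k' + l' \<Longrightarrow> E (demb2 k k' l i) = demb2 k k' l (p' i)"
  shows "dtens k l k' l' p p' = E"
proof
  fix x
  show "dtens k l k' l' p p' x = E x"
  proof (cases "x < k + k' + (l + l')")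
    case True
    then show ?thesis
      by (cases rule: demb_cases) (use assms in \<open>simp_all add: dtens_demb1 dtens_demb2\<close>)
  qed (use brauer_outside[OF assms(1)] in \<open>simp add: dtens_def\<close>)
qed

lemma dswap_dtens:
  "dtens i i 2 2 (did i) dX = dswap (i + 2) i"
  "Suc i < N \<Longrightarrow> dtens N N j j (dswap N i) (did j) = dswap (N + j) i"
proof -
  show "dtens i i 2 2 (did i) dX = dswap (i + 2) i"
  proof (rule dtens_eqI[OF brauer_dswap brauer_did brauer_dX])
    fix x :: nat assume "x < 2 + 2"
    then have "x = 0 \<or> x = 1 \<or> x = 2 \<or> x = 3" by linarith
    then show "dswap (i + 2) i (demb2 i 2 i x) = demb2 i 2 i (dX x)"
      by (auto simp: dswap_def swp_def demb2_def dX_def)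
  qed (auto simp: dswap_def swp_def demb1_def did_def)
  assume i: "Suc i < N"
  then show "dtens N N j j (dswap N i) (did j) = dswap (N + j) i"
  proof (intro dtens_eqI brauer_dswap brauer_did)
    fix x assume x: "x < N + N"
    show "dswap (N + j) i (demb1 N j x) = demb1 N j (dswap N i x)"
    proof (cases "x < N")
      case False
      then have "x - N < N" using x by linarith
      then have "swp i (x - N) < N" using swp_lt[OF i] by blast
      then show ?thesis using False x by (simp add: dswap_def demb1_def)
    qed (use swp_lt[OF i, of x] in \<open>simp add: dswap_def demb1_def\<close>)
  qed (auto simp: dswap_def swp_def demb2_def did_def)
qed

text \<open>A crossing placed below a diagram without top points only relabels the bottom points,
  hence conjugates the involution. Each middle point ends at the bottom point to which the crossing
  leads.\<close>

lemma dcomp_dswap: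
  assumes D: "brauer N 0 D" and i: "Suc i < N"
  shows "brauer N 0 (\<lambda>x. swp i (D (swp i x)))"
    and "dcomp N N 0 D (dswap N i) = (\<lambda>x. swp i (D (swp i x))) \<and> dloops N N 0 D (dswap N i) = 0"
proof -
  let ?E = "\<lambda>x. swp i (D (swp i x))" and ?r = "\<lambda>x. if x < N then x else swp i (x - N)"
  let ?G = "dglue N N 0 D (dswap N i)"
  note lt = swp_lt[OF i]
  have ne: "swp i a = x \<longleftrightarrow> a = swp i x" for a x by (metis swp_swp)
  show E: "brauer N 0 ?E"
    using D unfolding brauer_def by (auto simp: lt ne not_less[symmetric])
  show "dcomp N N 0 D (dswap N i) = ?E \<and> dloops N N 0 D (dswap N i) = 0"
  proof (rule dcomp_eqI[OF brauer_dswap[OF i] D E, where r = ?r])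
    show "x < N + N + 0 \<Longrightarrow> (x, douter N N (?r x)) \<in> ?G" for x
    proof (cases "x < N")
      case False
      assume x: "x < N + N + 0"
      have "(x, dswap N i x) \<in> ?G"
        unfolding dglue_def using x by (intro r_into_rtrancl) auto
      moreover have "x - N < N" using x False by linarith
      ultimately show ?thesis using False x lt[of "x - N"] by (simp add: dswap_def douter_def)
    qed (simp add: douter_def dglue_def)
    show "\<exists>j<N + 0. ?r (N + j) = x \<and> ?r (N + D j) = ?E x"
      if "x < N + 0" for x
      using that lt by (intro exI[of _ "swp i x"]) simp
    show "?r (N + D x) = ?r (N + x) \<or> ?r (N + D x) = ?E (?r (N + x))" if "x < N + 0" for x
      by simp
  qed (auto simp: douter_def lt dswap_def)
qed

text \<open>\<open>bend k l\<close> renames the points of a diagram with rows \<open>k\<close> and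
  \<open>l + 1\<close> when its last top point is moved to the right end of the bottom row;
  \<open>unbend\<close> undoes this.\<close>

definition unbend :: "nat \<Rightarrow> nat \<Rightarrow> nat \<Rightarrow> nat" where
  "unbend k l x = (if x = k then k + l else if k < x \<and> x \<le> k + l then x - 1 else x)"

definition bend :: "nat \<Rightarrow> nat \<Rightarrow> nat \<Rightarrow> nat" where
  "bend k l x = (if x = k + l then k else if k \<le> x \<and> x < k + l then x + 1 else x)"

lemma bend_unbend [simp]: "bend k l (unbend k l x) = x" "unbend k l (bend k l x) = x"
  by (auto simp: bend_def unbend_def)

lemma bend_lt: "bend k l x < k + l + 1 \<longleftrightarrow> x < k + l + 1" "unbend k l x < k + l + 1 \<longleftrightarrow> x < k + l + 1"
  by (auto simp: bend_def unbend_def)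

text \<open>A snake is pulled straight: one end of the cup enters the bent strand of
  \<open>D'\<close>, and the other is led by \<open>dI\<close> up to the last top point.\<close>

lemma dcomp_bend:
  assumes D: "brauer k (l + 1) D"
  defines "D' \<equiv> \<lambda>x. bend k l (D (unbend k l x))"
  shows "brauer (k + 1) l D'"
    and "dcomp k (k + 2) (l + 1) (dtens (k + 1) l 1 1 D' dI) (dtens k k 0 2 (did k) dU) = D \<and>
      dloops k (k + 2) (l + 1) (dtens (k + 1) l 1 1 D' dI) (dtens k k 0 2 (did k) dU) = 0"
proof -
  have ne: "bend k l a = x \<longleftrightarrow> a = unbend k l x" for a x by (metis bend_unbend)
  have lt: "bend k l x < k + 1 + l \<longleftrightarrow> x < k + (l + 1)" "unbend k l x < k + (l + 1) \<longleftrightarrow> x < k + 1 + l" for x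
    using bend_lt[of k l x] by auto
  show D': "brauer (k + 1) l D'"
    unfolding brauer_def
  proof (intro conjI allI impI)
    fix x assume "x < k + 1 + l"
    then have u: "unbend k l x < k + (l + 1)" using lt by blast
    show "D' x < k + 1 + l" unfolding D'_def lt using brauer_lt[OF D u] .
    show "D' x \<noteq> x" unfolding D'_def ne using brauer_ne[OF D u] .
    show "D' (D' x) = x" using brauer_invol[OF D] by (simp add: D'_def)
  next
    fix x assume "k + 1 + l \<le> x"
    then have "k + (l + 1) \<le> unbend k l x" using lt by (meson not_le)
    then show "D' x = x" using brauer_outside[OF D] by (simp add: D'_def)
  qed
  let ?p1 = "dtens k k 0 2 (did k) dU" and ?p2 = "dtens (k + 1) l 1 1 D' dI"
  let ?G = "dglue k (k + 2) (l + 1) ?p2 ?p1"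
  \<comment> \<open>Middle points on the identity strands go to the bottom. Both ends of the cup, at
    \<open>2 * k\<close> and \<open>2 * k + 1\<close>, lead to the last top point
    \<open>k + l\<close>; the points after them are the top points.\<close>
  define r where "r x = (if x < k then x else if x < 2 * k then x - k else if x < 2 * k + 2 then k + l else x - (k + 2))" for x
  have p1: "brauer k (k + 2) ?p1" using brauer_dtens[OF brauer_did brauer_dU, of k] by simp
  have p2: "brauer (k + 2) (l + 1) ?p2" using brauer_dtens[OF D' brauer_dI] by (simp add: add.assoc)
  have p1_eq: "?p1 x = (if x < k then x + k else if x < 2 * k then x - k else if x = 2 * k then 2 * k + 1
      else if x = 2 * k + 1 then 2 * k else x)" for x
    by (auto simp: dtens_def did_def dU_def demb1_def demb2_def)
  have r1: "r (k + demb1 (k + 1) 1 j) = unbend k l j" if "j < k + 1 + l" for j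
    using that by (auto simp: r_def demb1_def unbend_def)
  have p2_1: "?p2 (demb1 (k + 1) 1 j) = demb1 (k + 1) 1 (D' j)" if "j < k + 1 + l" for j
    using that by (rule dtens_demb1[OF D'])
  have p2_2: "?p2 (demb2 (k + 1) 1 l j) = demb2 (k + 1) 1 l (dI j)" if "j < 1 + 1" for j
    using that by (rule dtens_demb2[OF brauer_dI])
  have D'l: "D' j < k + 1 + l" if "j < k + 1 + l" for j
    using that D' by (simp add: brauer_def)
  have G1: "(j, ?p1 j) \<in> ?G" if "j < k + (k + 2)" for j
    unfolding dglue_def using that by (intro r_into_rtrancl) auto
  have G2: "(k + j, k + ?p2 j) \<in> ?G" if "j < k + 2 + (l + 1)" for j
    unfolding dglue_def using that by (intro r_into_rtrancl) auto
  have "?p2 (demb2 (k + 1) 1 l 0) = demb2 (k + 1) 1 l 1"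
    using p2_2[of 0] by (simp add: dI_def did_def)
  then have "(k + (k + 1), k + (k + l + 2)) \<in> ?G"
    using G2[of "k + 1"] by (simp add: demb2_def)
  moreover have "k + (k + 1) = 2 * k + 1" "k + (k + l + 2) = 2 * k + l + 2" by simp_all
  ultimately have top1: "(2 * k + 1, 2 * k + l + 2) \<in> ?G" by (simp only:)
  moreover have "(2 * k, 2 * k + 1) \<in> ?G" using G1[of "2 * k"] by (simp add: p1_eq)
  ultimately have top2: "(2 * k, 2 * k + l + 2) \<in> ?G"
    unfolding dglue_def by (meson rtrancl_trans)
  note top = top1 top2
  show "dcomp k (k + 2) (l + 1) ?p2 ?p1 = D \<and> dloops k (k + 2) (l + 1) ?p2 ?p1 = 0"
  proof (rule dcomp_eqI[OF p1 p2 D, where r = r])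
    show "i < k + (l + 1) \<Longrightarrow> r (douter k (k + 2) i) = i" for i by (auto simp: r_def douter_def)
    show "x < k + (k + 2) + (l + 1) \<Longrightarrow> r x < k + (l + 1)" for x by (auto simp: r_def)
    show "(x, douter k (k + 2) (r x)) \<in> ?G" if x: "x < k + (k + 2) + (l + 1)" for x
    proof -
      consider "x < k" | "k \<le> x" "x < 2 * k" | "x = 2 * k" | "x = 2 * k + 1" | "2 * k + 2 \<le> x" by linarith
      then show ?thesis
      proof cases
        case 2
        then have "x - k < k" by linarith
        then show ?thesis using 2 G1[of x] by (simp add: r_def p1_eq douter_def)
      next
        case 3
        then show ?thesis using top by (simp add: r_def douter_def mult_2 add_ac)
      next
        case 4
        then show ?thesis using top by (simp add: r_def douter_def mult_2 add_ac)
      next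
        case 5
        then obtain y where "x = 2 * k + 2 + y" using le_Suc_ex by blast
        then show ?thesis by (simp add: r_def douter_def dglue_def mult_2 add_ac)
      qed (simp add: r_def douter_def dglue_def)
    qed
    show "i < k + (k + 2) \<Longrightarrow> r (?p1 i) = r i \<or> r (?p1 i) = D (r i)" for i
      by (auto simp: r_def p1_eq)
    show "r (k + ?p2 i) = r (k + i) \<or> r (k + ?p2 i) = D (r (k + i))" if i: "i < k + 2 + (l + 1)" for i
    proof -
      have "i < k + 1 + 1 + (l + 1)" using i by simp
      then show ?thesis
      proof (cases rule: demb_cases)
        case (1 j)
        then show ?thesis using r1[of j] r1[OF D'l] p2_1[of j] unfolding 1(1) by (simp add: D'_def)
      next
        case (2 j)
        then have "j = 0 \<or> j = 1" by auto
        then show ?thesis using p2_2[of j] 2 by (auto simp: r_def dI_def did_def demb2_def)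
      qed
    qed
    show "\<exists>j<k + 2 + (l + 1). r (k + j) = i \<and> r (k + ?p2 j) = D i"
      if i: "i < k + (l + 1)" for i
    proof -
      have b: "bend k l i < k + 1 + l" using i lt by simp
      have "demb1 (k + 1) 1 (bend k l i) < k + 2 + (l + 1)" using b by (auto simp: demb1_def)
      moreover have "r (k + demb1 (k + 1) 1 (bend k l i)) = i" using r1[OF b] by simp
      moreover have "r (k + ?p2 (demb1 (k + 1) 1 (bend k l i))) = D i"
        using r1[OF D'l[OF b]] p2_1[OF b] by (simp add: D'_def)
      ultimately show ?thesis by blast
    qed
  qed
qed

text \<open>Every diagram is obtained from the elementary ones without creating loops: bending the
  last top point down reduces to diagrams without top points, and there adjacent crossings at
  the bottom move the partner of the first point next to it, so that a cap splits off.\<close>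

lemma brauer_induct [consumes 1, case_names empty dI dX dU dA comp tens]:
  assumes D: "brauer k l D"
    and empty: "P 0 0 (did 0)" and dI: "P 1 1 dI" and dX: "P 2 2 dX" and dU: "P 0 2 dU" and dA: "P 2 0 dA"
    and comp: "\<And>k l q D1 D2. brauer k l D1 \<Longrightarrow> brauer l q D2 \<Longrightarrow> P k l D1 \<Longrightarrow> P l q D2 \<Longrightarrow>
      dloops k l q D2 D1 = 0 \<Longrightarrow> P k q (dcomp k l q D2 D1)"
    and tens: "\<And>k l k' l' D D'. brauer k l D \<Longrightarrow> brauer k' l' D' \<Longrightarrow> P k l D \<Longrightarrow> P k' l' D' \<Longrightarrow>
      P (k + k') (l + l') (dtens k l k' l' D D')"
  shows "P k l D"
proof -
  have did: "P k k (did k)" for k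
  proof (induction k)
    case (Suc k)
    then show ?case using tens[OF brauer_did brauer_dI _ dI, of k] by (simp add: did_Suc)
  qed (rule empty)
  have swap: "P N N (dswap N i)" if i: "Suc i < N" for i N
  proof -
    obtain j where N: "N = i + 2 + j" using i le_Suc_ex[of "i + 2" N] by auto
    have "P (i + 2) (i + 2) (dtens i i 2 2 (did i) dX)"
      by (rule tens[OF brauer_did brauer_dX did dX])
    from tens[OF brauer_dtens[OF brauer_did brauer_dX] brauer_did this did, of j]
    show ?thesis using dswap_dtens(2)[of i "i + 2" j] by (simp add: N dswap_dtens(1))
  qed
  have cap: "P N 0 D" if "brauer N 0 D" for N D
    using that
  proof (induction N arbitrary: D rule: less_induct)
    case (less N)
    note IHN = less.IH
    show ?case
    proof (cases "N = 0")
      case True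
      then have "D = did 0" using less.prems by (auto simp: brauer_def did_def fun_eq_iff)
      then show ?thesis using empty True by simp
    next
      case N: False
      have main: "P N 0 D" if "brauer N 0 D" "D 0 = Suc j" for D j
        using that
      proof (induction j arbitrary: D)
        case 0
        then have D: "brauer N 0 D" "D 0 = 1" "D 1 = 0" using brauer_invol[of N 0 D 0] by auto
        have N2: "1 < N" using brauer_lt[OF D(1), of 0] D N by simp
        define M where "M = N - 2"
        have M: "N = 2 + M" using N2 by (simp add: M_def)
        define D' where "D' x = D (x + 2) - 2" for x
        \<comment> \<open>The points 0 and 1 are each other's partners, so all other values are at
          least 2 and the truncated subtraction in \<open>D'\<close> is exact.\<close>
        have ge: "2 \<le> D (x + 2)" for x
        proof (rule ccontr)
          assume "\<not> 2 \<le> D (x + 2)"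
          then have "D (x + 2) = 0 \<or> D (x + 2) = 1" by auto
          moreover have "D (D (x + 2)) = x + 2" using brauer_invol[OF D(1)] .
          ultimately show False using D(2,3) by auto
        qed
        have DD': "D (x + 2) = D' x + 2" for x using ge[of x] by (simp add: D'_def)
        have D'inv: "D' (D' x) = x" for x
          using brauer_invol[OF D(1), of "x + 2"] DD'[of x] DD'[of "D' x"] by simp
        have D': "brauer M 0 D'"
          unfolding brauer_def
        proof (intro conjI allI impI)
          fix x assume "x < M + 0"
          then have "x + 2 < N + 0" using M by simp
          then show "D' x < M + 0" "D' x \<noteq> x" "D' (D' x) = x"
            using brauer_lt[OF D(1), of "x + 2"] brauer_ne[OF D(1), of "x + 2"] D'inv M DD'[of x] by simp_all
        next
          fix x assume "M + 0 \<le> x"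
          then have "D (x + 2) = x + 2" using brauer_outside[OF D(1), of "x + 2"] M by simp
          then show "D' x = x" using DD'[of x] by simp
        qed
        have "D = dtens 2 0 M 0 dA D'"
        proof
          fix x
          consider "x = 0" | "x = 1" | "2 \<le> x" "x < N" | "N \<le> x" by linarith
          then show "D x = dtens 2 0 M 0 dA D' x"
          proof cases
            case 3
            then have "x - 2 < M" using M by simp
            then have "D' (x - 2) < M" using brauer_lt[OF D', of "x - 2"] by simp
            moreover have "x - 2 + 2 = x" using 3 by linarith
            then have "D x = D' (x - 2) + 2" using DD'[of "x - 2"] by (simp only:)
            ultimately show ?thesis using 3 M by (simp add: dtens_def demb2_def)
          qed (use D M brauer_outside[OF D(1), of x] in \<open>simp_all add: dtens_def demb1_def dA_def\<close>)
        qed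
        then show ?case
          using tens[OF brauer_dA D' dA IHN[OF _ D']] M by simp
      next
        case (Suc j)
        have i: "Suc (Suc j) < N" using brauer_lt[OF Suc.prems(1), of 0] Suc.prems N by simp
        \<comment> \<open>The crossing of \<open>j + 1\<close> and \<open>j + 2\<close> fixes the
          point 0 and moves its partner down by one; applied once more it turns \<open>?E\<close>
          back into \<open>D\<close>.\<close>
        let ?E = "\<lambda>x. swp (Suc j) (D (swp (Suc j) x))"
        have E: "brauer N 0 ?E" using dcomp_dswap(1)[OF Suc.prems(1) i] .
        have "?E 0 = Suc j" using Suc.prems(2) by (simp add: swp_def)
        then have "P N 0 ?E" by (rule Suc.IH[OF E])
        then have "P N 0 (dcomp N N 0 ?E (dswap N (Suc j)))"
          using dcomp_dswap(2)[OF E i] by (intro comp[OF brauer_dswap[OF i] E swap[OF i]]) auto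
        then show ?case using dcomp_dswap(2)[OF E i] by simp
      qed
      obtain j where "D 0 = Suc j" using brauer_ne[OF less.prems, of 0] N by (cases "D 0") auto
      then show ?thesis using main less.prems by blast
    qed
  qed
  show ?thesis
    using D
  proof (induction l arbitrary: k D)
    case 0
    then show ?case using cap by simp
  next
    case (Suc l)
    define D' where "D' = (\<lambda>x. bend k l (D (unbend k l x)))"
    have D: "brauer k (l + 1) D" using Suc.prems by simp
    note b = dcomp_bend[OF D, folded D'_def]
    have "P (k + 1) l D'" using Suc.IH b(1) by simp
    then have 2: "P (k + 2) (l + 1) (dtens (k + 1) l 1 1 D' dI)"
      using tens[OF b(1) brauer_dI _ dI] by (simp add: add.assoc)
    have 1: "P k (k + 2) (dtens k k 0 2 (did k) dU)"
      using tens[OF brauer_did brauer_dU did dU, of k] by simp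
    have br: "brauer k (k + 2) (dtens k k 0 2 (did k) dU)" "brauer (k + 2) (l + 1) (dtens (k + 1) l 1 1 D' dI)"
      using brauer_dtens[OF brauer_did brauer_dU, of k] brauer_dtens[OF b(1) brauer_dI] by (simp_all add: add.assoc)
    show ?case using comp[OF br 1 2] b(2) by simp
  qed
qed

section \<open>Equivariance\<close>

lemma sum_words_1: "(\<Sum>w\<in>words m n 1. f w) = (\<Sum>a<m + 2 * n. f [a])"
  by (rule sum.reindex_bij_witness[where i = "\<lambda>a. [a]" and j = hd]) (auto simp: words_def length_Suc_conv)

lemma sum_words_2: "(\<Sum>w\<in>words m n 2. f w) = (\<Sum>a<m + 2 * n. \<Sum>b<m + 2 * n. f [a, b])"
proof -
  have "(\<Sum>w\<in>words m n 2. f w) = (\<Sum>(a, b)\<in>{..<m + 2 * n} \<times> {..<m + 2 * n}. f [a, b])"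
    by (rule sum.reindex_bij_witness[where i = "\<lambda>(a, b). [a, b]" and j = "\<lambda>w. (w ! 0, w ! 1)"])
      (auto simp: words_2)
  then show ?thesis by (simp add: sum.cartesian_product)
qed

text \<open>The matrix of a tensor product whose second factor is even: compared with
  \<open>mtens_eq_app\<close> the twist is absent.\<close>

definition tmat :: "nat \<Rightarrow> nat \<Rightarrow> nat \<Rightarrow> (nat list \<Rightarrow> nat list \<Rightarrow> gr) \<Rightarrow> (nat list \<Rightarrow> nat list \<Rightarrow> gr)
    \<Rightarrow> nat list \<Rightarrow> nat list \<Rightarrow> gr" where
  "tmat m k l M M' z w = gmult (gtw (wpar m (drop l z)) (M (take l z) (take k w))) (M' (drop l z) (drop k w))"

lemma tmat_append:
  "length v = l \<Longrightarrow> length u = k \<Longrightarrow> tmat m k l M M' (v @ v') (u @ u') = gmult (gtw (wpar m v') (M v u)) (M' v' u')"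
  by (simp add: tmat_def)

fun gpow :: "nat \<Rightarrow> (nat list \<Rightarrow> nat list \<Rightarrow> gr) \<Rightarrow> nat \<Rightarrow> nat list \<Rightarrow> nat list \<Rightarrow> gr" where
  "gpow m W 0 = (\<lambda>v u. gone)"
| "gpow m W (Suc r) = tmat m r r (gpow m W r) W"

definition even_matrix :: "nat \<Rightarrow> nat \<Rightarrow> nat \<Rightarrow> (nat list \<Rightarrow> nat list \<Rightarrow> gr) \<Rightarrow> bool" where
  "even_matrix m n r M \<longleftrightarrow> (\<forall>u\<in>words m n r. \<forall>v\<in>words m n r. gelem (M v u) \<and> ghom (wpar m v + wpar m u) (M v u))"

lemma ghom_gmult:
  assumes "ghom p a" "ghom q b"
  shows "ghom (p + q) (gmult a b)"
  unfolding ghom_def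
proof (intro allI impI)
  fix S assume S: "gmult a b S \<noteq> 0"
  then have fin: "finite S" using gmult_infinite by blast
  obtain T where T: "T \<in> Pow S" "gsign T (S - T) * a T * b (S - T) \<noteq> 0"
    using S unfolding gmult_def by (meson sum.not_neutral_contains_not_neutral)
  then have "card T mod 2 = p mod 2" "card (S - T) mod 2 = q mod 2"
    using assms by (auto simp: ghom_def)
  moreover have "card S = card T + card (S - T)"
    using T fin by (simp add: card_Diff_subset finite_subset card_mono)
  ultimately show "card S mod 2 = (p + q) mod 2" by (metis mod_add_eq)
qed

lemma ghom_gtw: "ghom p a \<Longrightarrow> ghom p (gtw q a)"
  by (auto simp: ghom_def gtw_def gflip_def)

lemma even_matrix_gpow:
  assumes W: "even_matrix m n 1 W"
  shows "even_matrix m n r (gpow m W r)"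
proof (induction r)
  case 0
  then show ?case by (simp add: even_matrix_def gone_def wpar_def)
next
  case (Suc r)
  show ?case
    unfolding even_matrix_def
  proof (intro ballI)
    fix w z assume "w \<in> words m n (Suc r)" "z \<in> words m n (Suc r)"
    then have t: "take r w \<in> words m n r" "drop r w \<in> words m n 1" "take r z \<in> words m n r" "drop r z \<in> words m n 1"
      using words_take_drop[of _ m n r 1] by auto
    let ?a = "gpow m W r (take r z) (take r w)" and ?b = "W (drop r z) (drop r w)"
    have a: "gelem ?a" "ghom (wpar m (take r z) + wpar m (take r w)) ?a" using Suc t by (auto simp: even_matrix_def)
    have b: "gelem ?b" "ghom (wpar m (drop r z) + wpar m (drop r w)) ?b" using W t by (auto simp: even_matrix_def)
    have "ghom (wpar m (take r z) + wpar m (take r w) + (wpar m (drop r z) + wpar m (drop r w)))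
        (gmult (gtw (wpar m (drop r z)) ?a) ?b)"
      by (intro ghom_gmult ghom_gtw a b)
    moreover have par: "even (wpar m (take r z) + wpar m (take r w) + (wpar m (drop r z) + wpar m (drop r w)))
        = even (wpar m z + wpar m w)"
      using wpar_take_drop[of m r z] wpar_take_drop[of m r w] by auto
    ultimately have "ghom (wpar m z + wpar m w) (gmult (gtw (wpar m (drop r z)) ?a) ?b)"
      by (simp only: ghom_cong_parity[OF par])
    then show "gelem (gpow m W (Suc r) z w) \<and> ghom (wpar m z + wpar m w) (gpow m W (Suc r) z w)"
      using a b by (simp add: tmat_def)
  qed
qed

text \<open>\<open>gpow\<close> is defined by splitting off the last factor, whereas a juxtaposition
  of diagrams cuts the word at an arbitrary place.\<close>

lemma gpow_add:
  assumes W: "even_matrix m n 1 W"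
    and len: "v \<in> words m n k" "u \<in> words m n k" "v' \<in> words m n k'" "u' \<in> words m n k'"
  shows "gpow m W (k + k') (v @ v') (u @ u') = gmult (gtw (wpar m v') (gpow m W k v u)) (gpow m W k' v' u')"
  using len(3,4)
proof (induction k' arbitrary: v' u')
  case 0
  have "gelem (gpow m W k v u)" using even_matrix_gpow[OF W, of k] len by (simp add: even_matrix_def)
  then show ?case using 0 by (simp add: wpar_def)
next
  case (Suc k')
  obtain v'' b where v': "v' = v'' @ [b]" "v'' \<in> words m n k'"
    using Suc.prems(1) by (cases v' rule: rev_cases) (auto simp: words_def)
  obtain u'' a where u': "u' = u'' @ [a]" "u'' \<in> words m n k'"
    using Suc.prems(2) by (cases u' rule: rev_cases) (auto simp: words_def)
  have l: "length v = k" "length u = k" "length v'' = k'" "length u'' = k'"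
    using len v' u' by (auto simp: words_def)
  have "gpow m W (k + Suc k') (v @ v') (u @ u')
      = gmult (gtw (wpar m [b]) (gpow m W (k + k') (v @ v'') (u @ u''))) (W [b] [a])"
    using tmat_append[of "v @ v''" "k + k'" "u @ u''" "k + k'" m _ W "[b]" "[a]"] l by (simp add: v' u')
  also have "\<dots> = gmult (gmult (gtw (wpar m [b] + wpar m v'') (gpow m W k v u)) (gtw (wpar m [b]) (gpow m W k' v'' u''))) (W [b] [a])"
    by (simp add: Suc.IH[OF v'(2) u'(2)] gtw_gmult gtw_gtw)
  also have "gtw (wpar m [b] + wpar m v'') = gtw (wpar m v')"
    by (rule gtw_cong_parity) (auto simp: v' wpar_append)
  finally show ?case
    using tmat_append[of v'' k' u'' k' m _ W "[b]" "[a]"] l by (simp add: v' u' gmult_assoc)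
qed

lemma gpow_1:
  assumes "even_matrix m n 1 W" "a < m + 2 * n" "b < m + 2 * n"
  shows "gpow m W 1 [b] [a] = W [b] [a]"
  using assms by (simp add: tmat_def even_matrix_def words_def)

lemma gpow_2:
  assumes "even_matrix m n 1 W" "a < m + 2 * n" "b < m + 2 * n" "c < m + 2 * n" "d < m + 2 * n"
  shows "gpow m W 2 [c, d] [a, b] = gmult (gtw (wpar m [d]) (W [c] [a])) (W [d] [b])"
  using gpow_add[OF assms(1), of "[c]" 1 "[a]" "[d]" 1 "[b]"] gpow_1[OF assms(1)] assms
  by (simp add: words_def numeral_2_eq_2)

text \<open>Equivariance of a single diagram, written as a matrix identity so that it can be
  transported along composition and juxtaposition.\<close>

definition intertwines :: "nat \<Rightarrow> nat \<Rightarrow> (nat list \<Rightarrow> nat list \<Rightarrow> gr) \<Rightarrow> nat \<Rightarrow> nat \<Rightarrow> (nat \<Rightarrow> nat) \<Rightarrow> bool" where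
  "intertwines m n W k l D \<longleftrightarrow> (\<forall>u\<in>words m n k. \<forall>v\<in>words m n l.
    (\<Sum>w\<in>words m n k. gmult (gscal (dval m D k l w v)) (gpow m W k w u))
      = (\<Sum>w\<in>words m n l. gmult (gpow m W l v w) (gscal (dval m D k l u w))))"

text \<open>Without loops the coefficients of the composite are the plain matrix product. With loops
  a power of \<open>m - 2 * n\<close> would remain, which cannot be cancelled if it is zero.\<close>

lemma intertwines_dcomp:
  assumes D: "brauer k l D1" "brauer l q D2" and I1: "intertwines m n W k l D1" and I2: "intertwines m n W l q D2"
    and no: "dloops k l q D2 D1 = 0"
  shows "intertwines m n W k q (dcomp k l q D2 D1)"
  unfolding intertwines_def
proof (intro ballI, goal_cases)
  case (1 u v)
  note u = 1(1) and v = 1(2)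
  let ?Z = "dval m (dcomp k l q D2 D1) k q" and ?Z1 = "dval m D1 k l" and ?Z2 = "dval m D2 l q"
  have Z: "gscal (?Z u v) = (\<Sum>w\<in>words m n l. gmult (gscal (?Z2 w v)) (gscal (?Z1 u w)))"
    if "u \<in> words m n k" "v \<in> words m n q" for u v
    using dval_dcomp[OF D that] no by (simp add: gscal_mult[symmetric] gscal_sum[symmetric] mult.commute)
  have "(\<Sum>w\<in>words m n k. gmult (gscal (?Z w v)) (gpow m W k w u))
      = (\<Sum>w\<in>words m n k. \<Sum>y\<in>words m n l. gmult (gscal (?Z2 y v)) (gmult (gscal (?Z1 w y)) (gpow m W k w u)))"
    using v by (simp add: Z gmult_sum_left gmult_assoc cong: sum.cong)
  also have "\<dots> = (\<Sum>y\<in>words m n l. gmult (gscal (?Z2 y v)) (\<Sum>w\<in>words m n k. gmult (gscal (?Z1 w y)) (gpow m W k w u)))"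
    by (subst sum.swap) (simp only: gmult_sum_right)
  also have "\<dots> = (\<Sum>y\<in>words m n l. gmult (gscal (?Z2 y v)) (\<Sum>w\<in>words m n l. gmult (gpow m W l y w) (gscal (?Z1 u w))))"
    using I1 u unfolding intertwines_def by (intro sum.cong) auto
  also have "\<dots> = (\<Sum>w\<in>words m n l. \<Sum>y\<in>words m n l. gmult (gmult (gscal (?Z2 y v)) (gpow m W l y w)) (gscal (?Z1 u w)))"
    by (subst sum.swap) (simp only: gmult_sum_right gmult_assoc)
  also have "\<dots> = (\<Sum>w\<in>words m n l. gmult (\<Sum>y\<in>words m n q. gmult (gpow m W q v y) (gscal (?Z2 w y))) (gscal (?Z1 u w)))"
    using I2 v unfolding intertwines_def gmult_sum_left[symmetric] by (intro sum.cong) auto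
  also have "\<dots> = (\<Sum>y\<in>words m n q. \<Sum>w\<in>words m n l. gmult (gpow m W q v y) (gmult (gscal (?Z2 w y)) (gscal (?Z1 u w))))"
    unfolding gmult_sum_left gmult_assoc by (rule sum.swap)
  also have "\<dots> = (\<Sum>y\<in>words m n q. gmult (gpow m W q v y) (gscal (?Z u y)))"
    using u by (simp add: Z gmult_sum_right cong: sum.cong)
  finally show ?case .
qed

lemma intertwines_dtens:
  assumes W: "even_matrix m n 1 W" and D: "brauer k l D" "brauer k' l' D'"
    and I1: "intertwines m n W k l D" and I2: "intertwines m n W k' l' D'"
  shows "intertwines m n W (k + k') (l + l') (dtens k l k' l' D D')"
  unfolding intertwines_def
proof (intro ballI, goal_cases)
  case (1 x z)
  note x = 1(1) and z = 1(2)
  define u u' v v' where "u = take k x" "u' = drop k x" "v = take l z" "v' = drop l z"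
  note uv = this
  have w: "u \<in> words m n k" "u' \<in> words m n k'" "v \<in> words m n l" "v' \<in> words m n l'" "x = u @ u'" "z = v @ v'"
    using x z by (auto simp: uv words_take_drop)
  let ?Z = "dval m D k l" and ?Z' = "dval m D' k' l'" and ?G = "gpow m W"
  have Zt: "dval m (dtens k l k' l' D D') (k + k') (l + l') (a @ a') (b @ b') = ?Z a b * ?Z' a' b'"
    if "a \<in> words m n k" "a' \<in> words m n k'" "b \<in> words m n l" "b' \<in> words m n l'" for a a' b b'
    using that by (intro dval_dtens[OF D]) (auto simp: words_def)
  have ge: "gelem (?G r a b)" if "a \<in> words m n r" "b \<in> words m n r" for r a b
    using even_matrix_gpow[OF W, of r] that by (simp add: even_matrix_def)
  have split: "(\<Sum>y\<in>words m n (r + r'). f y) = (\<Sum>a\<in>words m n r. \<Sum>a'\<in>words m n r'. f (a @ a'))"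
    for f :: "nat list \<Rightarrow> gr" and r r'
    using sum_words_append[of "\<lambda>a a'. f (a @ a')" r m n r'] by simp
  have "(\<Sum>y\<in>words m n (k + k'). gmult (gscal (dval m (dtens k l k' l' D D') (k + k') (l + l') y z)) (?G (k + k') y x))
     = (\<Sum>a\<in>words m n k. \<Sum>a'\<in>words m n k'.
        gmult (gtw (wpar m v') (gmult (gscal (?Z a v)) (?G k a u))) (gmult (gscal (?Z' a' v')) (?G k' a' u')))"
    unfolding split
  proof (intro sum.cong refl, goal_cases)
    case a: (1 a a')
    show ?case
    proof (cases "?Z' a' v' = 0")
      case True
      then show ?thesis unfolding w(5,6) Zt[OF a w(3,4)] by simp
    next
      case False
      \<comment> \<open>\<open>gpow_add\<close> twists the first block by the intermediate word
        \<open>a'\<close>; parity conservation replaces it by the output word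
        \<open>v'\<close>.\<close>
      then have p: "wpar m a' = wpar m v'" using dval_parity[OF D(2), of a' v' m] a w by (simp add: words_def)
      let ?A = "gtw (wpar m v') (?G k a u)"
      have "gmult (gscal (?Z' a' v')) ?A = gmult ?A (gscal (?Z' a' v'))"
        using ge[OF a(1) w(1)] by (intro gscal_commute[symmetric] gelem_gtw)
      then have "gmult (gscal (?Z a v * ?Z' a' v')) (gmult ?A (?G k' a' u'))
        = gmult (gmult (gscal (?Z a v)) ?A) (gmult (gscal (?Z' a' v')) (?G k' a' u'))"
        by (simp only: gscal_mult gmult_assoc[symmetric]) (simp only: gmult_assoc)
      then show ?thesis
        unfolding w(5,6) Zt[OF a w(3,4)] gpow_add[OF W a(1) w(1) a(2) w(2)] p gtw_gmult gtw_gscal .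
    qed
  qed
  also have "\<dots> = gmult (gtw (wpar m v') (\<Sum>a\<in>words m n k. gmult (gscal (?Z a v)) (?G k a u)))
      (\<Sum>a'\<in>words m n k'. gmult (gscal (?Z' a' v')) (?G k' a' u'))"
    unfolding gtw_sum gmult_sum_left gmult_sum_right by (rule sum.swap)
  also have "\<dots> = gmult (gtw (wpar m v') (\<Sum>b\<in>words m n l. gmult (?G l v b) (gscal (?Z u b))))
      (\<Sum>b'\<in>words m n l'. gmult (?G l' v' b') (gscal (?Z' u' b')))"
    using I1 I2 w unfolding intertwines_def by simp
  also have "\<dots> = (\<Sum>b\<in>words m n l. \<Sum>b'\<in>words m n l'.
      gmult (gtw (wpar m v') (gmult (?G l v b) (gscal (?Z u b)))) (gmult (?G l' v' b') (gscal (?Z' u' b'))))"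
    unfolding gtw_sum gmult_sum_left gmult_sum_right by (rule sum.swap)
  also have "\<dots> = (\<Sum>y\<in>words m n (l + l'). gmult (?G (l + l') z y) (gscal (dval m (dtens k l k' l' D D') (k + k') (l + l') x y)))"
    unfolding split
  proof (intro sum.cong refl, goal_cases)
    case b: (1 b b')
    show ?case
      unfolding w(5,6) Zt[OF w(1,2) b] gpow_add[OF W w(3) b(1) w(4) b(2)] gtw_gmult gtw_gscal
      using ge[OF w(4) b(2)] by (rule gmult_scalar_pair)
  qed
  finally show ?case .
qed

lemma wpar_singleton: "wpar m [a] = (if m \<le> a then 1 else 0)"
  by (simp add: wpar_def)

lemma intertwines_dI:
  assumes W: "even_matrix m n 1 W"
  shows "intertwines m n W 1 1 dI"
  unfolding intertwines_def
proof (intro ballI, goal_cases)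
  case (1 u v)
  then obtain a b where ab: "u = [a]" "v = [b]" "a < m + 2 * n" "b < m + 2 * n" by (auto simp: words_1[simplified])
  have ge: "gelem (gpow m W 1 [c] [d])" if "c < m + 2 * n" "d < m + 2 * n" for c d
    using even_matrix_gpow[OF W, of 1] that by (simp add: even_matrix_def words_1[simplified])
  have "(\<Sum>w\<in>words m n 1. gmult (gscal (dval m dI 1 1 w v)) (gpow m W 1 w u)) = gpow m W 1 [b] [a]"
  proof -
    have "(\<Sum>c<m + 2 * n. gmult (gscal (dval m dI 1 1 [c] v)) (gpow m W 1 [c] u))
      = (\<Sum>c<m + 2 * n. if c = b then gpow m W 1 [c] [a] else 0)"
      unfolding ab dval_dI using ge ab by (intro sum.cong) (auto simp flip: gone_def)
    then show ?thesis unfolding sum_words_1 using ab by (simp only: sum.delta finite_lessThan lessThan_iff if_True)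
  qed
  moreover have "(\<Sum>w\<in>words m n 1. gmult (gpow m W 1 v w) (gscal (dval m dI 1 1 u w))) = gpow m W 1 [b] [a]"
  proof -
    have "(\<Sum>c<m + 2 * n. gmult (gpow m W 1 v [c]) (gscal (dval m dI 1 1 u [c])))
      = (\<Sum>c<m + 2 * n. if c = a then gpow m W 1 [b] [c] else 0)"
      unfolding ab dval_dI using ge ab by (intro sum.cong) (auto simp flip: gone_def)
    then show ?thesis unfolding sum_words_1 using ab by (simp only: sum.delta finite_lessThan lessThan_iff if_True)
  qed
  ultimately show ?case by simp
qed

lemma gmult_gscal_uminus: "gelem a \<Longrightarrow> gmult (gscal (- 1)) a = - a" "gelem a \<Longrightarrow> gmult a (gscal (- 1)) = - a"
  by (simp_all add: gmult_gscal_left gmult_gscal_right fun_eq_iff)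

text \<open>\<open>dX\<close> contributes a signed transposition on each side. What remains is the
  exchange of two entries of \<open>W\<close>, whose supercommutation sign is compared in each of
  the sixteen parity cases.\<close>

lemma intertwines_dX:
  assumes W: "even_matrix m n 1 W"
  shows "intertwines m n W 2 2 dX"
  unfolding intertwines_def
proof (intro ballI, goal_cases)
  case (1 u v)
  then obtain a b c d where ab: "u = [a, b]" "v = [c, d]" and
    lt: "a < m + 2 * n" "b < m + 2 * n" "c < m + 2 * n" "d < m + 2 * n" by (auto simp: words_2)
  let ?G = "gpow m W 2"
  define s where "s x y = (if m \<le> x \<and> m \<le> y then - 1 else 1 :: complex)" for x y
  have W': "gelem (W [x] [y]) \<and> ghom (wpar m [x] + wpar m [y]) (W [x] [y])" if "x < m + 2 * n" "y < m + 2 * n" for x y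
    using W that by (simp add: even_matrix_def words_1[simplified])
  have "(\<Sum>w\<in>words m n 2. gmult (gscal (dval m dX 2 2 w v)) (?G w u)) = gmult (gscal (s c d)) (?G [d, c] [a, b])"
  proof -
    have "(\<Sum>p<m + 2 * n. \<Sum>q<m + 2 * n. gmult (gscal (dval m dX 2 2 [p, q] v)) (?G [p, q] u))
      = (\<Sum>p<m + 2 * n. \<Sum>q<m + 2 * n. if q = c then if p = d then gmult (gscal (s c d)) (?G [d, c] [a, b]) else 0 else 0)"
      unfolding ab dval_dX s_def by (intro sum.cong refl) auto
    also have "\<dots> = gmult (gscal (s c d)) (?G [d, c] [a, b])"
      using lt by (simp only: sum.delta finite_lessThan lessThan_iff if_True)
    finally show ?thesis unfolding sum_words_2 .
  qed
  moreover have "(\<Sum>w\<in>words m n 2. gmult (?G v w) (gscal (dval m dX 2 2 u w))) = gmult (?G [c, d] [b, a]) (gscal (s a b))"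
  proof -
    have "(\<Sum>p<m + 2 * n. \<Sum>q<m + 2 * n. gmult (?G v [p, q]) (gscal (dval m dX 2 2 u [p, q])))
      = (\<Sum>p<m + 2 * n. \<Sum>q<m + 2 * n. if q = a then if p = b then gmult (?G [c, d] [b, a]) (gscal (s a b)) else 0 else 0)"
      unfolding ab dval_dX s_def by (intro sum.cong refl) auto
    also have "\<dots> = gmult (?G [c, d] [b, a]) (gscal (s a b))"
      using lt by (simp only: sum.delta finite_lessThan lessThan_iff if_True)
    finally show ?thesis unfolding sum_words_2 .
  qed
  moreover have "gmult (gscal (s c d)) (?G [d, c] [a, b]) = gmult (?G [c, d] [b, a]) (gscal (s a b))"
  proof -
    let ?A = "W [d] [a]" and ?B = "W [c] [b]"
    have A: "gelem ?A" "ghom (wpar m [d] + wpar m [a]) ?A" and B: "gelem ?B" "ghom (wpar m [c] + wpar m [b]) ?B"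
      using W' lt by blast+
    have "gmult ?A ?B = gmult (gtw (wpar m [d] + wpar m [a]) ?B) ?A" by (rule gmult_supercommute[OF A(2)])
    then have AB: "gmult ?A ?B = gmult (if odd (wpar m [c] + wpar m [b]) \<and> odd (wpar m [d] + wpar m [a]) then - ?B else ?B) ?A"
      by (simp only: gtw_ghom[OF B(2)])
    have G: "?G [d, c] [a, b] = gmult (gtw (wpar m [c]) ?A) ?B" "?G [c, d] [b, a] = gmult (gtw (wpar m [d]) ?B) ?A"
      using gpow_2[OF W] lt by blast+
    have "gelem (gmult ?B ?A)" using A B by simp
    then show ?thesis
      unfolding G gtw_ghom[OF A(2)] gtw_ghom[OF B(2)]
      by (cases "m \<le> a"; cases "m \<le> b"; cases "m \<le> c"; cases "m \<le> d")
        (simp_all add: s_def wpar_singleton AB gmult_minus_left gmult_gscal_uminus flip: gone_def)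
  qed
  ultimately show ?case by simp
qed

lemma gscal_pull: "gelem a \<Longrightarrow> gmult (gscal s) (gmult a b) = gmult a (gmult (gscal s) b)"
  by (simp only: gmult_assoc[symmetric] gscal_commute)

lemma intertwines_dA:
  assumes W: "even_matrix m n 1 W"
    and form: "\<And>a b. a < m + 2 * n \<Longrightarrow> b < m + 2 * n \<Longrightarrow>
      (\<Sum>c<m + 2 * n. \<Sum>d<m + 2 * n. gmult (gscal (eta m c d)) (gmult (gtw (wpar m [d]) (W [c] [a])) (W [d] [b])))
        = gscal (eta m a b)"
  shows "intertwines m n W 2 0 dA"
  unfolding intertwines_def
proof (intro ballI, goal_cases)
  case (1 u v)
  then obtain a b where ab: "u = [a, b]" "v = []" "a < m + 2 * n" "b < m + 2 * n" by (auto simp: words_2)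
  have "(\<Sum>w\<in>words m n 2. gmult (gscal (dval m dA 2 0 w v)) (gpow m W 2 w u))
    = (\<Sum>c<m + 2 * n. \<Sum>d<m + 2 * n. gmult (gscal (eta m c d)) (gmult (gtw (wpar m [d]) (W [c] [a])) (W [d] [b])))"
    unfolding sum_words_2 ab using ab by (intro sum.cong refl) (simp add: dval_dA gpow_2[OF W])
  then show ?case
    using form ab by (simp add: dval_dA)
qed

text \<open>Invariance of the form gives a left inverse of \<open>W\<close>; as \<open>W\<close> is onto, it is also a right
  inverse, which is the invariance of \<open>c\<^sub>0\<close>.\<close>

lemma intertwines_dU:
  assumes W: "even_matrix m n 1 W"
    and form: "\<And>a b. a < m + 2 * n \<Longrightarrow> b < m + 2 * n \<Longrightarrow>
      (\<Sum>c<m + 2 * n. \<Sum>d<m + 2 * n. gmult (gscal (eta m c d)) (gmult (gtw (wpar m [d]) (W [c] [a])) (W [d] [b])))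
        = gscal (eta m a b)"
    and surj: "\<And>j. j < m + 2 * n \<Longrightarrow> \<exists>x. (\<forall>b. gelem (x b)) \<and>
      (\<forall>d<m + 2 * n. (\<Sum>b<m + 2 * n. gmult (W [d] [b]) (x b)) = (if d = j then gone else 0))"
  shows "intertwines m n W 0 2 dU"
proof -
  let ?N = "m + 2 * n"
  define h where "h d b = W [d] [b]" for d b
  have h: "gelem (h x y)" "ghom (wpar m [x] + wpar m [y]) (h x y)" if "x < ?N" "y < ?N" for x y
    using W that by (simp_all add: even_matrix_def words_1[simplified] h_def)
  \<comment> \<open>\<open>Q\<close> is the product of the inverse form, the supertranspose of
    \<open>W\<close> and the form: the left inverse that invariance of the form predicts.\<close>
  define Q where "Q e d = (\<Sum>a<?N. gmult (gscal (eta_inv m e a)) (\<Sum>c<?N. gmult (gscal (eta m c d)) (gtw (wpar m [d]) (h c a))))" for e d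
  have Qg: "gelem (Q e d)" if "d < ?N" for e d
    unfolding Q_def using h that by (intro gelem_sum gelem_gmult) auto
  have left: "(\<Sum>d<?N. gmult (Q e d) (h d b)) = (if e = b then gone else 0)" if e: "e < ?N" and b: "b < ?N" for e b
  proof -
    have "(\<Sum>d<?N. gmult (Q e d) (h d b)) = (\<Sum>a<?N. gmult (gscal (eta_inv m e a))
        (\<Sum>d<?N. \<Sum>c<?N. gmult (gscal (eta m c d)) (gmult (gtw (wpar m [d]) (h c a)) (h d b))))"
      unfolding Q_def gmult_sum_left gmult_sum_right gmult_assoc by (rule sum.swap)
    also have "\<dots> = (\<Sum>a<?N. gmult (gscal (eta_inv m e a)) (gscal (eta m a b)))"
      using form[OF _ b] unfolding h_def by (intro sum.cong refl, subst sum.swap) simp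
    also have "\<dots> = gscal (\<Sum>a<?N. eta_inv m e a * eta m a b)"
      by (simp add: gscal_mult gscal_sum)
    finally show ?thesis using sum_eta_inv_eta[OF e] by (simp add: gone_def)
  qed
  \<comment> \<open>Multiplying the equation supplied by \<open>surj\<close> from the left by
    \<open>Q\<close> forces its solution \<open>x\<close> to be column \<open>j\<close> of
    \<open>Q\<close>.\<close>
  have right: "(\<Sum>e<?N. gmult (h d e) (Q e j)) = (if d = j then gone else 0)" if d: "d < ?N" and j: "j < ?N" for d j
  proof -
    obtain x where x: "\<And>b. gelem (x b)" "\<And>d. d < ?N \<Longrightarrow> (\<Sum>b<?N. gmult (h d b) (x b)) = (if d = j then gone else 0)"
      using surj[OF j] unfolding h_def by blast
    have "x e = Q e j" if e: "e < ?N" for e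
    proof -
      have "(\<Sum>d<?N. gmult (Q e d) (\<Sum>b<?N. gmult (h d b) (x b)))
        = (\<Sum>b<?N. gmult (\<Sum>d<?N. gmult (Q e d) (h d b)) (x b))"
        unfolding gmult_sum_right gmult_sum_left gmult_assoc by (rule sum.swap)
      also have "\<dots> = (\<Sum>b<?N. if b = e then x b else 0)"
        using left[OF e] x(1) by (intro sum.cong refl) auto
      also have "\<dots> = x e" using e by (simp only: sum.delta finite_lessThan lessThan_iff if_True)
      finally have "x e = (\<Sum>d<?N. gmult (Q e d) (\<Sum>b<?N. gmult (h d b) (x b)))" ..
      also have "\<dots> = (\<Sum>d<?N. if d = j then Q e d else 0)"
        using x(2) Qg by (intro sum.cong refl) auto
      also have "\<dots> = Q e j" using j by (simp only: sum.delta finite_lessThan lessThan_iff if_True)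
      finally show ?thesis .
    qed
    then show ?thesis using x(2)[OF d] by simp
  qed
  have U1: "(\<Sum>e<?N. \<Sum>a<?N. gmult (gmult (h d e) (gtw (wpar m [f]) (h f a))) (gscal (eta_inv m e a))) = gscal (eta_inv m d f)"
    if d: "d < ?N" and f: "f < ?N" for d f
  proof -
    \<comment> \<open>Here the form cancels against its inverse: \<open>Q\<close> times the inverse
      form is the inverse form times the supertranspose of \<open>W\<close>.\<close>
    have Qf: "(\<Sum>j<?N. gmult (Q e j) (gscal (eta_inv m j f))) = (\<Sum>a<?N. gmult (gtw (wpar m [f]) (h f a)) (gscal (eta_inv m e a)))"
      for e
    proof -
      have "(\<Sum>j<?N. gmult (Q e j) (gscal (eta_inv m j f)))
        = (\<Sum>j<?N. \<Sum>a<?N. \<Sum>c<?N. gmult (gtw (wpar m [c]) (h c a)) (gscal (eta_inv m e a * (eta m c j * eta_inv m j f))))"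
        unfolding Q_def gmult_sum_left gmult_sum_right
      proof (intro sum.cong refl, goal_cases)
        case jac: (1 j a c)
        show ?case
        proof (cases "eta m c j = 0")
          case False
          then have "wpar m [j] = wpar m [c]" using eta_parity by (simp add: wpar_singleton)
          moreover have "gelem (gtw (wpar m [c]) (h c a))" using h jac by simp
          ultimately show ?thesis
            by (simp only: gscal_commute[symmetric] gscal_pull gmult_assoc gscal_mult)
        qed simp
      qed
      also have "\<dots> = (\<Sum>a<?N. \<Sum>c<?N. \<Sum>j<?N. gmult (gtw (wpar m [c]) (h c a)) (gscal (eta_inv m e a * (eta m c j * eta_inv m j f))))"
        by (rule trans[OF sum.swap], rule sum.cong[OF refl], rule sum.swap)
      also have "\<dots> = (\<Sum>a<?N. \<Sum>c<?N. if c = f then gmult (gtw (wpar m [f]) (h f a)) (gscal (eta_inv m e a)) else 0)"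
      proof (intro sum.cong refl, goal_cases)
        case c: (1 a c)
        have "(\<Sum>j<?N. gmult (gtw (wpar m [c]) (h c a)) (gscal (eta_inv m e a * (eta m c j * eta_inv m j f))))
          = gmult (gtw (wpar m [c]) (h c a)) (gscal (eta_inv m e a * (\<Sum>j<?N. eta m c j * eta_inv m j f)))"
          by (simp only: gmult_sum_right[symmetric] gscal_sum[symmetric] sum_distrib_left[symmetric])
        then show ?case
          using sum_eta_eta_inv[of c m n f] c by simp
      qed
      also have "\<dots> = (\<Sum>a<?N. gmult (gtw (wpar m [f]) (h f a)) (gscal (eta_inv m e a)))"
        using f by (simp only: sum.delta finite_lessThan lessThan_iff if_True)
      finally show ?thesis .
    qed
    have "(\<Sum>e<?N. \<Sum>a<?N. gmult (gmult (h d e) (gtw (wpar m [f]) (h f a))) (gscal (eta_inv m e a)))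
        = (\<Sum>e<?N. gmult (h d e) (\<Sum>j<?N. gmult (Q e j) (gscal (eta_inv m j f))))"
      unfolding Qf gmult_sum_right gmult_assoc ..
    also have "\<dots> = (\<Sum>j<?N. gmult (\<Sum>e<?N. gmult (h d e) (Q e j)) (gscal (eta_inv m j f)))"
      unfolding gmult_sum_right gmult_sum_left gmult_assoc by (rule sum.swap)
    also have "\<dots> = (\<Sum>j<?N. if j = d then gscal (eta_inv m j f) else 0)"
      using right[OF d] by (intro sum.cong refl) auto
    also have "\<dots> = gscal (eta_inv m d f)"
      using d by (simp only: sum.delta finite_lessThan lessThan_iff if_True)
    finally show ?thesis .
  qed
  \<comment> \<open>In \<open>U1\<close> the two entries of \<open>W\<close> stand in the order
    opposite to \<open>gpow\<close>. Supercommuting them and transposing \<open>eta_inv\<close>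
    gives the invariance of \<open>c0\<close>.\<close>
  have U2: "(\<Sum>a<?N. \<Sum>e<?N. gmult (gmult (gtw (wpar m [d]) (h f a)) (h d e)) (gscal (eta_inv m a e))) = gscal (eta_inv m f d)"
    if d: "d < ?N" and f: "f < ?N" for d f
  proof -
    have termwise: "gmult (gmult (gtw (wpar m [d]) (h f a)) (h d e)) (gscal (eta_inv m a e))
      = gmult (gscal (if m \<le> f then - 1 else 1)) (gmult (gmult (h d e) (gtw (wpar m [f]) (h f a))) (gscal (eta_inv m e a)))"
      if a: "a < ?N" and e: "e < ?N" for a e
    proof (cases "eta_inv m a e = 0")
      case True
      then have "eta_inv m e a = 0" using eta_inv_sym[of m e a] by simp
      then show ?thesis using True by simp
    next
      case False
      then have ae: "m \<le> e \<longleftrightarrow> m \<le> a" using eta_inv_parity by blast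
      let ?A = "h f a" and ?B = "h d e"
      have A: "gelem ?A" "ghom (wpar m [f] + wpar m [a]) ?A" and B: "gelem ?B" "ghom (wpar m [d] + wpar m [e]) ?B"
        using h a e d f by blast+
      have "gmult ?B ?A = gmult (gtw (wpar m [d] + wpar m [e]) ?A) ?B" by (rule gmult_supercommute[OF B(2)])
      then have BA: "gmult ?B ?A = gmult (if odd (wpar m [f] + wpar m [a]) \<and> odd (wpar m [d] + wpar m [e]) then - ?A else ?A) ?B"
        by (simp only: gtw_ghom[OF A(2)])
      have g: "gelem (gmult ?A ?B)" using A B by simp
      have s: "gscal (eta_inv m e a) = (if m \<le> a then - gscal (eta_inv m a e) else gscal (eta_inv m a e))"
        using eta_inv_sym[of m e a] ae by (simp add: gscal_minus)
      show ?thesis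
        unfolding gtw_ghom[OF A(2)] s
        by (cases "m \<le> a"; cases "m \<le> d"; cases "m \<le> f")
          (simp_all add: wpar_singleton ae BA gmult_minus_left gmult_minus_right gmult_gscal_uminus g flip: gone_def)
    qed
    have sgn: "(if m \<le> f then - 1 else 1) * eta_inv m d f = eta_inv m f d"
      using eta_inv_parity[of m f d] eta_inv_sym[of m d f] by (cases "eta_inv m f d = 0") auto
    have "(\<Sum>a<?N. \<Sum>e<?N. gmult (gmult (gtw (wpar m [d]) (h f a)) (h d e)) (gscal (eta_inv m a e)))
      = gmult (gscal (if m \<le> f then - 1 else 1))
        (\<Sum>e<?N. \<Sum>a<?N. gmult (gmult (h d e) (gtw (wpar m [f]) (h f a))) (gscal (eta_inv m e a)))"
      unfolding gmult_sum_right by (subst sum.swap) (intro sum.cong refl, simp add: termwise)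
    also have "\<dots> = gscal (eta_inv m f d)"
      by (simp only: U1[OF d f] gscal_mult[symmetric] sgn)
    finally show ?thesis .
  qed
  show ?thesis
    unfolding intertwines_def
  proof (intro ballI, goal_cases)
    case (1 u v)
    then obtain f d where fd: "u = []" "v = [f, d]" "f < ?N" "d < ?N" by (auto simp: words_2)
    have "(\<Sum>w\<in>words m n 2. gmult (gpow m W 2 v w) (gscal (dval m dU 0 2 u w)))
      = (\<Sum>a<?N. \<Sum>e<?N. gmult (gmult (gtw (wpar m [d]) (h f a)) (h d e)) (gscal (eta_inv m a e)))"
      unfolding sum_words_2 fd using fd by (intro sum.cong refl) (simp add: dval_dU gpow_2[OF W] h_def)
    then show ?case
      using U2 fd by (simp add: dval_dU)
  qed
qed

text \<open>Membership in the group is translated into matrices: evenness makes the entries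
  homogeneous, invariance on basis vectors gives \<open>form\<close>, and bijectivity gives
  \<open>surj\<close>.\<close>

lemma osp_matrix:
  assumes g: "is_osp m n g"
  defines "W \<equiv> \<lambda>v u. g (vbasis u) v"
  shows "even_matrix m n 1 W"
    and "brauer k l D \<Longrightarrow> intertwines m n W k l D"
    and "x \<in> tens m n r \<Longrightarrow> gtpow m n g r x = app m n r r (gpow m W r) x"
proof -
  let ?N = "m + 2 * n"
  have lin: "is_lin m n 1 1 g" and ev: "\<And>x. x \<in> tens m n 1 \<Longrightarrow> mev m g x = g x"
    and bij: "bij_betw g (tens m n 1) (tens m n 1)"
    and inv: "\<And>x y. x \<in> tens m n 1 \<Longrightarrow> y \<in> tens m n 1 \<Longrightarrow> vform m n (g x) (g y) = vform m n x y"
    using g by (auto simp: is_osp_def)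
  have vb: "vbasis [a] \<in> tens m n 1" if "a < ?N" for a
    using that by (intro vbasis_tens) (simp add: words_1[simplified])
  show W: "even_matrix m n 1 W"
    unfolding even_matrix_def W_def
  proof (intro ballI conjI)
    fix u v assume u: "u \<in> words m n 1"
    show "gelem (g (vbasis u) v)" using is_lin_tens[OF lin vbasis_tens[OF u]] by (rule tens_gelem)
    have "g (vbasis u) v = gpart (wpar m v + wpar m u) (g (vbasis u) v)"
      using mev_vbasis(1)[where g = g, OF is_lin_0[OF lin], of m u v] ev[OF vbasis_tens[OF u]] by simp
    then show "ghom (wpar m v + wpar m u) (g (vbasis u) v)"
      by (metis ghom_gpart)
  qed
  have form: "(\<Sum>c<?N. \<Sum>d<?N. gmult (gscal (eta m c d)) (gmult (gtw (wpar m [d]) (W [c] [a])) (W [d] [b])))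
        = gscal (eta m a b)" if a: "a < ?N" and b: "b < ?N" for a b
  proof -
    have "vform m n (vbasis [a]) (vbasis [b]) = (\<Sum>c<?N. \<Sum>d<?N. if d = b then if c = a then gscal (eta m a b) else 0 else 0)"
      unfolding vform_def by (intro sum.cong refl) (auto simp: vbasis_def gflipw_gtw)
    also have "\<dots> = gscal (eta m a b)"
      using a b by (simp only: sum.delta finite_lessThan lessThan_iff if_True)
    finally show ?thesis
      using inv[OF vb[OF a] vb[OF b]] by (simp add: vform_def W_def gflipw_gtw)
  qed
  have surj: "\<exists>x. (\<forall>b. gelem (x b)) \<and>
      (\<forall>d<?N. (\<Sum>b<?N. gmult (W [d] [b]) (x b)) = (if d = j then gone else 0))" if j: "j < ?N" for j
  proof -
    \<comment> \<open>The coordinates of the preimage of a basis vector form the required column of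
      the inverse matrix.\<close>
    obtain x where x: "x \<in> tens m n 1" "g x = vbasis [j]"
      using bij vb[OF j] unfolding bij_betw_def by (metis imageE)
    have "(\<Sum>b<?N. gmult (W [d] [b]) (x [b])) = (if d = j then gone else 0)" if "d < ?N" for d
    proof -
      have "vbasis [j] [d] = app m n 1 1 W x [d]"
        using is_lin_eq_app[OF lin x(1)] x(2) by (simp add: W_def)
      moreover have "[d] \<in> words m n 1" using that by (simp add: words_1[simplified])
      ultimately show ?thesis
        unfolding app_def sum_words_1 by (auto simp: vbasis_def)
    qed
    then show ?thesis using tens_gelem[OF x(1)] by (intro exI[of _ "\<lambda>b. x [b]"]) simp
  qed
  show "intertwines m n W k l D" if "brauer k l D"
    using that
  proof (induction rule: brauer_induct)
    case empty
    then show ?case by (simp add: intertwines_def dval_did)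
  next
    case (comp k l q D1 D2)
    then show ?case by (intro intertwines_dcomp)
  next
    case (tens k l k' l' D D')
    then show ?case by (intro intertwines_dtens[OF W])
  qed (rule intertwines_dI[OF W] intertwines_dX[OF W] intertwines_dA[OF W form] intertwines_dU[OF W form surj];
      assumption)+
  have ge: "gelem (gpow m W r v u)" if "u \<in> words m n r" "v \<in> words m n r" for r u v
    using even_matrix_gpow[OF W, of r] that by (simp add: even_matrix_def)
  have "is_lin m n r r (gtpow m n g r) \<and> (\<forall>x\<in>tens m n r. gtpow m n g r x = app m n r r (gpow m W r) x)" for r
  proof (induction r)
    case 0
    have "x = app m n 0 0 (gpow m W 0) x" if "x \<in> tens m n 0" for x
    proof
      fix w
      show "x w = app m n 0 0 (gpow m W 0) x w"
        using tens_gelem[OF that] tens_outside[OF that, of w] by (auto simp: app_def)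
    qed
    then show ?case by (simp add: is_lin_def)
  next
    case (Suc r)
    have eq: "gtpow m n g (Suc r) x = app m n (r + 1) (r + 1) (gpow m W (Suc r)) x" for x
    proof -
      have "gtpow m n g (Suc r) x = app m n (r + 1) (r + 1) (\<lambda>z w.
          gmult (gtw (wpar m (drop r z)) (gtpow m n g r (vbasis (take r w)) (take r z)))
            (twist (wpar m (drop r z) + wpar m (drop r w)) (wpar m (take r w)) (g (vbasis (drop r w)) (drop r z)))) x"
        using mtens_eq_app[OF conjunct1[OF Suc] lin] by simp
      also have "\<dots> = app m n (r + 1) (r + 1) (gpow m W (Suc r)) x"
      proof (rule fun_cong[OF app_cong], goal_cases)
        case (1 w z)
        have t: "take r w \<in> words m n r" "drop r w \<in> words m n 1" "take r z \<in> words m n r" "drop r z \<in> words m n 1"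
          using 1 words_take_drop[of _ m n r 1] by auto
        have "gtpow m n g r (vbasis (take r w)) (take r z) = gpow m W r (take r z) (take r w)"
          using conjunct2[OF Suc] vbasis_tens[OF t(1)] app_vbasis[OF ge t(1) t(3)] by simp
        moreover have "twist (wpar m (drop r z) + wpar m (drop r w)) (wpar m (take r w)) (g (vbasis (drop r w)) (drop r z))
            = W (drop r z) (drop r w)"
          using W t by (simp add: W_def even_matrix_def twist_ghom)
        ultimately show ?case
          by (simp add: tmat_def)
      qed
      finally show ?thesis .
    qed
    have "gtpow m n g (Suc r) = app m n (Suc r) (Suc r) (gpow m W (Suc r))"
      using eq by (intro ext) simp
    moreover have "is_lin m n (Suc r) (Suc r) (app m n (Suc r) (Suc r) (gpow m W (Suc r)))"
      by (rule is_lin_app) (rule ge)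
    ultimately show ?case by simp
  qed
  then show "x \<in> tens m n r \<Longrightarrow> gtpow m n g r x = app m n r r (gpow m W r) x" by blast
qed

lemma equivariant_brauer_rep:
  assumes c: "c \<in> bmor k l"
  shows "equivariant m n k l (brauer_rep m n k l c)"
  unfolding equivariant_def
proof (intro allI impI ballI)
  fix g x assume g: "is_osp m n g" and x: "x \<in> tens m n k"
  define W where "W = (\<lambda>v u. g (vbasis u) v)"
  note W = osp_matrix[OF g, folded W_def]
  have "(\<Sum>w\<in>words m n k. gmult (Fmat m k l c v w) (gpow m W k w u))
      = (\<Sum>w\<in>words m n l. gmult (gpow m W l v w) (Fmat m k l c w u))"
    if u: "u \<in> words m n k" and v: "v \<in> words m n l" for u v
  proof -
    have "(\<Sum>w\<in>words m n k. gmult (Fmat m k l c v w) (gpow m W k w u))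
        = (\<Sum>D\<in>diagrams k l. gmult (gtw (wpar m v) (c D))
            (\<Sum>w\<in>words m n k. gmult (gscal (dval m D k l w v)) (gpow m W k w u)))"
      unfolding Fmat_def gmult_sum_left gmult_sum_right gmult_assoc by (rule sum.swap)
    also have "\<dots> = (\<Sum>D\<in>diagrams k l. gmult (gtw (wpar m v) (c D))
            (\<Sum>w\<in>words m n l. gmult (gpow m W l v w) (gscal (dval m D k l u w))))"
      using W(2)[of k l] u v by (intro sum.cong refl) (simp add: intertwines_def diagrams_def)
    also have "\<dots> = (\<Sum>D\<in>diagrams k l. \<Sum>w\<in>words m n l.
            gmult (gpow m W l v w) (gmult (gtw (wpar m w) (c D)) (gscal (dval m D k l u w))))"
      unfolding gmult_sum_right
    proof (intro sum.cong refl, goal_cases)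
      case w: (1 D w)
      \<comment> \<open>An entry whose degree is the parity of \<open>v\<close> plus that of
        \<open>w\<close> passes a coefficient twisted by \<open>w\<close>; the two contributions of
        \<open>w\<close> cancel and the twist by \<open>v\<close> remains.\<close>
      have "ghom (wpar m v + wpar m w) (gpow m W l v w)"
        using even_matrix_gpow[OF W(1), of l] v w by (simp add: even_matrix_def)
      then have "gmult (gpow m W l v w) (gtw (wpar m w) (c D))
          = gmult (gtw (wpar m v + wpar m w + wpar m w) (c D)) (gpow m W l v w)"
        by (simp add: gmult_supercommute[of "wpar m v + wpar m w"] gtw_gtw)
      also have "gtw (wpar m v + wpar m w + wpar m w) = gtw (wpar m v)"
        by (rule gtw_cong_parity) auto
      finally show ?case
        by (simp add: gmult_assoc[symmetric])
    qed
    also have "\<dots> = (\<Sum>w\<in>words m n l. gmult (gpow m W l v w) (Fmat m k l c w u))"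
      unfolding Fmat_def gmult_sum_right by (rule sum.swap)
    finally show ?thesis .
  qed
  then have "brauer_rep m n k l c (app m n k k (gpow m W k) x)
      = app m n l l (gpow m W l) (brauer_rep m n k l c x)"
    unfolding brauer_rep_def app_app by (intro fun_cong[OF app_cong])
  then show "brauer_rep m n k l c (gtpow m n g k x) = gtpow m n g l (brauer_rep m n k l c x)"
    using W(3) x is_lin_tens[OF is_lin_brauer_rep[OF c] x] by simp
qed

lemma brauer_functor_brauer_rep: "brauer_functor m n (brauer_rep m n)"
  unfolding brauer_functor_def Let_def
  using is_lin_brauer_rep equivariant_brauer_rep brauer_rep_add brauer_rep_bsmul brauer_rep_did
    brauer_rep_bcomp brauer_rep_dX brauer_rep_dU brauer_rep_dA brauer_rep_btens
  by (auto simp: dI_def)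

section \<open>Uniqueness of the functor\<close>

lemma bdiag_bmor: "brauer k l D \<Longrightarrow> bdiag D \<in> bmor k l"
  by (auto simp: bmor_def bdiag_def diagrams_def)

text \<open>With loops the right-hand side would carry a power of \<delta>; the compositions
  supplied by \<open>brauer_induct\<close> are loop-free.\<close>

lemma bcomp_bdiag:
  assumes "brauer k l D1" "brauer l q D2" "dloops k l q D2 D1 = 0"
  shows "bcomp \<delta> k l q (bdiag D2) (bdiag D1) = bdiag (dcomp k l q D2 D1)"
proof
  fix E
  have D: "D1 \<in> diagrams k l" "D2 \<in> diagrams l q" using assms by (auto simp: diagrams_def)
  have "bcomp \<delta> k l q (bdiag D2) (bdiag D1) E = (\<Sum>C1\<in>diagrams k l. \<Sum>C2\<in>diagrams l q.
      if C2 = D2 then if C1 = D1 then bdiag (dcomp k l q D2 D1) E else 0 else 0)"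
    unfolding bcomp_def using assms(3) by (intro sum.cong refl) (auto simp: bdiag_def)
  also have "\<dots> = bdiag (dcomp k l q D2 D1) E"
    using D by (simp only: sum.delta finite_diagrams if_True)
  finally show "bcomp \<delta> k l q (bdiag D2) (bdiag D1) E = bdiag (dcomp k l q D2 D1) E" .
qed

lemma btens_bdiag:
  assumes "brauer k l D" "brauer k' l' D'"
  shows "btens k l k' l' (bdiag D) (bdiag D') = bdiag (dtens k l k' l' D D')"
proof
  fix E
  have D: "D \<in> diagrams k l" "D' \<in> diagrams k' l'" using assms by (auto simp: diagrams_def)
  have "btens k l k' l' (bdiag D) (bdiag D') E = (\<Sum>C\<in>diagrams k l. \<Sum>C'\<in>diagrams k' l'.
      if C' = D' then if C = D then bdiag (dtens k l k' l' D D') E else 0 else 0)"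
    unfolding btens_def by (intro sum.cong refl) (auto simp: bdiag_def)
  also have "\<dots> = bdiag (dtens k l k' l' D D') E"
    using D by (simp only: sum.delta finite_diagrams if_True)
  finally show "btens k l k' l' (bdiag D) (bdiag D') E = bdiag (dtens k l k' l' D D') E" .
qed

lemma bsmul_bdiag_bmor: "D \<in> diagrams k l \<Longrightarrow> gelem a \<Longrightarrow> bsmul a (bdiag D) \<in> bmor k l"
  by (auto simp: bmor_def bsmul_def bdiag_def)

lemma bmor_decomp:
  assumes c: "c \<in> bmor k l"
  shows "c = (\<Sum>D\<in>diagrams k l. bsmul (c D) (bdiag D))"
proof
  fix E
  have "(\<Sum>D\<in>diagrams k l. bsmul (c D) (bdiag D)) E = (\<Sum>D\<in>diagrams k l. bsmul (c D) (bdiag D) E)"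
    by (rule sum_fun_apply)
  also have "\<dots> = (\<Sum>D\<in>diagrams k l. if E = D then c D else 0)"
    using bmor_gelem[OF c] by (intro sum.cong refl) (auto simp: bsmul_def bdiag_def)
  also have "\<dots> = c E"
    using c by (auto simp: sum.delta' bmor_def)
  finally show "c E = (\<Sum>D\<in>diagrams k l. bsmul (c D) (bdiag D)) E" ..
qed

text \<open>The axioms constrain a functor only on \<open>bmor\<close> and \<open>tens\<close>, so
  two functors can be compared only there. Single diagrams are settled by generation, linear
  combinations by additivity and scalar multiplication.\<close>

lemma brauer_functor_unique:
  assumes F: "brauer_functor m n F" and F': "brauer_functor m n F'"
    and c: "c \<in> bmor k l" and x: "x \<in> tens m n k"
  shows "F' k l c x = F k l c x"
proof -
  note ax = F[unfolded brauer_functor_def Let_def] F'[unfolded brauer_functor_def Let_def]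
  have lin: "is_lin m n k l (H k l c)" if "brauer_functor m n H" "c \<in> bmor k l" for H k l c
    using that unfolding brauer_functor_def Let_def by simp
  have diag: "\<forall>x\<in>tens m n k. F' k l (bdiag D) x = F k l (bdiag D) x" if "brauer k l D" for k l D
    using that
  proof (induction rule: brauer_induct)
    case (comp k l q D1 D2)
    note b = bdiag_bmor[OF comp.hyps(1)] bdiag_bmor[OF comp.hyps(2)]
    have "H k q (bdiag (dcomp k l q D2 D1)) x = H l q (bdiag D2) (H k l (bdiag D1) x)"
      if "brauer_functor m n H" "x \<in> tens m n k" for H x
      using that b bcomp_bdiag[OF comp.hyps, of "gscal (of_int (int m - 2 * int n))"]
      unfolding brauer_functor_def Let_def by metis
    then show ?case
      using comp.IH F F' is_lin_tens[OF lin[OF F b(1)]] by simp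
  next
    case (tens k l k' l' D D')
    note b = bdiag_bmor[OF tens(1)] bdiag_bmor[OF tens(2)]
    have H: "H (k + k') (l + l') (bdiag (dtens k l k' l' D D')) x = mtens m n k l k' (H k l (bdiag D)) (H k' l' (bdiag D')) x"
      if "brauer_functor m n H" "x \<in> tens m n (k + k')" for H x
      using that b btens_bdiag[OF tens(1,2)] unfolding brauer_functor_def Let_def by metis
    show ?case
    proof
      fix x assume x: "x \<in> tens m n (k + k')"
      \<comment> \<open>The tensor product of two linear maps depends only on their values at basis
        tensors, where the induction hypotheses apply.\<close>
      show "F' (k + k') (l + l') (bdiag (dtens k l k' l' D D')) x = F (k + k') (l + l') (bdiag (dtens k l k' l' D D')) x"
        unfolding H[OF F x] H[OF F' x] mtens_eq_app[OF lin[OF F b(1)] lin[OF F b(2)]]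
          mtens_eq_app[OF lin[OF F' b(1)] lin[OF F' b(2)]]
      proof (rule fun_cong[OF app_cong], goal_cases)
        case (1 w z)
        then have "vbasis (take k w) \<in> tens m n k" "vbasis (drop k w) \<in> tens m n k'"
          by (auto simp: words_take_drop intro: vbasis_tens)
        then show ?case
          using tens(3,4) by simp
      qed
    qed
  qed (use ax in \<open>simp_all\<close>)
  have add: "H k l (c + c') x = H k l c x + H k l c' x" if "brauer_functor m n H" "c \<in> bmor k l" "c' \<in> bmor k l" for H c c'
    using that x unfolding brauer_functor_def Let_def by simp
  have smul: "H k l (bsmul a c) x = lsmul m a (H k l c x)" if "brauer_functor m n H" "gelem a" "c \<in> bmor k l" for H a c
    using that x unfolding brauer_functor_def Let_def by simp
  have zero_bmor: "0 \<in> bmor k l" by (simp add: bmor_def)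
  have zero: "H k l 0 x = 0" if "brauer_functor m n H" for H
    using add[OF that zero_bmor zero_bmor] by simp
  have "(\<Sum>D\<in>A. bsmul (c D) (bdiag D)) \<in> bmor k l \<and>
      F' k l (\<Sum>D\<in>A. bsmul (c D) (bdiag D)) x = F k l (\<Sum>D\<in>A. bsmul (c D) (bdiag D)) x"
    if "finite A" "A \<subseteq> diagrams k l" for A
    using that
  proof (induction rule: finite_induct)
    case empty
    show ?case unfolding sum.empty zero[OF F] zero[OF F'] using zero_bmor by blast
  next
    case (insert D A)
    let ?s = "\<Sum>D\<in>A. bsmul (c D) (bdiag D)" and ?t = "bsmul (c D) (bdiag D)"
    have D: "D \<in> diagrams k l" "brauer k l D" using insert.prems by (auto simp: diagrams_def)
    have IH: "?s \<in> bmor k l" "F' k l ?s x = F k l ?s x" using insert by auto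
    have t: "?t \<in> bmor k l" by (rule bsmul_bdiag_bmor[OF D(1) bmor_gelem[OF c]])
    have "F' k l ?t x = F k l ?t x"
      using smul[OF F bmor_gelem[OF c] bdiag_bmor[OF D(2)]] smul[OF F' bmor_gelem[OF c] bdiag_bmor[OF D(2)]]
        diag[OF D(2)] x by simp
    then have "F' k l (?t + ?s) x = F k l (?t + ?s) x"
      using add[OF F t IH(1)] add[OF F' t IH(1)] IH(2) by simp
    moreover have "?t + ?s \<in> bmor k l" using t IH(1) by (simp add: bmor_def)
    ultimately show ?case unfolding sum.insert[OF insert.hyps] by blast
  qed
  from this[of "diagrams k l"] show ?thesis
    unfolding bmor_decomp[OF c, symmetric] by simp
qed

theorem theorem5p4:
  fixes m n :: nat
  shows "\<exists>F. brauer_functor m n F \<and>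
           (\<forall>F'. brauer_functor m n F' \<longrightarrow>
              (\<forall>k l c x. c \<in> bmor k l \<longrightarrow> x \<in> tens m n k \<longrightarrow> F' k l c x = F k l c x))"
  using brauer_functor_brauer_rep brauer_functor_unique by blast

end
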